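(* Let $\mathscr B=\{b_1,b_2,\dots\}\subset\{2,3,\dots\}$ be infinite and pairwise coprime with $\sum_{b\in\mathscr B}\frac1b<\infty$, and suppose $b_1=2$. Let $a_{00},a_{01},a_1\in\mathbb R$ and let $\phi=a_{00}\mathbf 1_{[00]}+a_{01}\mathbf 1_{[01]}+a_1\mathbf 1_{[1]}$ on the $\mathscr B$-free subshift $(X_\eta,S)$. Put $$p=\frac{2^{2a_{00}}}{2^{a_1+a_{01}}+2^{2a_{00}}}.$$ Then $\nu_\eta*B_{p,1-p}$ is the unique equilibrium state for $\phi$, and it is not a Gibbs measure for $\phi$.
   Context: $S$ is the left shift on $\{0,1\}^{\mathbb Z}$. For a subshift $(X,S)$, $\mathcal M(X,S)$ is the set of $S$-invariant Borel probability measures on $X$; $\mathcal L_n(X)$ is the set of words $[w_0\cdots w_{n-1}]$ such that some $x\in X$ has $x_i=w_i$ for $0\le i\le n-1$, and a word $W$ of length $n$ also denotes the cylinder $\{x\in X:x_0\cdots x_{n-1}=W\}$ (so $[01]=\{x:x_0=0,x_1=1\}$, etc.). Logarithms are to base 2. $\mathscr B$-free subshift: $\mathcal F_{\mathscr B}=\mathbb Z\setminus\bigcup_{b\in\mathscr B}b\mathbb Z$, $\eta=\mathbf 1_{\mathcal F_{\mathscr B}}\in\{0,1\}^{\mathbb Z}$, and $X_\eta$ is the set of all $y\in\{0,1\}^{\mathbb Z}$ such that every finite block of consecutive coordinates of $y$ occurs as a block in $\eta$. Under the hypotheses above $X_\eta$ is hereditary, i.e. $x\in X_\eta$ and $y\le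 x$ coordinatewise imply $y\in X_\eta$. Mirsky measure: let $\Omega=\prod_{i\ge1}\mathbb Z/b_i\mathbb Z$ with normalized Haar measure $\mathbb P$, and define $\varphi:\Omega\to\{0,1\}^{\mathbb Z}$ by $\varphi(\omega)(n)=1$ if $\omega(i)+n\not\equiv0\bmod b_i$ for all $i\ge1$, and $\varphi(\omega)(n)=0$ otherwise. Then $\nu_\eta=\mathbb P\circ\varphi^{-1}$, an $S$-invariant measure on $X_\eta$. $B_{p,1-p}$ is the Bernoulli measure on $\{0,1\}^{\mathbb Z}$ with $B_{p,1-p}([0])=p$, $B_{p,1-p}([1])=1-p$. $\nu_\eta*B_{p,1-p}$ is the image of $\nu_\eta\otimes B_{p,1-p}$ under $(x,y)\mapsto(x_iy_i)_{i\in\mathbb Z}$, a measure on $X_\eta$. Topological pressure: $P(X,\phi)=\lim_n\frac1n\log\sum_{W\in\mathcal L_n(X)}2^{\sup_{x\in W}\sum_{i=0}^{n-1}\phi(S^ix)}$. Measure entropy: $h_\mu(X,S)=\lim_n\frac1n\big(-\sum_{W\in\mathcal L_n(X)}\mu(W)\log\mu(W)\big)$. A measure $\mu\in\mathcal M(X,S)$ is an equilibrium state for $\phi$ if $P(X,\phi)=h_\mu(X,S)+\int\phi\,d\mu$. Gibbs measure: $\mu\in\mathcal M(X,S)$ is a Gibbs measure for $\phi$ if there exist $P=P(X,\phi)\ge0$ and $c>0$ such that for all $n\in\mathbb N$, every word $C\in\mathcal L_n(X)$ with $\mu(C)>0$ and every $x\in C$, $c^{-1}\le\mu(C)\big/2^{\sum_{i=0}^{n-1}\phi(S^ix)-nP}\le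 c$; the constant $P$ here is the topological pressure of $\phi$ on $(X,S)$. *)

theory Defs
  imports "HOL-Probability.Probability"
begin

instance bool :: second_countable_topology
proof
  have ob: "open S" for S :: "bool set"
  proof -
    have "closed (UNIV - S)" by (rule finite_imp_closed) simp
    then show ?thesis by (simp add: closed_def Compl_eq_Diff_UNIV[symmetric])
  qed
  show "\<exists>B::bool set set. countable B \<and> open = generate_topology B"
  proof (intro exI conjI ext iffI)
    show "countable (UNIV::bool set set)" by simp
  qed (auto intro: generate_topology.Basis ob)
qed

type_synonym config = "int \<Rightarrow> bool"

definition shift :: "config \<Rightarrow> config" where
  "shift x = (\<lambda>i. x (i + 1))"

definition cylinder :: "config set \<Rightarrow> bool list \<Rightarrow> config set" where
  "cylinder X w = {x \<in> X. \<forall>i < length w. x (int i) = w ! i}"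

definition language :: "nat \<Rightarrow> config set \<Rightarrow> bool list set" where
  "language n X = {w. length w = n \<and> (\<exists>x\<in>X. \<forall>i<n. x (int i) = w ! i)}"

text \<open>The topology on \<^typ>\<open>config\<close> is the product of discrete topologies.  A Borel probability
  measure on \<open>X\<close> is encoded as a Borel probability measure on the full shift giving mass 1
  to \<open>X\<close>.\<close>

definition invariant_measures :: "config set \<Rightarrow> config measure set" where
  "invariant_measures X =
     {\<mu>. prob_space \<mu> \<and> sets \<mu> = sets borel \<and> measure \<mu> X = 1 \<and> distr \<mu> borel shift = \<mu>}"

definition birkhoff_sum :: "nat \<Rightarrow> (config \<Rightarrow> real) \<Rightarrow> config \<Rightarrow> real" where
  "birkhoff_sum n \<phi> x = (\<Sum>i<n. \<phi> ((shift ^^ i) x))"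

definition pressure :: "config set \<Rightarrow> (config \<Rightarrow> real) \<Rightarrow> real" where
  "pressure X \<phi> =
     lim (\<lambda>n. 1 / real n *
       log 2 (\<Sum>w\<in>language n X. 2 powr (SUP x\<in>cylinder X w. birkhoff_sum n \<phi> x)))"

text \<open>The convention \<open>0 log 0 = 0\<close> is built in, since the product vanishes.\<close>

definition measure_entropy :: "config set \<Rightarrow> config measure \<Rightarrow> real" where
  "measure_entropy X \<mu> =
     lim (\<lambda>n. 1 / real n *
       (- (\<Sum>w\<in>language n X. measure \<mu> (cylinder X w) * log 2 (measure \<mu> (cylinder X w)))))"

definition equilibrium_state :: "config set \<Rightarrow> (config \<Rightarrow> real) \<Rightarrow> config measure \<Rightarrow> bool" where
  "equilibrium_state X \<phi> \<mu> \<longleftrightarrow>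
     \<mu> \<in> invariant_measures X \<and> pressure X \<phi> = measure_entropy X \<mu> + (\<integral>x. \<phi> x \<partial>\<mu>)"

definition gibbs_measure :: "config set \<Rightarrow> (config \<Rightarrow> real) \<Rightarrow> config measure \<Rightarrow> bool" where
  "gibbs_measure X \<phi> \<mu> \<longleftrightarrow>
     \<mu> \<in> invariant_measures X \<and>
     (\<exists>P c. P = pressure X \<phi> \<and> P \<ge> 0 \<and> c > 0 \<and>
       (\<forall>n. \<forall>w\<in>language n X. measure \<mu> (cylinder X w) > 0 \<longrightarrow>
         (\<forall>x\<in>cylinder X w.
            inverse c \<le> measure \<mu> (cylinder X w) / 2 powr (birkhoff_sum n \<phi> x - real n * P) \<and>
            measure \<mu> (cylinder X w) / 2 powr (birkhoff_sum n \<phi> x - real n * P) \<le> c)))"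

definition free_numbers :: "nat set \<Rightarrow> int set" where
  "free_numbers B = UNIV - (\<Union>b\<in>B. {int b * k | k. True})"

definition eta :: "nat set \<Rightarrow> config" where
  "eta B = (\<lambda>n. n \<in> free_numbers B)"

definition free_subshift :: "nat set \<Rightarrow> config set" where
  "free_subshift B = {y. \<forall>i n. \<exists>j. \<forall>k<n. y (i + int k) = eta B (j + int k)}"

text \<open>The residue classes modulo \<open>b i\<close> are represented by \<open>0, \<dots>, b i - 1\<close>; normalized Haar
  measure on the compact group of all residue sequences is the product of the uniform measures.
  Sequences are indexed from 0.\<close>

definition residue_haar :: "(nat \<Rightarrow> nat) \<Rightarrow> (nat \<Rightarrow> int) measure" where
  "residue_haar b = (\<Pi>\<^sub>M i\<in>UNIV. uniform_count_measure {0..<int (b i)})"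

definition residue_coding :: "(nat \<Rightarrow> nat) \<Rightarrow> (nat \<Rightarrow> int) \<Rightarrow> config" where
  "residue_coding b \<omega> = (\<lambda>n. \<forall>i. (\<omega> i + n) mod int (b i) \<noteq> 0)"

definition mirsky_measure :: "(nat \<Rightarrow> nat) \<Rightarrow> config measure" where
  "mirsky_measure b = distr (residue_haar b) borel (residue_coding b)"

text \<open>The argument \<open>p\<close> is the probability of the symbol 0, i.e. of \<^const>\<open>False\<close>.\<close>

definition bernoulli_measure :: "real \<Rightarrow> config measure" where
  "bernoulli_measure p = (\<Pi>\<^sub>M i\<in>UNIV. measure_pmf (bernoulli_pmf (1 - p)))"

definition mult_convolution :: "config measure \<Rightarrow> config measure \<Rightarrow> config measure" where
  "mult_convolution \<mu> \<nu> = distr (\<mu> \<Otimes>\<^sub>M \<nu>) borel (\<lambda>(x, y) i. x i \<and> y i)"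

definition two_block_potential :: "config set \<Rightarrow> real \<Rightarrow> real \<Rightarrow> real \<Rightarrow> config \<Rightarrow> real" where
  "two_block_potential X a00 a01 a1 x =
     a00 * indicator (cylinder X [False, False]) x +
     a01 * indicator (cylinder X [False, True]) x +
     a1 * indicator (cylinder X [True]) x"

end

theory Submission
  imports Defs
begin

text \<open>
  Let \<open>\<beta> = a1 + a01 - 2 a00\<close>, \<open>s = 1 - p\<close> and \<open>L = log 2 (1 / (1 - s))\<close>; then
  \<open>\<beta> = log 2 (s / (1 - s))\<close>. As 2 is one of the moduli, no two ones are adjacent in the subshift, and
  there the potential differs from \<open>a00 + \<beta> x\<^sub>0\<close> by a coboundary (\<open>two_block_potential_linear\<close>). So one
  has to maximize entropy plus \<open>\<beta>\<close> times the frequency of ones; this part holds for arbitrary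
  pairwise coprime moduli with summable reciprocals.

  By \<open>free_subshift_iff\<close> the subshift consists of the configurations that miss a residue class of each
  modulus. Let \<open>d = (\<Prod>k. 1 - 1 / b k) > 0\<close>. A word of the language lies below the pattern of
  positions that a choice of residues leaves free. At most about \<open>d n\<close> of \<open>n\<close> positions are free, and
  some choices attain \<open>d n\<close>; each free position contributes a factor \<open>1 + 2 powr \<beta>\<close> to the
  partition sum. Hence the pressure is
  \<open>a00 + d L\<close> (\<open>pressure_counting\<close>).

  Uniqueness is the heart of the matter. Given an invariant measure, attach to a configuration a
  random residue class among those that it misses, for each of the first \<open>K\<close> moduli. The pair is
  stationary, the residues are uniformly distributed, and their finite number does not change the
  entropy rate. This rate is at most the entropy of one symbol given its past and the residues, and
  a position is free with probability \<open>d\<^sub>K = (\<Prod>k<K. 1 - 1 / b k)\<close>. A free symbol contributes at most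
  \<open>L\<close>, with a loss that is quadratic in the distance of its conditional probability from \<open>s\<close>
  (\<open>entropy_step_bound\<close>). So the free energy is at most \<open>d\<^sub>K L\<close> for all \<open>K\<close>, hence at most \<open>d L\<close>; and
  if it equals \<open>d L\<close>, then the losses are at most \<open>(d\<^sub>K - d) L\<close>, which tends to 0. In the limit the
  measure arises from the Mirsky measure by independent thinning with probability \<open>s\<close>
  (\<open>window_of_maximizer\<close>). Conversely, under the convolution the conditional probability of a 1 never
  exceeds \<open>s\<close>, which by concavity bounds its entropy from below (\<open>conv_free_energy\<close>).

  The Gibbs property fails on words \<open>W\<close> with at least the average number of ones. Such a word, if its
  length is suitable, misses only one class of each of the first \<open>K\<close> moduli
  (\<open>dense_window_determines_clock\<close>), so that the residue patterns above it have probability at most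
  \<open>1 / (\<Prod>k<K. b k)\<close>. Its measure is smaller than the Gibbs weight by this factor, which is
  arbitrarily small.
\<close>

section \<open>Entropy of a binary splitting\<close>

text \<open>The entropy of the binary law \<open>a : b\<close>, weighted by its mass \<open>a + b\<close>. The weighted form is
  homogeneous of degree one and needs no case distinction for a vanishing mass.\<close>

definition split_entropy :: "real \<Rightarrow> real \<Rightarrow> real" where
  "split_entropy a b = (a + b) * log 2 (a + b) - a * log 2 a - b * log 2 b"

lemma split_entropy_ln:
  "split_entropy a b * ln 2 = a * (ln (a + b) - ln a) + b * (ln (a + b) - ln b)"
  by (simp add: split_entropy_def log_def field_simps)

lemma split_entropy_0_left [simp]: "split_entropy 0 b = 0"
  by (simp add: split_entropy_def)

lemma split_entropy_nonneg:
  assumes "0 \<le> a" "0 \<le> b" shows "0 \<le> split_entropy a b"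
proof -
  have "0 \<le> a * (ln (a + b) - ln a)" if "0 \<le> a" "0 \<le> b" for a b :: real
    using that by (cases "a = 0") auto
  from this[OF assms] this[OF assms(2,1)] have "0 \<le> split_entropy a b * ln 2"
    by (simp add: split_entropy_ln add.commute)
  then show ?thesis by (simp add: zero_le_mult_iff)
qed

lemma xlnx_tangent:
  fixes a c A C :: real
  assumes "0 \<le> a" "a \<le> c" "0 < A" "0 < C"
  shows "a * (ln c - ln a) \<le> a * (ln C - ln A) + c * A / C - a"
proof (cases "a = 0")
  case True
  then show ?thesis using assms by simp
next
  case False
  then have a: "0 < a" "0 < c" using assms by auto
  have "ln (c * A / (a * C)) \<le> c * A / (a * C) - 1"
    using a assms by (intro ln_le_minus_one) simp
  then have "a * ln (c * A / (a * C)) \<le> a * (c * A / (a * C) - 1)"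
    using a by (intro mult_left_mono) auto
  moreover have eq1: "a * (c * A / (a * C) - 1) = c * A / C - a"
    using a by (simp add: right_diff_distrib)
  moreover have eq2: "ln (c * A / (a * C)) = (ln c - ln a) - (ln C - ln A)"
    using a assms by (simp add: ln_div ln_mult)
  ultimately have "a * ((ln c - ln a) - (ln C - ln A)) \<le> c * A / C - a" by metis
  then show ?thesis by (simp add: right_diff_distrib)
qed

lemma log_sum_inequality:
  fixes a a' c c' :: real
  assumes "0 \<le> a" "a \<le> c" "0 \<le> a'" "a' \<le> c'"
  shows "a * (ln c - ln a) + a' * (ln c' - ln a') \<le> (a + a') * (ln (c + c') - ln (a + a'))"
proof (cases "a + a' = 0")
  case True
  then show ?thesis using assms by (simp add: add_nonneg_eq_0_iff)
next
  case False
  then have pos: "0 < a + a'" "0 < c + c'" using assms by auto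
  have "c * (a + a') / (c + c') + c' * (a + a') / (c + c') = a + a'"
    using pos by (simp add: add_divide_distrib[symmetric] distrib_right[symmetric])
  then show ?thesis
    using xlnx_tangent[OF assms(1,2) pos] xlnx_tangent[OF assms(3,4) pos]
    by (simp add: algebra_simps)
qed

text \<open>Conditional entropy is concave in the joint distribution; as \<^const>\<open>split_entropy\<close> is
  homogeneous of degree one, concavity takes the form of superadditivity.\<close>

lemma split_entropy_superadditive:
  assumes "0 \<le> a" "0 \<le> b" "0 \<le> a'" "0 \<le> b'"
  shows "split_entropy a b + split_entropy a' b' \<le> split_entropy (a + a') (b + b')"
proof -
  have "(split_entropy a b + split_entropy a' b') * ln 2 \<le> split_entropy (a + a') (b + b') * ln 2"
    unfolding distrib_right split_entropy_ln
    using log_sum_inequality[of a "a + b" a' "a' + b'"] log_sum_inequality[of b "a + b" b' "a' + b'"] assms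
    by (simp add: algebra_simps)
  then show ?thesis by simp
qed

lemma xlnx_sqrt_bound:
  fixes a q :: real
  assumes "0 \<le> a" "0 < q"
  shows "a * (ln q - ln a) \<le> 2 * (sqrt a * sqrt q) - 2 * a"
proof (cases "a = 0")
  case False
  then have a: "0 < a" using assms by simp
  have "ln (sqrt q / sqrt a) \<le> sqrt q / sqrt a - 1"
    using a assms by (intro ln_le_minus_one) simp
  then have "a * ln (sqrt q / sqrt a) \<le> a * (sqrt q / sqrt a - 1)"
    using a by (intro mult_left_mono) auto
  also have "\<dots> = sqrt a * sqrt q - a"
    using a by (simp add: field_simps)
  finally show ?thesis
    using a assms by (simp add: ln_div ln_sqrt field_simps)
qed simp

text \<open>With the energy \<open>log 2 (s / (1 - s))\<close> for each unit of \<open>a\<close>, the splitting in proportion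
  \<open>s : 1 - s\<close> is optimal. Any other splitting loses at least its squared Hellinger distance from
  the optimal one, because \<open>ln x \<le> 2 (sqrt x - 1)\<close>, and this distance dominates the quadratic
  term below.\<close>

lemma split_entropy_deficit:
  fixes a b s :: real
  assumes "0 \<le> a" "0 \<le> b" "0 < a + b" "0 < s" "s < 1"
  shows "split_entropy a b + log 2 (s / (1 - s)) * a
    \<le> (a + b) * log 2 (1 / (1 - s)) - (a - s * (a + b))\<^sup>2 / (4 * (a + b))"
proof -
  define m where "m = a + b"
  define u v where "u = sqrt a" and "v = sqrt (s * m)"
  define u' v' where "u' = sqrt b" and "v' = sqrt ((1 - s) * m)"
  have m: "0 < m" using assms by (simp add: m_def)
  have sq: "u\<^sup>2 = a" "v\<^sup>2 = s * m" "u'\<^sup>2 = b" "v'\<^sup>2 = (1 - s) * m"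
    using assms m by (simp_all add: u_def v_def u'_def v'_def)
  have "a * (ln (s * m) - ln a) + b * (ln ((1 - s) * m) - ln b)
      \<le> 2 * (u * v) - 2 * a + (2 * (u' * v') - 2 * b)"
    unfolding u_def v_def u'_def v'_def
    using assms m by (intro add_mono xlnx_sqrt_bound) auto
  also have "\<dots> = - (u - v)\<^sup>2 - (u' - v')\<^sup>2"
    by (simp add: power2_diff sq m_def algebra_simps)
  also have "\<dots> \<le> - (u - v)\<^sup>2" by simp
  also have "(a - s * m)\<^sup>2 / (4 * m) \<le> (u - v)\<^sup>2"
  proof -
    have "u \<le> sqrt m" "v \<le> sqrt m" "0 \<le> u" "0 \<le> v"
      using assms m by (auto simp: u_def v_def m_def mult_le_cancel_right1 intro!: mult_nonneg_nonneg)
    then have "(u + v)\<^sup>2 \<le> (2 * sqrt m)\<^sup>2" by (intro power_mono) auto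
    then have "(u + v)\<^sup>2 \<le> 4 * m" using m by (simp add: power_mult_distrib)
    then have "(u - v)\<^sup>2 * (u + v)\<^sup>2 \<le> (u - v)\<^sup>2 * (4 * m)"
      by (intro mult_left_mono) auto
    moreover have "(u - v)\<^sup>2 * (u + v)\<^sup>2 = (a - s * m)\<^sup>2"
        unfolding sq[symmetric] by (simp add: power2_eq_square algebra_simps)
    ultimately show ?thesis using m by (simp add: field_simps)
  qed
  then have "- (u - v)\<^sup>2 \<le> - ((a - s * m)\<^sup>2 / (4 * m))" by simp
  also have "\<dots> \<le> - ((a - s * m)\<^sup>2 / (4 * m) * ln 2)"
  proof -
    have "(a - s * m)\<^sup>2 / (4 * m) * ln 2 \<le> (a - s * m)\<^sup>2 / (4 * m) * 1"
      using m ln_2_less_1 by (intro mult_left_mono) auto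
    then show ?thesis by simp
  qed
  finally have "a * (ln (s * m) - ln a) + b * (ln ((1 - s) * m) - ln b)
      \<le> - ((a - s * m)\<^sup>2 / (4 * m) * ln 2)" .
  moreover have "(split_entropy a b + log 2 (s / (1 - s)) * a - m * log 2 (1 / (1 - s))) * ln 2
     = a * (ln (s * m) - ln a) + b * (ln ((1 - s) * m) - ln b)"
  proof -
    have lns: "ln (s * m) = ln s + ln m" "ln ((1 - s) * m) = ln (1 - s) + ln m"
        "log 2 (s / (1 - s)) * ln 2 = ln s - ln (1 - s)" "log 2 (1 / (1 - s)) * ln 2 = - ln (1 - s)"
      using assms m by (simp_all add: log_def ln_mult ln_div)
    have "split_entropy a b * ln 2 + log 2 (s / (1 - s)) * ln 2 * a - m * (log 2 (1 / (1 - s)) * ln 2)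
        = a * (ln (s * m) - ln a) + b * (ln ((1 - s) * m) - ln b)"
      unfolding split_entropy_ln lns m_def[symmetric] using m_def by (simp add: algebra_simps)
    then show ?thesis by (simp add: algebra_simps)
  qed
  ultimately have "(split_entropy a b + log 2 (s / (1 - s)) * a - m * log 2 (1 / (1 - s))) * ln 2
     \<le> (- ((a - s * m)\<^sup>2 / (4 * m))) * ln 2"
    by simp
  then have "split_entropy a b + log 2 (s / (1 - s)) * a - m * log 2 (1 / (1 - s))
     \<le> - ((a - s * m)\<^sup>2 / (4 * m))"
    by (rule mult_right_le_imp_le) simp
  then show ?thesis by (simp add: m_def)
qed

lemma split_entropy_optimal:
  fixes s m :: real
  assumes "0 < s" "s < 1" "0 \<le> m"
  shows "split_entropy (s * m) ((1 - s) * m) + log 2 (s / (1 - s)) * (s * m) = m * log 2 (1 / (1 - s))"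
proof (cases "m = 0")
  case False
  with assms have m: "0 < m" by simp
  have sum: "s * m + (1 - s) * m = m" by (simp add: algebra_simps)
  have lns: "ln (s * m) = ln s + ln m" "ln ((1 - s) * m) = ln (1 - s) + ln m"
      "log 2 (s / (1 - s)) * ln 2 = ln s - ln (1 - s)" "log 2 (1 / (1 - s)) * ln 2 = - ln (1 - s)"
    using assms m by (simp_all add: log_def ln_mult ln_div)
  have "(split_entropy (s * m) ((1 - s) * m) + log 2 (s / (1 - s)) * (s * m)) * ln 2
     = (m * log 2 (1 / (1 - s))) * ln 2"
  proof -
    have "split_entropy (s * m) ((1 - s) * m) * ln 2 + log 2 (s / (1 - s)) * ln 2 * (s * m)
        = m * (log 2 (1 / (1 - s)) * ln 2)"
      unfolding split_entropy_ln sum lns by (simp add: algebra_simps)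
    then show ?thesis by (simp add: algebra_simps)
  qed
  then show ?thesis by simp
qed (simp add: split_entropy_def)

lemma cesaro_decseq:
  fixes c :: "nat \<Rightarrow> real"
  assumes "decseq c" and "\<And>n. 0 \<le> c n"
  shows "\<exists>l. (\<lambda>n. (\<Sum>k<n. c k) / real n) \<longlonglongrightarrow> l \<and> (\<forall>n. l \<le> c n)"
proof -
  obtain l where l: "c \<longlonglongrightarrow> l" "\<And>n. l \<le> c n"
    using decseq_convergent[OF assms(1)] assms(2) by metis
  have "(\<lambda>n. (\<Sum>k<n. c k) / real n) \<longlonglongrightarrow> l"
  proof (rule LIMSEQ_I)
    fix r :: real assume r: "0 < r"
    obtain N where N: "\<And>n. n \<ge> N \<Longrightarrow> c n < l + r / 2"
      using order_tendstoD(2)[OF l(1), of "l + r / 2"] r by (auto simp: eventually_sequentially)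
    obtain M :: nat where M: "real M > 2 * (real N * c 0) / r" using reals_Archimedean2 by blast
    show "\<exists>no. \<forall>n\<ge>no. norm ((\<Sum>k<n. c k) / real n - l) < r"
    proof (intro exI allI impI)
      fix n assume n: "n \<ge> max (Suc M) N"
      then have n0: "0 < real n" by simp
      have "real n * l = (\<Sum>k<n. l)" by simp
      also have "\<dots> \<le> (\<Sum>k<n. c k)" by (intro sum_mono l(2))
      finally have lo: "l \<le> (\<Sum>k<n. c k) / real n" using n0 by (simp add: field_simps)
      have "(\<Sum>k<n. c k) \<le> (\<Sum>k<n. (l + r / 2) + (if k < N then c 0 else 0))"
      proof (intro sum_mono)
        fix k
        show "c k \<le> l + r / 2 + (if k < N then c 0 else 0)"
        proof (cases "k < N")
          case True
          have "0 \<le> l" using LIMSEQ_le_const[OF l(1)] assms(2) by blast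
          then show ?thesis using True decseqD[OF assms(1), of 0 k] r by simp
        next
          case False
          then show ?thesis using N[of k] by simp
        qed
      qed
      also have "\<dots> = real n * (l + r / 2) + real N * c 0"
      proof -
        have "{..<n} \<inter> {k. k < N} = {..<N}" using n by auto
        then have "(\<Sum>k<n. if k < N then c 0 else 0) = real N * c 0"
          by (simp add: sum.If_cases)
        then show ?thesis by (simp add: sum.distrib)
      qed
      also have "\<dots> < real n * (l + r)"
      proof -
        have "real M \<le> real n" using n by simp
        then have "2 * (real N * c 0) / r < real n" using M by linarith
        then have "2 * (real N * c 0) < real n * r" using r by (simp add: field_simps)
        then show ?thesis by (simp add: algebra_simps)
      qed
      finally have "(\<Sum>k<n. c k) / real n < l + r" using n0 by (simp add: field_simps)
      with lo show "norm ((\<Sum>k<n. c k) / real n - l) < r" by simp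
    qed
  qed
  with l(2) show ?thesis by blast
qed

section \<open>Sums over binary words\<close>

definition words :: "nat \<Rightarrow> bool list set" where
  "words n = {w. length w = n}"

lemma finite_words [simp]: "finite (words n)"
  using finite_lists_length_eq[of "UNIV :: bool set" n] by (simp add: words_def)

lemma length_words: "w \<in> words n \<Longrightarrow> length w = n"
  by (simp add: words_def)

lemma words_0 [simp]: "words 0 = {[]}"
  by (auto simp: words_def)

lemma words_Suc_snoc: "words (Suc n) = (\<lambda>u. u @ [True]) ` words n \<union> (\<lambda>u. u @ [False]) ` words n"
proof -
  have "w \<in> (\<lambda>u. u @ [True]) ` words n \<union> (\<lambda>u. u @ [False]) ` words n" if w: "w \<in> words (Suc n)" for w
  proof -
    obtain u v where "w = u @ [v]" using w by (cases w rule: rev_cases) (auto simp: words_def)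
    with w show ?thesis by (cases v) (auto simp: words_def)
  qed
  then show ?thesis by (auto simp: words_def)
qed

lemma words_Suc_Cons: "words (Suc n) = (#) True ` words n \<union> (#) False ` words n"
proof -
  have "w \<in> (#) True ` words n \<union> (#) False ` words n" if w: "w \<in> words (Suc n)" for w
  proof -
    obtain v u where "w = v # u" using w by (cases w) (auto simp: words_def)
    with w show ?thesis by (cases v) (auto simp: words_def)
  qed
  then show ?thesis by (auto simp: words_def)
qed

lemma sum_words_snoc:
  fixes f :: "bool list \<Rightarrow> real"
  shows "(\<Sum>w\<in>words (Suc n). f w) = (\<Sum>u\<in>words n. f (u @ [True]) + f (u @ [False]))"
  unfolding words_Suc_snoc
  by (subst sum.union_disjoint) (auto simp: sum.reindex inj_on_def sum.distrib)

lemma sum_words_Cons: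
  fixes f :: "bool list \<Rightarrow> real"
  shows "(\<Sum>w\<in>words (Suc n). f w) = (\<Sum>u\<in>words n. f (True # u) + f (False # u))"
  unfolding words_Suc_Cons
  by (subst sum.union_disjoint) (auto simp: sum.reindex inj_on_def sum.distrib)

lemma prod_nth_snoc:
  fixes f :: "nat \<Rightarrow> bool \<Rightarrow> real"
  assumes "u \<in> words n"
  shows "(\<Prod>j<Suc n. f j ((u @ [v]) ! j)) = (\<Prod>j<n. f j (u ! j)) * f n v"
  using assms by (simp add: length_words nth_append)

lemma sum_words_prod:
  fixes f :: "nat \<Rightarrow> bool \<Rightarrow> real"
  shows "(\<Sum>w\<in>words n. \<Prod>j<n. f j (w ! j)) = (\<Prod>j<n. f j True + f j False)"
proof (induction n)
  case (Suc n)
  have "(\<Sum>w\<in>words (Suc n). \<Prod>j<Suc n. f j (w ! j))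
      = (\<Sum>u\<in>words n. (\<Prod>j<n. f j (u ! j)) * (f n True + f n False))"
    unfolding sum_words_snoc
    by (intro sum.cong refl) (simp only: prod_nth_snoc distrib_left)
  also have "\<dots> = (\<Prod>j<Suc n. f j True + f j False)"
    by (simp add: sum_distrib_right[symmetric] Suc.IH)
  finally show ?case .
qed simp

section \<open>Entropy of a stationary process with a finite clock\<close>

text \<open>\<open>G w r\<close> is the probability that a stationary binary process starts with the word \<open>w\<close> while a
  finite-state clock shows \<open>r\<close>; one time step moves the clock by \<open>T\<close>.\<close>

locale stationary_family =
  fixes R :: "'r set" and T :: "'r \<Rightarrow> 'r" and G :: "bool list \<Rightarrow> 'r \<Rightarrow> real"
  assumes finite_R: "finite R"
    and T: "bij_betw T R R"
    and nonneg: "\<And>w r. r \<in> R \<Longrightarrow> 0 \<le> G w r"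
    and snoc: "\<And>w r. r \<in> R \<Longrightarrow> G w r = G (w @ [True]) r + G (w @ [False]) r"
    and Cons: "\<And>w r. r \<in> R \<Longrightarrow> G w (T r) = G (True # w) r + G (False # w) r"
    and total: "(\<Sum>r\<in>R. G [] r) = 1"
begin

definition block_entropy :: "nat \<Rightarrow> real" where
  "block_entropy n = - (\<Sum>r\<in>R. \<Sum>w\<in>words n. G w r * log 2 (G w r))"

definition entropy_step :: "nat \<Rightarrow> real" where
  "entropy_step n = (\<Sum>r\<in>R. \<Sum>u\<in>words n. split_entropy (G (u @ [True]) r) (G (u @ [False]) r))"

lemma sum_words: "r \<in> R \<Longrightarrow> (\<Sum>w\<in>words n. G w r) = G [] r"
  by (induction n) (simp_all add: sum_words_snoc snoc[symmetric])

lemma block_entropy_Suc: "block_entropy (Suc n) = block_entropy n + entropy_step n"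
proof -
  have "(\<Sum>w\<in>words (Suc n). G w r * log 2 (G w r))
     = (\<Sum>w\<in>words n. G w r * log 2 (G w r))
       - (\<Sum>u\<in>words n. split_entropy (G (u @ [True]) r) (G (u @ [False]) r))" if "r \<in> R" for r
    unfolding sum_words_snoc sum_subtractf[symmetric]
    by (intro sum.cong refl) (simp add: split_entropy_def snoc[OF that, symmetric])
  then show ?thesis
    by (simp add: block_entropy_def entropy_step_def sum_subtractf)
qed

lemma entropy_step_nonneg: "0 \<le> entropy_step n"
  unfolding entropy_step_def by (intro sum_nonneg split_entropy_nonneg nonneg)

lemma entropy_step_Suc_le: "entropy_step (Suc n) \<le> entropy_step n"
proof -
  have "entropy_step (Suc n) = (\<Sum>r\<in>R. \<Sum>u\<in>words n.
      split_entropy (G (True # u @ [True]) r) (G (True # u @ [False]) r) +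
      split_entropy (G (False # u @ [True]) r) (G (False # u @ [False]) r))"
    unfolding entropy_step_def sum_words_Cons by simp
  also have "\<dots> \<le> (\<Sum>r\<in>R. \<Sum>u\<in>words n.
      split_entropy (G (u @ [True]) (T r)) (G (u @ [False]) (T r)))"
    by (intro sum_mono order_trans[OF split_entropy_superadditive]) (simp_all add: nonneg Cons)
  also have "\<dots> = entropy_step n"
    unfolding entropy_step_def
    by (rule sum.reindex_bij_betw[OF T, where g = "\<lambda>r. \<Sum>u\<in>words n.
      split_entropy (G (u @ [True]) r) (G (u @ [False]) r)"])
  finally show ?thesis .
qed

lemma block_entropy_eq_sum: "block_entropy n = block_entropy 0 + (\<Sum>k<n. entropy_step k)"
  by (induction n) (simp_all add: block_entropy_Suc)

text \<open>The entropy rate is the limit of the conditional entropies of one symbol given an ever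
  longer past; these decrease by superadditivity.\<close>

lemma entropy_rate:
  "\<exists>h. (\<lambda>n. block_entropy n / real n) \<longlonglongrightarrow> h \<and> (\<forall>n. h \<le> entropy_step n)"
proof -
  have dec: "decseq entropy_step" by (simp add: decseq_Suc_iff entropy_step_Suc_le)
  from cesaro_decseq[OF dec entropy_step_nonneg]
  obtain l where l: "(\<lambda>n. (\<Sum>k<n. entropy_step k) / real n) \<longlonglongrightarrow> l" "\<forall>n. l \<le> entropy_step n"
    by (elim exE conjE)
  have "(\<lambda>n. block_entropy 0 / real n + (\<Sum>k<n. entropy_step k) / real n) \<longlonglongrightarrow> 0 + l"
    by (intro tendsto_add l(1) lim_const_over_n)
  moreover have "block_entropy n / real n = block_entropy 0 / real n + (\<Sum>k<n. entropy_step k) / real n" for n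
    using block_entropy_eq_sum[of n] by (simp add: add_divide_distrib)
  ultimately have "(\<lambda>n. block_entropy n / real n) \<longlonglongrightarrow> l"
    by simp
  with l(2) show ?thesis by blast
qed

text \<open>Only monotonicity of the logarithm enters: a joint mass is at most the sum over the clock
  states. For a clock with finitely many states the two sides have the same growth rate, so nothing
  is lost when the entropy rate of the process is estimated by that of the pair.\<close>

lemma entropy_forget_clock_le:
  "- (\<Sum>w\<in>words n. (\<Sum>r\<in>R. G w r) * log 2 (\<Sum>r\<in>R. G w r)) \<le> block_entropy n"
proof -
  have "G w r * log 2 (G w r) \<le> G w r * log 2 (\<Sum>r\<in>R. G w r)" if r: "r \<in> R" for w r
  proof (cases "G w r = 0")
    case False
    then have "0 < G w r" using nonneg[OF r, of w] by simp
    moreover have "G w r \<le> (\<Sum>r\<in>R. G w r)"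
      using finite_R r nonneg by (intro member_le_sum) auto
    ultimately show ?thesis by simp
  qed simp
  then have "(\<Sum>r\<in>R. \<Sum>w\<in>words n. G w r * log 2 (G w r))
      \<le> (\<Sum>r\<in>R. \<Sum>w\<in>words n. G w r * log 2 (\<Sum>r\<in>R. G w r))"
    by (intro sum_mono) auto
  also have "\<dots> = (\<Sum>w\<in>words n. (\<Sum>r\<in>R. G w r) * log 2 (\<Sum>r\<in>R. G w r))"
    by (subst sum.swap) (simp add: sum_distrib_right)
  finally show ?thesis by (simp add: block_entropy_def)
qed

lemma G_Nil_T: "r \<in> R \<Longrightarrow> G [] (T r) = G [] r"
  using Cons[of r "[]"] snoc[of r "[]"] by simp

lemma entropy_rate_ge:
  assumes "\<And>n. c \<le> entropy_step n" and "(\<lambda>n. block_entropy n / real n) \<longlonglongrightarrow> h"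
  shows "c \<le> h"
proof -
  have "(\<lambda>n. block_entropy n / real n - block_entropy 0 / real n) \<longlonglongrightarrow> h - 0"
    by (intro tendsto_diff assms(2) lim_const_over_n)
  moreover have "c \<le> block_entropy n / real n - block_entropy 0 / real n" if "1 \<le> n" for n
  proof -
    have "real n * c = (\<Sum>k<n. c)" by simp
    also have "\<dots> \<le> (\<Sum>k<n. entropy_step k)" by (intro sum_mono assms(1))
    finally have "real n * c \<le> block_entropy n - block_entropy 0" using block_entropy_eq_sum[of n] by simp
    then show ?thesis using that by (simp add: field_simps)
  qed
  ultimately have "c \<le> h - 0" by (intro LIMSEQ_le_const) blast+
  then show ?thesis by simp
qed

lemma sum_last_True: "(\<Sum>r\<in>R. \<Sum>u\<in>words n. G (u @ [True]) r) = (\<Sum>r\<in>R. G [True] r)"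
proof (induction n)
  case (Suc n)
  have "(\<Sum>r\<in>R. \<Sum>u\<in>words (Suc n). G (u @ [True]) r) = (\<Sum>r\<in>R. \<Sum>u\<in>words n. G (u @ [True]) (T r))"
    unfolding sum_words_Cons by (intro sum.cong refl) (simp add: Cons)
  also have "\<dots> = (\<Sum>r\<in>R. \<Sum>u\<in>words n. G (u @ [True]) r)"
    by (rule sum.reindex_bij_betw[OF T, where g = "\<lambda>r. \<Sum>u\<in>words n. G (u @ [True]) r"])
  finally show ?case using Suc.IH by simp
qed simp

text \<open>If the mass \<open>G u r\<close> vanishes, then so does the numerator, and the value 0 of the quotient is the
  right one.\<close>

definition deviation :: "real \<Rightarrow> bool list \<Rightarrow> 'r \<Rightarrow> real" where
  "deviation s u r = (G (u @ [True]) r - s * G u r)\<^sup>2 / (4 * G u r)"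

lemma deviation_nonneg: "r \<in> R \<Longrightarrow> 0 \<le> deviation s u r"
  by (simp add: deviation_def nonneg)

lemma G_eq_0_iff:
  assumes "r \<in> R" "G u r = 0" shows "G (u @ [v]) r = 0"
  using snoc[OF assms(1), of u] nonneg[OF assms(1), of "u @ [True]"] nonneg[OF assms(1), of "u @ [False]"] assms(2)
  by (cases v) auto

text \<open>The optimum for a single free site is summed over all pasts and over the clock states in
  \<open>A\<close>; the other clock states force a 0 and contribute nothing. The defect records how far the
  process is from choosing its next symbol independently of the past.\<close>

lemma entropy_step_bound:
  fixes s :: real
  assumes s: "0 < s" "s < 1"
    and blocked: "\<And>u r. r \<in> R \<Longrightarrow> u \<in> words n \<Longrightarrow> r \<notin> A \<Longrightarrow> G (u @ [True]) r = 0"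
  shows "entropy_step n + log 2 (s / (1 - s)) * (\<Sum>r\<in>R. G [True] r)
     \<le> (\<Sum>r\<in>R \<inter> A. G [] r) * log 2 (1 / (1 - s)) - (\<Sum>r\<in>R \<inter> A. \<Sum>u\<in>words n. deviation s u r)"
proof -
  let ?L = "log 2 (1 / (1 - s))" and ?\<beta> = "log 2 (s / (1 - s))"
  have loc: "split_entropy (G (u @ [True]) r) (G (u @ [False]) r) + ?\<beta> * G (u @ [True]) r
      \<le> G u r * ?L - deviation s u r" if "r \<in> R" for u r
  proof (cases "G u r = 0")
    case True
    then show ?thesis using G_eq_0_iff[OF that True] by (simp add: deviation_def)
  next
    case False
    then have "0 < G u r" using nonneg[OF that, of u] by simp
    then show ?thesis
      unfolding deviation_def snoc[OF that, of u] using s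
      by (intro split_entropy_deficit nonneg that)
  qed
  have "entropy_step n + ?\<beta> * (\<Sum>r\<in>R. G [True] r)
     = (\<Sum>r\<in>R. \<Sum>u\<in>words n. split_entropy (G (u @ [True]) r) (G (u @ [False]) r) + ?\<beta> * G (u @ [True]) r)"
    unfolding sum_last_True[of n, symmetric] by (simp add: entropy_step_def sum.distrib sum_distrib_left)
  also have "\<dots> = (\<Sum>r\<in>R \<inter> A. \<Sum>u\<in>words n. split_entropy (G (u @ [True]) r) (G (u @ [False]) r) + ?\<beta> * G (u @ [True]) r)"
    using finite_R by (intro sum.mono_neutral_right) (auto simp: blocked)
  also have "\<dots> \<le> (\<Sum>r\<in>R \<inter> A. \<Sum>u\<in>words n. G u r * ?L - deviation s u r)"
    using loc by (intro sum_mono) auto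
  also have "\<dots> = (\<Sum>r\<in>R \<inter> A. G [] r) * ?L - (\<Sum>r\<in>R \<inter> A. \<Sum>u\<in>words n. deviation s u r)"
    by (simp add: sum_subtractf sum_distrib_right[symmetric] sum_words)
  finally show ?thesis .
qed

text \<open>A process that attains the bound up to \<open>\<delta>\<close> has total squared deviation at most \<open>\<delta>\<close>. The
  passage to absolute values is \<open>2 t \<le> \<epsilon> g + t\<^sup>2 / (\<epsilon> g)\<close>, summed over all words, with a free
  parameter \<open>\<epsilon>\<close> in place of the Cauchy-Schwarz inequality.\<close>

lemma deviation_from_thinning:
  fixes s :: real
  assumes s: "0 < s" "s < 1"
    and blocked: "\<And>u r. r \<in> R \<Longrightarrow> u \<in> words n \<Longrightarrow> r \<notin> A \<Longrightarrow> G (u @ [True]) r = 0"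
    and step: "(\<Sum>r\<in>R \<inter> A. G [] r) * log 2 (1 / (1 - s)) - \<delta>
       \<le> entropy_step n + log 2 (s / (1 - s)) * (\<Sum>r\<in>R. G [True] r)"
    and \<epsilon>: "0 < \<epsilon>"
  shows "(\<Sum>r\<in>R \<inter> A. \<Sum>u\<in>words n. 2 * \<bar>G (u @ [True]) r - s * G u r\<bar>) \<le> \<epsilon> + 4 * \<delta> / \<epsilon>"
proof -
  define S where "S = (\<Sum>r\<in>R \<inter> A. \<Sum>u\<in>words n. deviation s u r)"
  have S: "S \<le> \<delta>" using entropy_step_bound[where n = n and A = A, OF s blocked] step by (simp add: S_def)
  have "2 * \<bar>G (u @ [True]) r - s * G u r\<bar> \<le> \<epsilon> * G u r + 4 / \<epsilon> * deviation s u r" if r: "r \<in> R" for u r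
  proof (cases "G u r = 0")
    case True
    then show ?thesis using G_eq_0_iff[OF r True] by (simp add: deviation_def)
  next
    case False
    then have g: "0 < G u r" using nonneg[OF r, of u] by simp
    define t where "t = \<bar>G (u @ [True]) r - s * G u r\<bar>"
    have "0 \<le> (\<epsilon> * G u r - t)\<^sup>2 / (\<epsilon> * G u r)" using g \<epsilon> by simp
    also have "\<dots> = \<epsilon> * G u r + t\<^sup>2 / (\<epsilon> * G u r) - 2 * t"
      using g \<epsilon> by (simp add: field_simps power2_eq_square)
    finally show ?thesis using g \<epsilon> by (simp add: deviation_def t_def)
  qed
  then have "(\<Sum>r\<in>R \<inter> A. \<Sum>u\<in>words n. 2 * \<bar>G (u @ [True]) r - s * G u r\<bar>)
     \<le> (\<Sum>r\<in>R \<inter> A. \<Sum>u\<in>words n. \<epsilon> * G u r + 4 / \<epsilon> * deviation s u r)"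
    by (intro sum_mono) auto
  also have "\<dots> = \<epsilon> * (\<Sum>r\<in>R \<inter> A. G [] r) + 4 / \<epsilon> * S"
    by (simp only: S_def sum.distrib sum_distrib_left[symmetric]) (simp add: sum_words)
  finally have "(\<Sum>r\<in>R \<inter> A. \<Sum>u\<in>words n. 2 * \<bar>G (u @ [True]) r - s * G u r\<bar>)
     \<le> \<epsilon> * (\<Sum>r\<in>R \<inter> A. G [] r) + 4 / \<epsilon> * S" .
  moreover have "(\<Sum>r\<in>R \<inter> A. G [] r) \<le> 1"
    unfolding total[symmetric] using finite_R nonneg by (intro sum_mono2) auto
  then have "\<epsilon> * (\<Sum>r\<in>R \<inter> A. G [] r) + 4 / \<epsilon> * S \<le> \<epsilon> * 1 + 4 / \<epsilon> * \<delta>"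
    using \<epsilon> S by (intro add_mono mult_left_mono) auto
  ultimately show ?thesis by simp
qed

end

section \<open>Residue clocks and admissible configurations\<close>

lemma prod_ge_one_minus_sum:
  fixes f :: "'a \<Rightarrow> real"
  assumes "finite I" "\<And>i. i \<in> I \<Longrightarrow> 0 \<le> f i \<and> f i \<le> 1"
  shows "1 - (\<Sum>i\<in>I. f i) \<le> (\<Prod>i\<in>I. 1 - f i) \<and> (\<Prod>i\<in>I. 1 - f i) \<le> 1 \<and> 0 \<le> (\<Prod>i\<in>I. 1 - f i)"
  using assms
proof (induction I)
  case (insert i I)
  let ?P = "\<Prod>i\<in>I. 1 - f i"
  have IH: "1 - (\<Sum>i\<in>I. f i) \<le> ?P" "?P \<le> 1" "0 \<le> ?P" "0 \<le> f i" "f i \<le> 1" using insert by auto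
  then have "f i * ?P \<le> f i * 1" by (intro mult_left_mono) auto
  moreover have "0 \<le> f i * ?P" "0 \<le> (1 - f i) * ?P" using IH by auto
  ultimately show ?case
    unfolding prod.insert[OF insert.hyps] sum.insert[OF insert.hyps] left_diff_distrib mult_1
    using IH by (intro conjI) linarith+
qed simp

locale coprime_moduli =
  fixes b :: "nat \<Rightarrow> nat"
  assumes ge2: "\<And>i. 2 \<le> b i"
    and cop: "\<And>i j. i \<noteq> j \<Longrightarrow> coprime (b i) (b j)"
    and summ: "summable (\<lambda>i. 1 / real (b i))"
begin

lemma b_pos [simp]: "0 < b i" "0 < int (b i)"
  using ge2[of i] by auto

definition period :: "nat \<Rightarrow> nat" where
  "period K = (\<Prod>k<K. b k)"

text \<open>A clock state with \<open>K\<close> hands is a residue \<open>\<rho> k\<close> for each of the first \<open>K\<close> moduli. As in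
  \<^const>\<open>residue_coding\<close>, the modulus \<open>b k\<close> deletes the position \<open>m\<close> if \<open>\<rho> k + m\<close> is a multiple of
  \<open>b k\<close>, so that the shift of configurations corresponds to adding 1 to all hands.\<close>

definition clocks :: "nat \<Rightarrow> (nat \<Rightarrow> int) set" where
  "clocks K = (\<Pi>\<^sub>E k\<in>{..<K}. {0..<int (b k)})"

definition rot :: "nat \<Rightarrow> int \<Rightarrow> (nat \<Rightarrow> int) \<Rightarrow> nat \<Rightarrow> int" where
  "rot K j \<rho> = (\<lambda>k\<in>{..<K}. (\<rho> k + j) mod int (b k))"

definition allowed :: "nat \<Rightarrow> (nat \<Rightarrow> int) \<Rightarrow> int \<Rightarrow> bool" where
  "allowed K \<rho> j \<longleftrightarrow> (\<forall>k<K. (\<rho> k + j) mod int (b k) \<noteq> 0)"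

definition dens :: "nat \<Rightarrow> real" where
  "dens K = (\<Prod>k<K. 1 - 1 / real (b k))"

definition density :: real where
  "density = (INF K. dens K)"

lemma clocks_iff:
  "\<rho> \<in> clocks K \<longleftrightarrow> \<rho> \<in> extensional {..<K} \<and> (\<forall>k<K. 0 \<le> \<rho> k \<and> \<rho> k < int (b k))"
  by (auto simp: clocks_def PiE_iff)

lemma period_pos [simp]: "0 < period K"
  by (simp add: period_def prod_pos)

lemma finite_clocks [simp]: "finite (clocks K)"
  by (simp add: clocks_def finite_PiE)

lemma card_clocks: "card (clocks K) = period K"
  by (simp add: clocks_def period_def card_PiE)

lemma rot_in_clocks [simp]: "rot K j \<rho> \<in> clocks K"
  by (auto simp: rot_def clocks_def)

lemma rot_rot: "rot K i (rot K j \<rho>) = rot K (i + j) \<rho>"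
  by (auto simp: rot_def fun_eq_iff mod_add_left_eq add.assoc add.commute[of i j])

lemma rot_0: "\<rho> \<in> clocks K \<Longrightarrow> rot K 0 \<rho> = \<rho>"
  by (fastforce simp: rot_def clocks_def PiE_def extensional_def fun_eq_iff Pi_def)

lemma bij_rot: "bij_betw (rot K j) (clocks K) (clocks K)"
  by (rule bij_betw_byWitness[where f' = "rot K (- j)"]) (auto simp: rot_rot rot_0)

lemma allowed_rot: "allowed K (rot K i \<rho>) j \<longleftrightarrow> allowed K \<rho> (i + j)"
  by (simp add: allowed_def rot_def mod_add_left_eq add.assoc)

lemma period_dvd:
  assumes "\<And>k. k < K \<Longrightarrow> int (b k) dvd x"
  shows "int (period K) dvd x"
  using assms
proof (induction K)
  case (Suc K)
  have "coprime (int (period K)) (int (b K))"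
    using cop by (auto simp: period_def intro!: prod_coprime_left)
  then have "int (period K) * int (b K) dvd x"
    using Suc by (intro divides_mult) auto
  then show ?case by (simp add: period_def mult.commute)
qed (simp add: period_def)

text \<open>By the Chinese remainder theorem the clock has a single orbit, of length \<^term>\<open>period K\<close>:
  equal states at two times make the difference of the times divisible by all the moduli.\<close>

lemma orbit_bij:
  assumes "\<rho> \<in> clocks K"
  shows "bij_betw (\<lambda>j. rot K (int j) \<rho>) {..<period K} (clocks K)"
proof -
  have "inj_on (\<lambda>j. rot K (int j) \<rho>) {..<period K}"
  proof (rule inj_onI)
    fix i j assume ij: "i \<in> {..<period K}" "j \<in> {..<period K}" "rot K (int i) \<rho> = rot K (int j) \<rho>"
    have "int (b k) dvd int i - int j" if "k < K" for k
    proof -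
      have "(\<rho> k + int i) mod int (b k) = (\<rho> k + int j) mod int (b k)"
        using fun_cong[OF ij(3), of k] that by (simp add: rot_def)
      then show ?thesis by (metis add_diff_cancel_left mod_eq_dvd_iff)
    qed
    then have "int (period K) dvd int i - int j" by (rule period_dvd)
    moreover have "\<bar>int i - int j\<bar> < int (period K)" using ij by auto
    ultimately show "i = j" using dvd_imp_le_int[of "int i - int j" "int (period K)"] by force
  qed
  then show ?thesis
    by (intro bij_betw_imageI card_subset_eq) (auto simp: card_image card_clocks)
qed

lemma sum_orbit:
  fixes f :: "(nat \<Rightarrow> int) \<Rightarrow> real"
  assumes "\<rho> \<in> clocks K"
  shows "(\<Sum>j<q * period K. f (rot K (int j) \<rho>)) = real q * (\<Sum>\<sigma>\<in>clocks K. f \<sigma>)"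
proof -
  have "(\<Sum>j\<in>{m * period K..<m * period K + period K}. f (rot K (int j) \<rho>)) = (\<Sum>\<sigma>\<in>clocks K. f \<sigma>)" for m
  proof -
    have "(\<Sum>j\<in>{m * period K..<m * period K + period K}. f (rot K (int j) \<rho>))
        = (\<Sum>j<period K. f (rot K (int j) (rot K (int (m * period K)) \<rho>)))"
      using sum.shift_bounds_nat_ivl[of "\<lambda>j. f (rot K (int j) \<rho>)" 0 "m * period K" "period K"]
      by (simp add: rot_rot lessThan_atLeast0 add.commute)
    also have "\<dots> = (\<Sum>\<sigma>\<in>clocks K. f \<sigma>)"
      by (rule sum.reindex_bij_betw[OF orbit_bij]) simp
    finally show ?thesis .
  qed
  then show ?thesis
    using sum.nat_group[of "\<lambda>j. f (rot K (int j) \<rho>)" "period K" q] by simp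
qed

lemma allowed_iff_nonzero:
  "\<rho> \<in> clocks K \<Longrightarrow> allowed K \<rho> 0 \<longleftrightarrow> (\<forall>k<K. \<rho> k \<noteq> 0)"
  by (auto simp: allowed_def clocks_iff)

lemma clocks_allowed_0_iff:
  "\<rho> \<in> clocks K \<and> allowed K \<rho> 0 \<longleftrightarrow> \<rho> \<in> extensional {..<K} \<and> (\<forall>k<K. 1 \<le> \<rho> k \<and> \<rho> k < int (b k))"
proof -
  have "1 \<le> x \<longleftrightarrow> 0 \<le> x \<and> x \<noteq> 0" for x :: int by linarith
  then show ?thesis using allowed_iff_nonzero[of \<rho> K] by (auto simp: clocks_iff)
qed

lemma card_allowed_0: "real (card {\<rho> \<in> clocks K. allowed K \<rho> 0}) = dens K * real (period K)"
proof -
  have "{\<rho> \<in> clocks K. allowed K \<rho> 0} = (\<Pi>\<^sub>E k\<in>{..<K}. {1..<int (b k)})"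
    by (simp only: clocks_allowed_0_iff set_eq_iff mem_Collect_eq PiE_iff atLeastLessThan_iff Ball_def
        lessThan_iff) blast
  then have "real (card {\<rho> \<in> clocks K. allowed K \<rho> 0}) = (\<Prod>k<K. real (nat (int (b k) - 1)))"
    by (simp add: card_PiE)
  also have "\<dots> = (\<Prod>k<K. (1 - 1 / real (b k)) * real (b k))"
  proof (intro prod.cong refl)
    fix k show "real (nat (int (b k) - 1)) = (1 - 1 / real (b k)) * real (b k)"
      using ge2[of k] by (simp add: field_simps of_nat_diff)
  qed
  finally show ?thesis by (simp add: dens_def period_def prod.distrib)
qed

lemma card_allowed: "real (card {\<rho> \<in> clocks K. allowed K \<rho> j}) = dens K * real (period K)"
proof -
  have "bij_betw (rot K j) {\<rho> \<in> clocks K. allowed K \<rho> j} {\<rho> \<in> clocks K. allowed K \<rho> 0}"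
    by (rule bij_betw_byWitness[where f' = "rot K (- j)"]) (auto simp: rot_rot rot_0 allowed_rot)
  from bij_betw_same_card[OF this] show ?thesis using card_allowed_0 by simp
qed

text \<open>With the value \<open>e\<close> forbidden in addition to 0, one hand has \<open>b k - 2\<close> instead of \<open>b k - 1\<close>
  choices.\<close>

lemma card_twice_allowed:
  assumes k: "k < K" and e: "e \<in> {1..<int (b k)}"
  shows "real (card {\<rho> \<in> clocks K. allowed K \<rho> 0 \<and> \<rho> k \<noteq> e})
    = dens K * real (period K) * (real (b k) - 2) / (real (b k) - 1)"
proof -
  let ?A = "\<lambda>i. if i = k then {1..<int (b k)} - {e} else {1..<int (b i)}"
  have "{\<rho> \<in> clocks K. allowed K \<rho> 0 \<and> \<rho> k \<noteq> e} = (\<Pi>\<^sub>E i\<in>{..<K}. ?A i)"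
  proof (rule set_eqI)
    fix \<rho>
    have "(\<forall>i<K. \<rho> i \<in> ?A i) \<longleftrightarrow> (\<forall>i<K. 1 \<le> \<rho> i \<and> \<rho> i < int (b i)) \<and> \<rho> k \<noteq> e"
      using k by (simp split: if_split) blast
    then show "\<rho> \<in> {\<rho> \<in> clocks K. allowed K \<rho> 0 \<and> \<rho> k \<noteq> e} \<longleftrightarrow> \<rho> \<in> (\<Pi>\<^sub>E i\<in>{..<K}. ?A i)"
      by (simp only: mem_Collect_eq conj_assoc[symmetric] clocks_allowed_0_iff PiE_iff Ball_def lessThan_iff) blast
  qed
  then have "real (card {\<rho> \<in> clocks K. allowed K \<rho> 0 \<and> \<rho> k \<noteq> e}) = (\<Prod>i<K. real (card (?A i)))"
    by (simp add: card_PiE)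
  also have "\<dots> = real (card (?A k)) * (\<Prod>i\<in>{..<K} - {k}. real (card (?A i)))"
    using k by (intro prod.remove) auto
  also have "real (card (?A k)) = real (b k) - 2"
    using e ge2[of k] by (auto simp: card_Diff_singleton of_nat_diff nat_diff_distrib)
  also have "(\<Prod>i\<in>{..<K} - {k}. real (card (?A i))) = (\<Prod>i\<in>{..<K} - {k}. (1 - 1 / real (b i)) * real (b i))"
  proof (intro prod.cong refl)
    fix i assume "i \<in> {..<K} - {k}"
    then show "real (card (?A i)) = (1 - 1 / real (b i)) * real (b i)"
      using ge2[of i] by (simp add: field_simps)
  qed
  also have "\<dots> = dens K * real (period K) / (real (b k) - 1)"
  proof -
    have "dens K * real (period K) = (\<Prod>i<K. (1 - 1 / real (b i)) * real (b i))"
      by (simp add: dens_def period_def prod.distrib)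
    also have "\<dots> = ((1 - 1 / real (b k)) * real (b k)) * (\<Prod>i\<in>{..<K} - {k}. (1 - 1 / real (b i)) * real (b i))"
      using k by (intro prod.remove) auto
    also have "(1 - 1 / real (b k)) * real (b k) = real (b k) - 1"
      using ge2[of k] by (simp add: field_simps)
    finally show ?thesis using ge2[of k] by simp
  qed
  finally show ?thesis by simp
qed

subsection \<open>Density\<close>

lemma small_tail:
  assumes "0 < \<epsilon>"
  obtains K where "\<And>I. finite I \<Longrightarrow> I \<subseteq> {K..} \<Longrightarrow> (\<Sum>k\<in>I. 1 / real (b k)) < \<epsilon>"
proof -
  obtain K where K: "\<And>m n. m \<ge> K \<Longrightarrow> norm (\<Sum>k\<in>{m..<n}. 1 / real (b k)) < \<epsilon>"
    using summ assms unfolding summable_Cauchy by blast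
  have "(\<Sum>k\<in>I. 1 / real (b k)) < \<epsilon>" if "finite I" "I \<subseteq> {K..}" for I
  proof -
    obtain n where "\<forall>k\<in>I. k < n" using \<open>finite I\<close> finite_nat_set_iff_bounded by blast
    then have "(\<Sum>k\<in>I. 1 / real (b k)) \<le> (\<Sum>k\<in>{K..<n}. 1 / real (b k))"
      using that by (intro sum_mono2) auto
    also have "\<dots> < \<epsilon>" using K[of K n] by simp
    finally show ?thesis .
  qed
  with that show ?thesis by (metis (no_types))
qed

lemma one_minus_inverse_b: "0 < 1 - 1 / real (b k)" "1 - 1 / real (b k) \<le> 1"
  using ge2[of k] by (simp_all add: field_simps)

lemma dens_pos: "0 < dens K"
  unfolding dens_def by (intro prod_pos) (rule one_minus_inverse_b)

lemma dens_Suc_le: "dens (Suc K) \<le> dens K"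
proof -
  have "dens (Suc K) = dens K * (1 - 1 / real (b K))" by (simp add: dens_def)
  also have "\<dots> \<le> dens K * 1"
    using dens_pos[of K] one_minus_inverse_b(2)[of K] by (intro mult_left_mono) auto
  finally show ?thesis by simp
qed

lemma dens_tendsto: "dens \<longlonglongrightarrow> density"
  unfolding density_def
  by (rule LIMSEQ_decseq_INF) (auto simp: decseq_Suc_iff dens_Suc_le intro!: bdd_belowI[of _ 0] less_imp_le dens_pos)

text \<open>Beyond some index the sum of the reciprocals is less than 1/2, so that the remaining factors have
  a product of at least 1/2.\<close>

lemma density_pos: "0 < density"
proof -
  obtain K where K: "\<And>I. finite I \<Longrightarrow> I \<subseteq> {K..} \<Longrightarrow> (\<Sum>k\<in>I. 1 / real (b k)) < 1 / 2"
    using small_tail[of "1 / 2"] by (metis half_gt_zero zero_less_one)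
  have "dens K / 2 \<le> dens n" if n: "K \<le> n" for n
  proof -
    have eq: "dens n = dens K * (\<Prod>k\<in>{K..<n}. 1 - 1 / real (b k))"
      unfolding dens_def lessThan_atLeast0 using n
      by (subst prod.atLeastLessThan_concat) auto
    have "1 - (\<Sum>k\<in>{K..<n}. 1 / real (b k)) \<le> (\<Prod>k\<in>{K..<n}. 1 - 1 / real (b k))"
    proof -
      have "0 \<le> 1 / real (b k) \<and> 1 / real (b k) \<le> 1" for k using ge2[of k] by simp
      then show ?thesis by (intro conjunct1[OF prod_ge_one_minus_sum]) auto
    qed
    moreover have "(\<Sum>k\<in>{K..<n}. 1 / real (b k)) < 1 / 2" by (rule K) auto
    ultimately have "1 / 2 \<le> (\<Prod>k\<in>{K..<n}. 1 - 1 / real (b k))" by linarith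
    then have "dens K * (1 / 2) \<le> dens K * (\<Prod>k\<in>{K..<n}. 1 - 1 / real (b k))"
      using dens_pos[of K] by (intro mult_left_mono) auto
    then show ?thesis unfolding eq by simp
  qed
  then have "dens K / 2 \<le> density"
    by (intro LIMSEQ_le_const[OF dens_tendsto]) blast
  with dens_pos[of K] show ?thesis by linarith
qed

subsection \<open>Patterns realized in the characteristic sequence of the free numbers\<close>

lemma inj_b: "inj b"
proof (rule injI, rule ccontr)
  fix i j assume "b i = b j" "i \<noteq> j"
  then have "coprime (b i) (b i)" using cop by metis
  then show False using ge2[of i] by simp
qed

lemma finite_b_le: "finite {k. b k \<le> Y}"
proof -
  have "finite (b -` {..Y})" by (intro finite_vimageI inj_b) simp
  then show ?thesis by (simp add: vimage_def)
qed

text \<open>The solutions form one residue class modulo \<open>m\<close>, hence each block of \<open>m\<close> consecutive numbers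
  contains at most one.\<close>

lemma card_dvd_progression_le:
  fixes m N :: nat and x :: int
  assumes "coprime m N" "0 < m"
  shows "real (card {l \<in> {..<L}. int m dvd x + int N * int l}) \<le> real L / real m + 1"
proof -
  let ?A = "{l \<in> {..<L}. int m dvd x + int N * int l}"
  have "inj_on (\<lambda>l. l div m) ?A"
  proof (rule inj_onI)
    fix l l' assume l: "l \<in> ?A" "l' \<in> ?A" "l div m = l' div m"
    then have "int m dvd (x + int N * int l) - (x + int N * int l')" by (intro dvd_diff) auto
    then have "int m dvd int N * (int l - int l')" by (simp add: algebra_simps)
    then have "int m dvd int l - int l'"
      using assms(1) by (simp add: coprime_dvd_mult_right_iff)
    then have "int l mod int m = int l' mod int m" by (simp add: mod_eq_dvd_iff)
    then have "l mod m = l' mod m" by (metis of_nat_eq_iff zmod_int)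
    with l(3) show "l = l'" by (metis div_mult_mod_eq)
  qed
  moreover have "(\<lambda>l. l div m) ` ?A \<subseteq> {..L div m}" by (auto intro: div_le_mono)
  ultimately have "card ?A \<le> L div m + 1"
    using card_inj_on_le[of "\<lambda>l. l div m" ?A "{..L div m}"] by simp
  then have "real (card ?A) \<le> real (L div m) + 1" by linarith
  also have "real (L div m) \<le> real L / real m" by (rule of_nat_div_le_of_nat)
  finally show ?thesis by simp
qed

text \<open>A finite pattern \<open>T\<close> that avoids a residue class of each modulus is free of all moduli at
  some position, and finitely many of the residues of that position can be prescribed. Only the
  infinitely many large moduli are an obstacle to the Chinese remainder theorem: along an
  arithmetic progression they exclude a set of positions of small density, by summability.\<close>

lemma realize_pattern:
  fixes c :: "nat \<Rightarrow> int" and T :: "int set"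
  assumes F: "finite F" and T: "T \<subseteq> {0..<int n}"
    and avoid: "\<And>k t. t \<in> T \<Longrightarrow> (c k + t) mod int (b k) \<noteq> 0"
  obtains j where "\<And>k. k \<in> F \<Longrightarrow> int (b k) dvd j - c k"
    and "\<And>k t. t \<in> T \<Longrightarrow> (j + t) mod int (b k) \<noteq> 0"
proof -
  \<comment> \<open>The successor keeps the following quotients meaningful when \<open>n = 0\<close>.\<close>
  define n' where "n' = Suc n"
  have n': "0 < real n'" by (simp add: n'_def)
  \<comment> \<open>Moduli from \<open>K0\<close> on exclude at most a quarter of the progression, up to rounding.\<close>
  obtain K0 where K0: "\<And>I. finite I \<Longrightarrow> I \<subseteq> {K0..} \<Longrightarrow> (\<Sum>k\<in>I. 1 / real (b k)) < 1 / (4 * real n')"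
    using small_tail[of "1 / (4 * real n')"] n' by (metis divide_pos_pos mult_pos_pos zero_less_numeral zero_less_one)
  obtain K' where K': "\<forall>k\<in>F. k < K'" using F finite_nat_set_iff_bounded by blast
  define K where "K = max K0 K'"
  define N where "N = period K"
  have N: "0 < N" by (simp add: N_def)
  define z where "z = (\<lambda>k\<in>{..<K}. 0 :: int)"
  have "z \<in> clocks K" by (simp add: z_def clocks_iff)
  moreover have "rot K 0 c \<in> clocks K" by simp
  ultimately obtain a0 :: nat where a0: "rot K (int a0) z = rot K 0 c"
    using orbit_bij[of z K] unfolding bij_betw_def by (metis (no_types, lifting) imageE)
  have a0_mod: "int a0 mod int (b k) = c k mod int (b k)" if "k < K" for k
    using fun_cong[OF a0, of k] that by (simp add: rot_def z_def)
  define a where "a = a0 + N"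
  have bN: "int (b k) dvd int N" if "k < K" for k
    unfolding N_def period_def of_nat_dvd_iff by (rule dvd_prodI) (use that in auto)
  have a_mod: "int (b k) dvd int a + int N * l - c k" if "k < K" for k l
  proof -
    have "int (b k) dvd int a0 - c k" using a0_mod[OF that] by (simp add: mod_eq_dvd_iff)
    then have "int (b k) dvd (int a0 - c k) + int N * (1 + l)" using bN[OF that] by auto
    then show ?thesis by (simp add: a_def algebra_simps)
  qed
  \<comment> \<open>\<open>\<epsilon>\<close> controls the rounding errors: there is one for each pair of an element of \<open>T\<close> and a modulus
      up to \<open>Y\<close>, and the number of these moduli is \<open>o(Y)\<close> by summability.\<close>
  define \<epsilon> where "\<epsilon> = 1 / (4 * real n' * real N)"
  have \<epsilon>: "0 < \<epsilon>" using n' N by (simp add: \<epsilon>_def)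
  obtain K1 where K1: "\<And>I. finite I \<Longrightarrow> I \<subseteq> {K1..} \<Longrightarrow> (\<Sum>k\<in>I. 1 / real (b k)) < \<epsilon>"
    using small_tail[OF \<epsilon>] by blast
  obtain L :: nat where L: "real L > 2 * (real n' * real K1 + real (a + n'))"
    using reals_Archimedean2 by blast
  define Y where "Y = a + n' + N * L"
  define q where "q = real (a + n') / (4 * real N)"
  define I where "I = {k. K \<le> k \<and> b k \<le> Y}"
  have finI: "finite I" unfolding I_def by (rule finite_subset[OF _ finite_b_le[of Y]]) auto
  have Y: "0 < real Y" unfolding of_nat_0_less_iff by (simp add: Y_def n'_def)
  have cardI: "real (card I) \<le> real K1 + \<epsilon> * real Y"
  proof -
    let ?J = "I \<inter> {K1..}"
    have "real (card ?J) * (1 / real Y) = (\<Sum>k\<in>?J. 1 / real Y)" by simp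
    also have "\<dots> \<le> (\<Sum>k\<in>?J. 1 / real (b k))"
      using Y by (intro sum_mono divide_left_mono) (auto simp: I_def)
    also have "\<dots> < \<epsilon>" using finI by (intro K1) auto
    finally have "real (card ?J) \<le> \<epsilon> * real Y" using Y by (simp add: field_simps)
    moreover have "card I \<le> card {..<K1} + card ?J"
    proof -
      have "I \<subseteq> {..<K1} \<union> ?J" by auto
      then have "card I \<le> card ({..<K1} \<union> ?J)" using finI by (intro card_mono) auto
      also have "\<dots> \<le> card {..<K1} + card ?J" by (rule card_Un_le)
      finally show ?thesis .
    qed
    then have "real (card I) \<le> real K1 + real (card ?J)" by simp
    ultimately show ?thesis by linarith
  qed
  define bad where "bad t k = {l \<in> {..<L}. int (b k) dvd (int a + t) + int N * int l}" for t k
  have card_bad: "real (card (bad t k)) \<le> real L / real (b k) + 1" if "k \<in> I" for t k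
  proof -
    have "coprime (b k) N"
      unfolding N_def period_def using that cop by (auto simp: I_def intro!: prod_coprime_right)
    then show ?thesis unfolding bad_def by (intro card_dvd_progression_le) auto
  qed
  have finT: "finite T" using T finite_subset by blast
  have cardT: "real (card T) \<le> real n'"
    using card_mono[OF _ T] by (simp add: n'_def)
  have "real (card (\<Union>t\<in>T. \<Union>k\<in>I. bad t k)) \<le> (\<Sum>t\<in>T. \<Sum>k\<in>I. real (card (bad t k)))"
  proof -
    have "card (\<Union>t\<in>T. \<Union>k\<in>I. bad t k) \<le> (\<Sum>t\<in>T. \<Sum>k\<in>I. card (bad t k))"
      by (intro order_trans[OF card_UN_le[OF finT]] sum_mono card_UN_le finI)
    then have "real (card (\<Union>t\<in>T. \<Union>k\<in>I. bad t k)) \<le> real (\<Sum>t\<in>T. \<Sum>k\<in>I. card (bad t k))"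
      by (rule of_nat_mono)
    then show ?thesis by simp
  qed
  also have "\<dots> \<le> (\<Sum>t\<in>T. \<Sum>k\<in>I. real L / real (b k) + 1)"
    by (intro sum_mono card_bad)
  also have "\<dots> = real (card T) * (real L * (\<Sum>k\<in>I. 1 / real (b k)) + real (card I))"
    by (simp add: sum.distrib sum_distrib_left)
  also have "\<dots> \<le> real n' * (real L * (1 / (4 * real n')) + (real K1 + \<epsilon> * real Y))"
  proof (rule mult_mono[OF cardT])
    have "I \<subseteq> {K0..}" by (auto simp: I_def K_def)
    then have "real L * (\<Sum>k\<in>I. 1 / real (b k)) \<le> real L * (1 / (4 * real n'))"
      using K0[OF finI] by (intro mult_left_mono) auto
    then show "real L * (\<Sum>k\<in>I. 1 / real (b k)) + real (card I)
        \<le> real L * (1 / (4 * real n')) + (real K1 + \<epsilon> * real Y)"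
      using cardI by linarith
    show "0 \<le> real L * (\<Sum>k\<in>I. 1 / real (b k)) + real (card I)"
      by (intro add_nonneg_nonneg mult_nonneg_nonneg sum_nonneg) auto
  qed simp
  also have "\<dots> = real L / 2 + real n' * real K1 + q"
    using n' N by (simp add: q_def \<epsilon>_def Y_def field_simps)
  finally have bound: "real (card (\<Union>t\<in>T. \<Union>k\<in>I. bad t k))
      \<le> real L / 2 + real n' * real K1 + q" .
  have qle: "q \<le> real (a + n')"
  proof -
    have "1 \<le> 4 * real N" using N by linarith
    then show ?thesis using divide_left_mono[of 1 "4 * real N" "real (a + n')"] N by (simp add: q_def)
  qed
  have "real (card (\<Union>t\<in>T. \<Union>k\<in>I. bad t k)) < real L"
    using bound qle L by (simp add: field_simps)
  then have "card (\<Union>t\<in>T. \<Union>k\<in>I. bad t k) < card {..<L}" by simp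
  then have "\<not> {..<L} \<subseteq> (\<Union>t\<in>T. \<Union>k\<in>I. bad t k)"
  proof (rule contrapos_pn)
    assume "{..<L} \<subseteq> (\<Union>t\<in>T. \<Union>k\<in>I. bad t k)"
    moreover have "finite (\<Union>t\<in>T. \<Union>k\<in>I. bad t k)" using finT finI by (simp add: bad_def)
    ultimately show "\<not> card (\<Union>t\<in>T. \<Union>k\<in>I. bad t k) < card {..<L}"
      by (simp only: not_less card_mono)
  qed
  then obtain l where l: "l < L" "\<And>t k. t \<in> T \<Longrightarrow> k \<in> I \<Longrightarrow> l \<notin> bad t k" by blast
  define j where "j = int a + int N * int l"
  show ?thesis
  proof
    show "int (b k) dvd j - c k" if "k \<in> F" for k
      unfolding j_def using K' that by (intro a_mod) (auto simp: K_def)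
    show "(j + t) mod int (b k) \<noteq> 0" if t: "t \<in> T" for k t
    proof (cases "k < K")
      case True
      then have "(j + t) mod int (b k) = (c k + t) mod int (b k)"
        using a_mod[OF True, of "int l"] by (simp add: j_def mod_eq_dvd_iff)
      then show ?thesis using avoid[OF t, of k] by simp
    next
      case False
      show ?thesis
      proof
        assume "(j + t) mod int (b k) = 0"
        then have dvd: "int (b k) dvd (int a + t) + int N * int l"
          by (simp add: j_def dvd_eq_mod_eq_0 algebra_simps)
        have t0: "0 \<le> t" "t < int n" using t T by auto
        have pos: "0 < (int a + t) + int N * int l" using t0 N by (simp add: a_def add_pos_nonneg)
        have "int (b k) \<le> (int a + t) + int N * int l" by (rule zdvd_imp_le[OF dvd pos])
        also have "\<dots> \<le> int Y"
        proof -
          have "N * l \<le> N * L" using l(1) by simp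
          then have "int N * int l \<le> int N * int L" by (metis of_nat_le_iff of_nat_mult)
          then show ?thesis using t0 by (simp add: Y_def n'_def)
        qed
        finally have "k \<in> I" using False by (simp add: I_def)
        with l(1) l(2)[OF t this] dvd show False by (simp add: bad_def)
      qed
    qed
  qed
qed

lemma eta_iff: "eta (range b) n \<longleftrightarrow> (\<forall>k. n mod int (b k) \<noteq> 0)"
  by (auto simp: eta_def free_numbers_def mod_eq_0_iff_dvd dvd_def)

text \<open>A point of the subshift misses a class of each modulus by compactness: every window does, and
  there are finitely many classes. Conversely, the ones of a window of such a configuration can be
  realized by \<open>realize_pattern\<close>, and each 0 is produced by its own modulus, which exceeds the
  length of the window and so does not interfere with the ones.\<close>

lemma free_subshift_iff:
  "x \<in> free_subshift (range b) \<longleftrightarrow> (\<forall>k. \<exists>r\<in>{0..<int (b k)}. \<forall>m. x m \<longrightarrow> (r + m) mod int (b k) \<noteq> 0)"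
proof (intro iffI allI)
  fix k
  assume x: "x \<in> free_subshift (range b)"
  show "\<exists>r\<in>{0..<int (b k)}. \<forall>m. x m \<longrightarrow> (r + m) mod int (b k) \<noteq> 0"
  proof (rule ccontr)
    assume "\<not> ?thesis"
    then have "\<forall>r\<in>{0..<int (b k)}. \<exists>m. x m \<and> (r + m) mod int (b k) = 0" by auto
    then obtain f where f: "\<And>r. r \<in> {0..<int (b k)} \<Longrightarrow> x (f r) \<and> (r + f r) mod int (b k) = 0"
      by metis
    define M where "M = nat (\<Sum>r\<in>{0..<int (b k)}. \<bar>f r\<bar>)"
    have M: "\<bar>f r\<bar> \<le> int M" if "r \<in> {0..<int (b k)}" for r
      unfolding M_def using that by (simp add: sum_nonneg) (rule member_le_sum, auto)
    obtain j where j: "\<And>t. t < Suc (2 * M) \<Longrightarrow> x (- int M + int t) = eta (range b) (j + int t)"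
      using x unfolding free_subshift_def by blast
    define r where "r = (j + int M) mod int (b k)"
    have r: "r \<in> {0..<int (b k)}" by (simp add: r_def)
    define t where "t = nat (f r + int M)"
    have t: "int t = f r + int M" "t < Suc (2 * M)" using M[OF r] by (auto simp: t_def)
    have "eta (range b) (j + int t)" using j[OF t(2)] f[OF r] t(1) by simp
    then have "(j + int t) mod int (b k) \<noteq> 0" by (simp add: eta_iff)
    moreover have "(r + f r) mod int (b k) = (j + int t) mod int (b k)"
      by (simp add: r_def t(1) mod_add_left_eq algebra_simps)
    ultimately show False using f[OF r] by simp
  qed
next
  assume "\<forall>k. \<exists>r\<in>{0..<int (b k)}. \<forall>m. x m \<longrightarrow> (r + m) mod int (b k) \<noteq> 0"
  then obtain r where r: "\<And>k m. x m \<Longrightarrow> (r k + m) mod int (b k) \<noteq> 0" by metis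
  have "\<exists>j. \<forall>t<n. x (i + int t) = eta (range b) (j + int t)" for i n
  proof -
    from finite_b_le[of n, unfolded finite_nat_set_iff_bounded]
    obtain M where "\<forall>k\<in>{k. b k \<le> n}. k < M" ..
    then have M: "k < M" if "b k \<le> n" for k by (rule bspec) (simp add: that)
    define T where "T = {t \<in> {0..<int n}. x (i + t)}"
    \<comment> \<open>The modulus \<open>b (M + t)\<close> is used to delete the position \<open>t\<close>.\<close>
    define F where "F = {k. M \<le> k \<and> k < M + n \<and> \<not> x (i + int (k - M))}"
    define c where "c k = (if k \<in> F then - int (k - M) else r k + i)" for k
    have avoid: "(c k + t) mod int (b k) \<noteq> 0" if "t \<in> T" for k t
    proof (cases "k \<in> F")
      case True
      then have "n < b k" using M[of k] by (cases "b k \<le> n") (auto simp: F_def)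
      moreover have "t \<noteq> int (k - M)" "int (k - M) < int n" using True that by (auto simp: F_def T_def)
      moreover have "0 \<le> t" "t < int n" using that by (auto simp: T_def)
      ultimately have "\<bar>t - int (k - M)\<bar> < int (b k)" "t - int (k - M) \<noteq> 0" by auto
      then have "\<not> int (b k) dvd t - int (k - M)"
        using dvd_imp_le_int[of "t - int (k - M)" "int (b k)"] by auto
      then show ?thesis using True by (simp add: c_def dvd_eq_mod_eq_0)
    next
      case False
      then show ?thesis using r[of "i + t" k] that by (simp add: c_def T_def add.assoc)
    qed
    have "finite F" "T \<subseteq> {0..<int n}" by (auto simp: F_def T_def)
    then obtain j where j: "\<And>k. k \<in> F \<Longrightarrow> int (b k) dvd j - c k"
      "\<And>k t. t \<in> T \<Longrightarrow> (j + t) mod int (b k) \<noteq> 0"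
      using realize_pattern[OF _ _ avoid] by metis
    have "x (i + int t) = eta (range b) (j + int t)" if t: "t < n" for t
    proof (cases "x (i + int t)")
      case True
      then have "int t \<in> T" using t by (simp add: T_def)
      then show ?thesis using True j(2) by (simp add: eta_iff)
    next
      case False
      then have F: "M + t \<in> F" using t by (simp add: F_def)
      then have "int (b (M + t)) dvd j + int t" using j(1)[OF F] by (simp add: c_def)
      then show ?thesis using False by (auto simp: eta_iff dvd_eq_mod_eq_0)
    qed
    then show ?thesis by blast
  qed
  then show "x \<in> free_subshift (range b)" by (simp add: free_subshift_def)
qed

lemma free_subshift_hereditary:
  assumes "x \<in> free_subshift (range b)" "\<And>m. y m \<Longrightarrow> x m"
  shows "y \<in> free_subshift (range b)"
  using assms unfolding free_subshift_iff by meson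

lemma residue_coding_in_free_subshift: "residue_coding b \<omega> \<in> free_subshift (range b)"
  unfolding free_subshift_iff
proof
  fix k
  show "\<exists>r\<in>{0..<int (b k)}. \<forall>m. residue_coding b \<omega> m \<longrightarrow> (r + m) mod int (b k) \<noteq> 0"
    by (rule bexI[of _ "\<omega> k mod int (b k)"]) (simp_all add: residue_coding_def mod_add_left_eq)
qed

lemma shift_in_free_subshift:
  assumes "x \<in> free_subshift (range b)"
  shows "shift x \<in> free_subshift (range b)"
  unfolding free_subshift_iff
proof
  fix k
  obtain r where r: "\<And>m. x m \<Longrightarrow> (r + m) mod int (b k) \<noteq> 0"
    using assms unfolding free_subshift_iff by blast
  have "((r + 1) mod int (b k) + m) mod int (b k) \<noteq> 0" if "shift x m" for m
    using r[of "m + 1"] that by (simp add: shift_def mod_add_left_eq add.assoc add.commute[of m 1])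
  then show "\<exists>r\<in>{0..<int (b k)}. \<forall>m. shift x m \<longrightarrow> (r + m) mod int (b k) \<noteq> 0"
    by (intro bexI[of _ "(r + 1) mod int (b k)"]) auto
qed

end

section \<open>Windows of configurations\<close>

definition window :: "int \<Rightarrow> nat \<Rightarrow> config \<Rightarrow> bool list" where
  "window i n x = map (\<lambda>j. x (i + int j)) [0..<n]"

lemma length_window [simp]: "length (window i n x) = n"
  by (simp add: window_def)

lemma window_in_words [simp]: "window i n x \<in> words n"
  by (simp add: words_def)

lemma window_nth [simp]: "j < n \<Longrightarrow> window i n x ! j = x (i + int j)"
  by (simp add: window_def)

lemma window_eq_iff: "window i n x = w \<longleftrightarrow> length w = n \<and> (\<forall>j<n. x (i + int j) = w ! j)"
  by (auto simp: list_eq_iff_nth_eq)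

lemma window_shift: "window i n (shift x) = window (i + 1) n x"
  by (simp add: window_def shift_def algebra_simps)

lemma cylinder_eq_window: "cylinder X w = {x \<in> X. window 0 (length w) x = w}"
  by (auto simp: cylinder_def window_eq_iff)

lemma sets_borel_bool: "sets (borel :: bool measure) = UNIV"
  by (simp add: sets_borel_eq_count_space)

lemma sets_config: "sets (borel :: config measure) = sets (\<Pi>\<^sub>M i\<in>UNIV. count_space UNIV)"
  unfolding sets_PiM_equal_borel[symmetric]
  by (intro sets_PiM_cong) (simp_all add: sets_borel_bool)

lemma measurable_coord [measurable]: "(\<lambda>x::config. x i) \<in> measurable borel (count_space UNIV)"
proof -
  have "(\<lambda>x. x i) \<in> measurable (\<Pi>\<^sub>M i\<in>UNIV. count_space UNIV) (count_space (UNIV :: bool set))"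
    by measurable
  then show ?thesis using measurable_cong_sets[OF sets_config refl] by blast
qed

lemma measurable_config:
  assumes "\<And>i. (\<lambda>x. f x i) \<in> measurable M (count_space UNIV)"
  shows "f \<in> measurable M (borel :: config measure)"
proof -
  have "f \<in> measurable M (\<Pi>\<^sub>M i\<in>UNIV. count_space (UNIV :: bool set))"
    by (rule measurable_PiM_single') (auto intro: assms)
  then show ?thesis using measurable_cong_sets[OF refl sets_config] by blast
qed

lemma measurable_shift [measurable]: "shift \<in> measurable borel borel"
  by (rule measurable_config) (simp add: shift_def measurable_coord)

lemma pred_window [measurable]: "Measurable.pred borel (\<lambda>x. window i n x = w)"
  unfolding window_eq_iff by measurable

lemma measurable_window [measurable]: "window i n \<in> measurable borel (count_space UNIV)"
proof -
  have "window i n -` {w} \<in> sets borel" for w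
  proof -
    have "{x \<in> space borel. window i n x = w} \<in> sets borel" by measurable
    then show ?thesis by (simp add: vimage_def)
  qed
  then show ?thesis by (simp add: measurable_count_space_eq2_countable)
qed

text \<open>An event that depends on finitely many coordinates is a finite union of windows.\<close>

lemma measure_eqI_windows:
  fixes M N :: "config measure"
  assumes "prob_space M" "prob_space N" and sets: "sets M = sets borel" "sets N = sets borel"
    and eq: "\<And>i w. measure M {x. window i (length w) x = w} = measure N {x. window i (length w) x = w}"
  shows "M = N"
proof -
  interpret M: prob_space M by fact
  interpret N: prob_space N by fact
  have [measurable_cong]: "sets M = sets borel" "sets N = sets borel" by fact+
  have space: "space M = UNIV" "space N = UNIV" using sets[THEN sets_eq_imp_space_eq] by simp_all
  have distr: "distr M (count_space UNIV) (window i n) = distr N (count_space UNIV) (window i n)" for i n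
  proof (rule measure_eqI_countable[where A = UNIV])
    fix w :: "bool list"
    have "measure M {x. window i n x = w} = measure N {x. window i n x = w}"
    proof (cases "length w = n")
      case True
      then show ?thesis using eq[of i w] by simp
    next
      case False
      then have "{x. window i n x = w} = {}" by auto
      then show ?thesis by simp
    qed
    then show "emeasure (distr M (count_space UNIV) (window i n)) {w}
        = emeasure (distr N (count_space UNIV) (window i n)) {w}"
      by (simp add: emeasure_distr space vimage_def M.emeasure_eq_measure N.emeasure_eq_measure)
  qed simp_all
  show ?thesis
  proof (rule measure_eqI_PiM_infinite)
    show "sets M = sets (\<Pi>\<^sub>M i\<in>UNIV. count_space UNIV)" "sets N = sets (\<Pi>\<^sub>M i\<in>UNIV. count_space UNIV)"
      using sets sets_config by simp_all
    show "finite_measure M" by unfold_locales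
    fix A :: "int \<Rightarrow> bool set" and J :: "int set" assume J: "finite J"
    define m where "m = nat (\<Sum>j\<in>J. \<bar>j\<bar>)"
    have m: "\<bar>j\<bar> \<le> int m" if "j \<in> J" for j
    proof -
      have "\<bar>j\<bar> \<le> (\<Sum>j\<in>J. \<bar>j\<bar>)" using that J by (intro member_le_sum) auto
      then show ?thesis by (simp add: m_def)
    qed
    define W where "W = {w. \<forall>j\<in>J. w ! nat (j + int m) \<in> A j}"
    have "prod_emb UNIV (\<lambda>_. count_space UNIV) J (Pi\<^sub>E J A) = window (- int m) (2 * m + 1) -` W"
    proof -
      have "window (- int m) (2 * m + 1) x ! nat (j + int m) = x j" if "j \<in> J" for j x
        using m[OF that] by (subst window_nth) auto
      then show ?thesis by (auto simp: prod_emb_def W_def PiE_iff)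
    qed
    moreover have "emeasure M (window (- int m) (2 * m + 1) -` W)
        = emeasure (distr M (count_space UNIV) (window (- int m) (2 * m + 1))) W"
      by (subst emeasure_distr) (auto simp: space)
    moreover have "emeasure N (window (- int m) (2 * m + 1) -` W)
        = emeasure (distr N (count_space UNIV) (window (- int m) (2 * m + 1))) W"
      by (subst emeasure_distr) (auto simp: space)
    ultimately show "emeasure M (prod_emb UNIV (\<lambda>_. count_space UNIV) J (Pi\<^sub>E J A))
        = emeasure N (prod_emb UNIV (\<lambda>_. count_space UNIV) J (Pi\<^sub>E J A))"
      by (simp add: distr)
  qed
qed

lemma measure_shifted_window:
  assumes "\<mu> \<in> invariant_measures X"
  shows "measure \<mu> {x. window (i + 1) n x = w} = measure \<mu> {x. window i n x = w}"
proof -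
  have sets: "sets \<mu> = sets borel" and inv: "distr \<mu> borel shift = \<mu>"
    using assms by (auto simp: invariant_measures_def)
  have [measurable_cong]: "sets \<mu> = sets borel" by fact
  have space: "space \<mu> = UNIV" using sets_eq_imp_space_eq[OF sets] by simp
  have "measure \<mu> {x. window i n x = w} = measure (distr \<mu> borel shift) {x. window i n x = w}"
    by (simp add: inv)
  also have "\<dots> = measure \<mu> {x. window (i + 1) n x = w}"
    by (subst measure_distr) (auto simp: space vimage_def window_shift)
  finally show ?thesis by simp
qed

lemma measure_window_eq_0:
  assumes "\<mu> \<in> invariant_measures X"
  shows "measure \<mu> {x. window i n x = w} = measure \<mu> {x. window 0 n x = w}"
proof (induction i rule: int_induct[of _ 0])
  case (step1 i)
  then show ?case using measure_shifted_window[OF assms, of i n w] by simp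
next
  case (step2 i)
  then show ?case using measure_shifted_window[OF assms, of "i - 1" n w] by simp
qed simp

section \<open>Thinning a residue pattern\<close>

text \<open>\<open>thin s a v\<close> is the probability of the symbol \<open>v\<close> at a site where a point is retained with
  probability \<open>s\<close> if \<open>a\<close> holds, and no point is present otherwise.\<close>

definition thin :: "real \<Rightarrow> bool \<Rightarrow> bool \<Rightarrow> real" where
  "thin s a v = (if a then (if v then s else 1 - s) else (if v then 0 else 1))"

lemma thin_nonneg: "0 \<le> s \<Longrightarrow> s \<le> 1 \<Longrightarrow> 0 \<le> thin s a v"
  by (simp add: thin_def)

lemma thin_le_1: "0 \<le> s \<Longrightarrow> s \<le> 1 \<Longrightarrow> thin s a v \<le> 1"
  by (simp add: thin_def)

context coprime_moduli
begin

abbreviation "haar \<equiv> residue_haar b"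

abbreviation "code \<equiv> residue_coding b"

lemma product_prob_space_residues:
  "product_prob_space (\<lambda>i. uniform_count_measure {0..<int (b i)})"
proof -
  have "prob_space (uniform_count_measure {0..<int (b i)})" for i
    by (rule prob_space_uniform_count_measure) (auto simp: not_le)
  then show ?thesis
    by (intro product_prob_spaceI)
qed

lemma prob_space_haar: "prob_space haar"
  unfolding residue_haar_def
  by (rule prob_space_PiM) (use product_prob_space_residues in \<open>simp add: product_prob_space_def product_prob_space_axioms_def\<close>)

lemma space_haar: "space haar = (\<Pi>\<^sub>E i\<in>UNIV. {0..<int (b i)})"
  by (simp add: residue_haar_def space_PiM space_uniform_count_measure)

lemma measurable_haar_coord [measurable]: "(\<lambda>\<omega>. \<omega> k) \<in> measurable haar (count_space UNIV)"
proof -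
  have "(\<lambda>\<omega>. \<omega> k) \<in> measurable haar (uniform_count_measure {0..<int (b k)})"
    unfolding residue_haar_def by measurable
  then have "(\<lambda>\<omega>. \<omega> k) \<in> measurable haar (count_space {0..<int (b k)})"
    using measurable_cong_sets[OF refl sets_uniform_count_measure_count_space] by blast
  then show ?thesis
    by (rule measurable_compose[where g = "\<lambda>x. x"]) simp
qed

lemma pred_allowed [measurable]: "Measurable.pred haar (\<lambda>\<omega>. allowed K \<omega> m)"
  unfolding allowed_def by measurable

lemma pred_code [measurable]: "Measurable.pred haar (\<lambda>\<omega>. code \<omega> m)"
  unfolding residue_coding_def by measurable

lemma measurable_code [measurable]: "code \<in> measurable haar borel"
  by (rule measurable_config) measurable

lemma haar_clock:
  assumes "\<rho> \<in> clocks K"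
  shows "measure haar {\<omega> \<in> space haar. restrict \<omega> {..<K} = \<rho>} = 1 / real (period K)"
proof -
  let ?M = "\<lambda>i. uniform_count_measure {0..<int (b i)}"
  interpret product_prob_space ?M UNIV by (rule product_prob_space_residues)
  have \<rho>: "\<rho> k \<in> {0..<int (b k)}" if "k < K" for k using assms that by (simp add: clocks_iff)
  have "{\<omega> \<in> space haar. restrict \<omega> {..<K} = \<rho>} = prod_emb UNIV ?M {..<K} (\<Pi>\<^sub>E k\<in>{..<K}. {\<rho> k})"
  proof (rule set_eqI)
    fix \<omega>
    have "restrict \<omega> {..<K} = \<rho> \<longleftrightarrow> (\<forall>k<K. \<omega> k = \<rho> k)"
      using assms by (auto simp: fun_eq_iff clocks_iff extensional_def)
    then show "\<omega> \<in> {\<omega> \<in> space haar. restrict \<omega> {..<K} = \<rho>} \<longleftrightarrow>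
        \<omega> \<in> prod_emb UNIV ?M {..<K} (\<Pi>\<^sub>E k\<in>{..<K}. {\<rho> k})"
      by (simp add: prod_emb_iff space_haar space_uniform_count_measure PiE_iff restrict_PiE_iff Ball_def conj_commute)
  qed
  then have "measure haar {\<omega> \<in> space haar. restrict \<omega> {..<K} = \<rho>} = (\<Prod>k<K. measure (?M k) {\<rho> k})"
    unfolding residue_haar_def using \<rho>
    by (simp only:) (rule measure_PiM_emb, auto simp: sets_uniform_count_measure)
  also have "\<dots> = (\<Prod>k<K. 1 / real (b k))"
    using \<rho> by (intro prod.cong refl) (simp add: measure_uniform_count_measure)
  also have "\<dots> = 1 / real (period K)"
    by (simp add: period_def prod_dividef)
  finally show ?thesis .
qed

lemma restrict_in_clocks: "\<omega> \<in> space haar \<Longrightarrow> restrict \<omega> {..<K} \<in> clocks K"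
  by (auto simp: space_haar clocks_iff PiE_iff)

lemma pred_restrict [measurable]: "Measurable.pred haar (\<lambda>\<omega>. restrict \<omega> {..<K} = \<rho>)"
proof -
  have "restrict \<omega> {..<K} = \<rho> \<longleftrightarrow> \<rho> \<in> extensional {..<K} \<and> (\<forall>k<K. \<omega> k = \<rho> k)" for \<omega>
    by (auto simp: fun_eq_iff extensional_def)
  then show ?thesis by simp
qed

lemma haar_integral_clock:
  "(\<integral>\<omega>. F (restrict \<omega> {..<K}) \<partial>haar) = (\<Sum>\<rho>\<in>clocks K. F \<rho>) / real (period K)"
proof -
  interpret prob_space haar by (rule prob_space_haar)
  have "(\<integral>\<omega>. F (restrict \<omega> {..<K}) \<partial>haar)
      = (\<integral>\<omega>. (\<Sum>\<rho>\<in>clocks K. F \<rho> * indicator {\<omega> \<in> space haar. restrict \<omega> {..<K} = \<rho>} \<omega>) \<partial>haar)"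
  proof (rule Bochner_Integration.integral_cong[OF refl])
    fix \<omega> assume \<omega>: "\<omega> \<in> space haar"
    have "(\<Sum>\<rho>\<in>clocks K. F \<rho> * indicator {\<omega> \<in> space haar. restrict \<omega> {..<K} = \<rho>} \<omega>)
        = (\<Sum>\<rho>\<in>clocks K. if \<rho> = restrict \<omega> {..<K} then F \<rho> else 0)"
      using \<omega> by (intro sum.cong refl) (auto simp: indicator_def)
    also have "\<dots> = F (restrict \<omega> {..<K})"
      using restrict_in_clocks[OF \<omega>] by simp
    finally show "F (restrict \<omega> {..<K})
        = (\<Sum>\<rho>\<in>clocks K. F \<rho> * indicator {\<omega> \<in> space haar. restrict \<omega> {..<K} = \<rho>} \<omega>)" by simp
  qed
  also have "\<dots> = (\<Sum>\<rho>\<in>clocks K. F \<rho> * measure haar {\<omega> \<in> space haar. restrict \<omega> {..<K} = \<rho>})"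
    by (subst Bochner_Integration.integral_sum) (simp_all add: integrable_real_indicator emeasure_eq_measure)
  also have "\<dots> = (\<Sum>\<rho>\<in>clocks K. F \<rho>) / real (period K)"
    by (simp add: haar_clock sum_divide_distrib)
  finally show ?thesis .
qed

lemma allowed_restrict: "allowed K (restrict \<omega> {..<K}) m = allowed K \<omega> m"
  by (simp add: allowed_def)

lemma eventually_allowed_eq_code: "eventually (\<lambda>K. allowed K \<omega> m = code \<omega> m) sequentially"
proof (cases "code \<omega> m")
  case True
  then show ?thesis by (simp add: allowed_def residue_coding_def)
next
  case False
  then have "\<exists>k. (\<omega> k + m) mod int (b k) = 0" by (simp only: residue_coding_def not_all not_not)
  then obtain k where "(\<omega> k + m) mod int (b k) = 0" ..
  then have "\<not> allowed K \<omega> m" if "k < K" for K using that by (auto simp: allowed_def)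
  then show ?thesis
    by (intro eventually_mono[OF eventually_gt_at_top[of k]]) (use False in simp)
qed

text \<open>The probability that the window at \<open>i\<close> of the thinned residue pattern is \<open>w\<close>; in
  \<open>thinned_clock\<close> only the first \<open>K\<close> moduli delete positions, and the integral is a finite mean.\<close>

definition thinned_window :: "real \<Rightarrow> int \<Rightarrow> bool list \<Rightarrow> real" where
  "thinned_window s i w = (\<integral>\<omega>. (\<Prod>j<length w. thin s (code \<omega> (i + int j)) (w ! j)) \<partial>haar)"

definition thinned_clock :: "real \<Rightarrow> nat \<Rightarrow> int \<Rightarrow> bool list \<Rightarrow> real" where
  "thinned_clock s K i w = (\<Sum>\<rho>\<in>clocks K. \<Prod>j<length w. thin s (allowed K \<rho> (i + int j)) (w ! j)) / real (period K)"

lemma prod_thin_bounds: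
  assumes "0 \<le> s" "s \<le> 1"
  shows "0 \<le> (\<Prod>j<n. thin s (a j) (v j))" "(\<Prod>j<n. thin s (a j) (v j)) \<le> 1"
  using assms by (auto intro!: prod_nonneg prod_le_1 thin_nonneg thin_le_1)

lemma prod_thin_norm:
  assumes "0 \<le> s" "s \<le> 1"
  shows "norm (\<Prod>j<n. thin s (a j) (v j)) \<le> 1"
  using prod_thin_bounds[OF assms, where a = a and v = v and n = n] by (simp del: prod_nonneg)

lemma measurable_thin [measurable]:
  "(\<lambda>\<omega>. thin s (code \<omega> m) v) \<in> borel_measurable haar"
  "(\<lambda>\<omega>. thin s (allowed K \<omega> m) v) \<in> borel_measurable haar"
  unfolding thin_def by measurable

lemma integrable_prod_thin:
  assumes "0 \<le> s" "s \<le> 1"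
  shows "integrable haar (\<lambda>\<omega>. \<Prod>j<n. thin s (code \<omega> (i + int j)) (w ! j))"
proof -
  interpret prob_space haar by (rule prob_space_haar)
  show ?thesis
    by (intro integrable_const_bound[where B = 1] AE_I2 prod_thin_norm assms) measurable
qed

lemma thinned_clock_tendsto:
  assumes s: "0 \<le> s" "s \<le> 1"
  shows "(\<lambda>K. thinned_clock s K i w) \<longlonglongrightarrow> thinned_window s i w"
proof -
  interpret prob_space haar by (rule prob_space_haar)
  let ?f = "\<lambda>K \<omega>. \<Prod>j<length w. thin s (allowed K \<omega> (i + int j)) (w ! j)"
  have "thinned_clock s K i w = (\<integral>\<omega>. ?f K \<omega> \<partial>haar)" for K
    using haar_integral_clock[of "?f K" K] by (simp add: thinned_clock_def allowed_restrict)
  moreover have "(\<lambda>K. \<integral>\<omega>. ?f K \<omega> \<partial>haar) \<longlonglongrightarrow> thinned_window s i w"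
    unfolding thinned_window_def
  proof (rule integral_dominated_convergence[where w = "\<lambda>_. 1"])
    show "AE \<omega> in haar. (\<lambda>K. ?f K \<omega>) \<longlonglongrightarrow> (\<Prod>j<length w. thin s (code \<omega> (i + int j)) (w ! j))"
    proof (rule AE_I2)
      fix \<omega>
      have "eventually (\<lambda>K. \<forall>j\<in>{..<length w}. allowed K \<omega> (i + int j) = code \<omega> (i + int j)) sequentially"
        by (intro eventually_ball_finite ballI eventually_allowed_eq_code) simp
      then have "eventually (\<lambda>K. ?f K \<omega> = (\<Prod>j<length w. thin s (code \<omega> (i + int j)) (w ! j))) sequentially"
        by eventually_elim (auto intro!: prod.cong)
      then show "(\<lambda>K. ?f K \<omega>) \<longlonglongrightarrow> (\<Prod>j<length w. thin s (code \<omega> (i + int j)) (w ! j))"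
        by (rule tendsto_eventually)
    qed
    show "AE \<omega> in haar. norm (?f K \<omega>) \<le> 1" for K
      by (intro AE_I2 prod_thin_norm s)
  qed simp_all
  ultimately show ?thesis by simp
qed

lemma thinned_clock_shift: "thinned_clock s K i w = thinned_clock s K 0 w"
proof -
  have "(\<Sum>\<rho>\<in>clocks K. \<Prod>j<length w. thin s (allowed K \<rho> (i + int j)) (w ! j))
      = (\<Sum>\<rho>\<in>clocks K. \<Prod>j<length w. thin s (allowed K (rot K i \<rho>) (0 + int j)) (w ! j))"
    by (simp add: allowed_rot)
  also have "\<dots> = (\<Sum>\<rho>\<in>clocks K. \<Prod>j<length w. thin s (allowed K \<rho> (0 + int j)) (w ! j))"
    by (rule sum.reindex_bij_betw[OF bij_rot])
  finally show ?thesis by (simp add: thinned_clock_def)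
qed

text \<open>Every finite clock is invariant under rotation, and the invariance passes to the limit.\<close>

lemma thinned_window_shift:
  assumes "0 \<le> s" "s \<le> 1"
  shows "thinned_window s i w = thinned_window s 0 w"
  using thinned_clock_tendsto[OF assms, of i w] thinned_clock_tendsto[OF assms, of 0 w]
  unfolding thinned_clock_shift[of _ _ i] by (rule LIMSEQ_unique)

lemma thinned_window_True:
  assumes "0 \<le> s" "s \<le> 1"
  shows "thinned_window s 0 [True] = s * density"
proof -
  have "thinned_clock s K 0 [True] = s * dens K" for K
  proof -
    have "thinned_clock s K 0 [True] = (\<Sum>\<rho>\<in>clocks K. if allowed K \<rho> 0 then s else 0) / real (period K)"
      by (simp add: thinned_clock_def thin_def)
    also have "\<dots> = s * real (card {\<rho> \<in> clocks K. allowed K \<rho> 0}) / real (period K)"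
      by (simp add: sum.inter_filter[symmetric] mult.commute)
    also have "\<dots> = s * dens K" using period_pos[of K] by (simp add: card_allowed del: period_pos)
    finally show ?thesis .
  qed
  then have "(\<lambda>K. s * dens K) \<longlonglongrightarrow> thinned_window s 0 [True]"
    using thinned_clock_tendsto[OF assms, of 0 "[True]"] by simp
  moreover have "(\<lambda>K. s * dens K) \<longlonglongrightarrow> s * density"
    by (intro tendsto_intros dens_tendsto)
  ultimately show ?thesis by (rule LIMSEQ_unique)
qed

section \<open>The convolution of the Mirsky measure with a Bernoulli measure\<close>

abbreviation "conv p \<equiv> mult_convolution (mirsky_measure b) (bernoulli_measure p)"

lemma prob_space_mirsky: "prob_space (mirsky_measure b)"
  unfolding mirsky_measure_def by (intro prob_space.prob_space_distr prob_space_haar measurable_code)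

lemma prob_space_bernoulli: "prob_space (bernoulli_measure p)"
  unfolding bernoulli_measure_def by (intro prob_space_PiM measure_pmf.prob_space_axioms)

lemma sets_mirsky [measurable_cong]: "sets (mirsky_measure b) = sets borel"
  by (simp add: mirsky_measure_def)

lemma sets_bernoulli [measurable_cong]: "sets (bernoulli_measure p) = sets borel"
  unfolding bernoulli_measure_def sets_config by (intro sets_PiM_cong) simp_all

lemma measurable_meet [measurable]:
  "(\<lambda>(x, y) i. x i \<and> y i) \<in> measurable (mirsky_measure b \<Otimes>\<^sub>M bernoulli_measure p) (borel :: config measure)"
  by (rule measurable_config, simp only: case_prod_beta') measurable

lemma prob_space_conv: "prob_space (conv p)"
proof -
  interpret M: prob_space "mirsky_measure b" by (rule prob_space_mirsky)
  interpret N: prob_space "bernoulli_measure p" by (rule prob_space_bernoulli)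
  interpret pair_prob_space "mirsky_measure b" "bernoulli_measure p" ..
  show ?thesis
    unfolding mult_convolution_def by (rule prob_space_distr) measurable
qed

lemma sets_conv: "sets (conv p) = sets borel"
  by (simp add: mult_convolution_def)

lemma bernoulli_window:
  assumes p: "0 \<le> p" "p \<le> 1"
  shows "emeasure (bernoulli_measure p) {y. window i (length w) (\<lambda>m. x m \<and> y m) = w}
    = ennreal (\<Prod>j<length w. thin (1 - p) (x (i + int j)) (w ! j))"
proof -
  let ?M = "\<lambda>_::int. measure_pmf (bernoulli_pmf (1 - p))"
  let ?J = "(\<lambda>j. i + int j) ` {..<length w}"
  let ?A = "\<lambda>m. {v. (x m \<and> v) = w ! nat (m - i)}"
  have "{y. window i (length w) (\<lambda>m. x m \<and> y m) = w} = prod_emb UNIV ?M ?J (Pi\<^sub>E ?J ?A)"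
    by (auto simp: window_eq_iff prod_emb_iff PiE_iff restrict_PiE_iff)
  then have "emeasure (bernoulli_measure p) {y. window i (length w) (\<lambda>m. x m \<and> y m) = w}
      = (\<Prod>m\<in>?J. emeasure (?M m) (?A m))"
    unfolding bernoulli_measure_def
    by (simp only:) (rule emeasure_PiM_emb, auto intro: measure_pmf.prob_space_axioms)
  also have "\<dots> = (\<Prod>j<length w. emeasure (?M 0) (?A (i + int j)))"
    by (subst prod.reindex) (auto simp: inj_on_def)
  also have "\<dots> = (\<Prod>j<length w. ennreal (thin (1 - p) (x (i + int j)) (w ! j)))"
  proof (intro prod.cong refl)
    fix j
    have "{v. v = w ! j} = {w ! j}" by auto
    then show "emeasure (?M 0) (?A (i + int j)) = ennreal (thin (1 - p) (x (i + int j)) (w ! j))"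
      using p by (cases "x (i + int j)"; cases "w ! j") (auto simp: thin_def emeasure_pmf_single measure_pmf.emeasure_space_1[simplified])
  qed
  also have "\<dots> = ennreal (\<Prod>j<length w. thin (1 - p) (x (i + int j)) (w ! j))"
    using p by (intro prod_ennreal thin_nonneg) auto
  finally show ?thesis .
qed

lemma measure_conv_window:
  assumes p: "0 \<le> p" "p \<le> 1"
  shows "measure (conv p) {x. window i (length w) x = w} = thinned_window (1 - p) i w"
proof -
  interpret N: prob_space "bernoulli_measure p" by (rule prob_space_bernoulli)
  let ?P = "mirsky_measure b \<Otimes>\<^sub>M bernoulli_measure p"
  let ?S = "{x. window i (length w) x = w}"
  have S: "?S \<in> sets borel"
    using measurable_sets[OF measurable_window, of "{w}" i "length w"] by (simp add: vimage_def)
  have space: "space ?P = UNIV"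
    using sets_eq_imp_space_eq[OF sets_mirsky] sets_eq_imp_space_eq[OF sets_bernoulli]
    by (simp add: space_pair_measure)
  let ?T = "(\<lambda>(x, y) i. x i \<and> y i) -` ?S"
  have T: "?T \<in> sets ?P"
    using measurable_sets[OF measurable_meet[of p] S] by (simp only: space Int_UNIV_right)
  have "emeasure (conv p) ?S = emeasure ?P ?T"
    unfolding mult_convolution_def by (subst emeasure_distr[OF measurable_meet S]) (simp add: space)
  also have "\<dots> = (\<integral>\<^sup>+x. emeasure (bernoulli_measure p) (Pair x -` ?T) \<partial>mirsky_measure b)"
    by (rule N.emeasure_pair_measure_alt[OF T])
  also have "\<dots> = (\<integral>\<^sup>+x. ennreal (\<Prod>j<length w. thin (1 - p) (x (i + int j)) (w ! j)) \<partial>mirsky_measure b)"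
    by (simp add: vimage_def bernoulli_window[OF p])
  also have "\<dots> = (\<integral>\<^sup>+\<omega>. ennreal (\<Prod>j<length w. thin (1 - p) (code \<omega> (i + int j)) (w ! j)) \<partial>haar)"
    unfolding mirsky_measure_def by (subst nn_integral_distr) (auto simp: thin_def)
  also have "\<dots> = ennreal (thinned_window (1 - p) i w)"
    unfolding thinned_window_def using p prod_thin_bounds[of "1 - p"]
    by (intro nn_integral_eq_integral integrable_prod_thin) (auto intro!: AE_I2)
  finally have "emeasure (conv p) ?S = ennreal (thinned_window (1 - p) i w)" .
  moreover have "0 \<le> thinned_window (1 - p) i w"
    unfolding thinned_window_def using p prod_thin_bounds[of "1 - p"] by (intro integral_nonneg_AE) (auto intro!: AE_I2)
  ultimately show ?thesis by (simp add: measure_def)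
qed

abbreviation "XF \<equiv> free_subshift (range b)"

lemma sets_XF [measurable]: "XF \<in> sets borel"
proof -
  have "XF = {x \<in> space borel. \<forall>k. \<exists>r\<in>{0..<int (b k)}. \<forall>m. x m \<longrightarrow> (r + m) mod int (b k) \<noteq> 0}"
    by (auto simp: free_subshift_iff)
  also have "\<dots> \<in> sets borel" by measurable
  finally show ?thesis .
qed

text \<open>Shift invariance is read off from the window probabilities, and the support property from
  heredity of the subshift.\<close>

lemma conv_invariant:
  assumes p: "0 \<le> p" "p \<le> 1"
  shows "conv p \<in> invariant_measures XF"
proof -
  interpret C: prob_space "conv p" by (rule prob_space_conv)
  interpret N: prob_space "bernoulli_measure p" by (rule prob_space_bernoulli)
  interpret M: prob_space "mirsky_measure b" by (rule prob_space_mirsky)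
  interpret P: pair_prob_space "mirsky_measure b" "bernoulli_measure p" ..
  note [measurable_cong] = sets_conv
  have spaceC: "space (conv p) = UNIV" using sets_eq_imp_space_eq[OF sets_conv] by simp
  have "distr (conv p) borel shift = conv p"
  proof (rule measure_eqI_windows)
    show "prob_space (distr (conv p) borel shift)"
      by (rule C.prob_space_distr) measurable
    fix i :: int and w :: "bool list"
    have "measure (distr (conv p) borel shift) {x. window i (length w) x = w}
        = measure (conv p) {x. window (i + 1) (length w) x = w}"
      by (subst measure_distr) (auto simp: spaceC vimage_def window_shift)
    also have "\<dots> = measure (conv p) {x. window i (length w) x = w}"
      using p by (simp add: measure_conv_window thinned_window_shift[of "1 - p" "i + 1"] thinned_window_shift[of "1 - p" i])
    finally show "measure (distr (conv p) borel shift) {x. window i (length w) x = w}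
        = measure (conv p) {x. window i (length w) x = w}" .
  qed (simp_all add: prob_space_conv sets_conv)
  moreover have "measure (conv p) XF = 1"
  proof -
    have "AE x in mirsky_measure b. x \<in> XF"
      unfolding mirsky_measure_def
      by (subst AE_distr_iff) (auto simp: residue_coding_in_free_subshift)
    then have "AE x in mirsky_measure b. AE y in bernoulli_measure p. (\<lambda>i. x i \<and> y i) \<in> XF"
    proof eventually_elim
      case (elim x)
      show ?case by (rule AE_I2, rule free_subshift_hereditary[OF elim]) simp
    qed
    then have "AE z in mirsky_measure b \<Otimes>\<^sub>M bernoulli_measure p. (\<lambda>(x, y) i. x i \<and> y i) z \<in> XF"
      by (intro P.AE_pair_measure) (auto simp: case_prod_beta')
    then have "AE x in conv p. x \<in> XF"
      unfolding mult_convolution_def by (subst AE_distr_iff) (auto)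
    then show ?thesis using C.prob_eq_1[of XF] by (simp add: sets_conv)
  qed
  ultimately show ?thesis by (simp add: invariant_measures_def prob_space_conv sets_conv)
qed

end

section \<open>Entropy relative to the residue clock\<close>

lemma window_Suc_Cons: "window i (Suc n) x = v # w \<longleftrightarrow> x i = v \<and> window (i + 1) n x = w"
proof -
  have "window i (Suc n) x = x i # window (i + 1) n x"
    by (simp add: window_def upt_conv_Cons map_Suc_upt[symmetric] algebra_simps del: upt_Suc)
  then show ?thesis by simp
qed

lemma window_Suc_snoc: "window i (Suc n) x = w @ [v] \<longleftrightarrow> window i n x = w \<and> x (i + int n) = v"
  by (simp add: window_def)

context coprime_moduli
begin

text \<open>A configuration with few ones may miss several classes of a modulus, so that it does not determine
  a clock state. The state is therefore chosen at random, uniformly among the compatible ones; this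
  choice commutes with the shift.\<close>

definition missed :: "nat \<Rightarrow> config \<Rightarrow> (nat \<Rightarrow> int) set" where
  "missed K x = {\<rho> \<in> clocks K. \<forall>m. x m \<longrightarrow> allowed K \<rho> m}"

definition clock_weight :: "nat \<Rightarrow> (nat \<Rightarrow> int) \<Rightarrow> config \<Rightarrow> real" where
  "clock_weight K \<rho> x = (if \<rho> \<in> missed K x then 1 / real (card (missed K x)) else 0)"

definition joint_law :: "config measure \<Rightarrow> nat \<Rightarrow> bool list \<Rightarrow> (nat \<Rightarrow> int) \<Rightarrow> real" where
  "joint_law \<mu> K w \<rho> = (\<integral>x. (if window 0 (length w) x = w then clock_weight K \<rho> x else 0) \<partial>\<mu>)"

lemma clocks_0: "clocks 0 = {\<lambda>_. undefined}"
  by (simp add: clocks_def)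

lemma missed_subset: "missed K x \<subseteq> clocks K"
  by (auto simp: missed_def)

lemma finite_missed [simp]: "finite (missed K x)"
  using missed_subset finite_clocks by (rule finite_subset)

lemma missed_nonempty:
  assumes "x \<in> free_subshift (range b)"
  shows "missed K x \<noteq> {}"
proof -
  obtain r where r: "\<forall>k. r k \<in> {0..<int (b k)} \<and> (\<forall>m. x m \<longrightarrow> (r k + m) mod int (b k) \<noteq> 0)"
    using assms unfolding free_subshift_iff by metis
  then have "restrict r {..<K} \<in> missed K x"
    by (auto simp: missed_def clocks_iff allowed_def)
  then show ?thesis by blast
qed

lemma missed_shift: "missed K (shift x) = rot K 1 ` missed K x"
proof -
  have *: "rot K 1 \<rho> \<in> missed K (shift x) \<longleftrightarrow> \<rho> \<in> missed K x" if "\<rho> \<in> clocks K" for \<rho>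
  proof -
    have "(\<forall>m. x (m + 1) \<longrightarrow> allowed K \<rho> (1 + m)) \<longleftrightarrow> (\<forall>m. x m \<longrightarrow> allowed K \<rho> m)"
      by (metis add.commute diff_add_cancel)
    then show ?thesis using that by (simp add: missed_def allowed_rot shift_def)
  qed
  have "\<sigma> \<in> rot K 1 ` missed K x" if \<sigma>: "\<sigma> \<in> missed K (shift x)" for \<sigma>
  proof -
    have "\<sigma> \<in> clocks K" using \<sigma> missed_subset by blast
    then have eq: "\<sigma> = rot K 1 (rot K (- 1) \<sigma>)" by (simp add: rot_rot rot_0)
    then have "rot K (- 1) \<sigma> \<in> missed K x" using *[of "rot K (- 1) \<sigma>"] \<sigma> by simp
    with eq show ?thesis by blast
  qed
  moreover have "rot K 1 \<rho> \<in> missed K (shift x)" if "\<rho> \<in> missed K x" for \<rho>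
    using * that missed_subset by blast
  ultimately show ?thesis by blast
qed

lemma clock_weight_shift:
  assumes "\<rho> \<in> clocks K"
  shows "clock_weight K (rot K 1 \<rho>) (shift x) = clock_weight K \<rho> x"
proof -
  have inj: "inj_on (rot K 1) (clocks K)" using bij_rot by (rule bij_betw_imp_inj_on)
  then have "card (missed K (shift x)) = card (missed K x)"
    unfolding missed_shift using missed_subset by (intro card_image) (rule inj_on_subset)
  moreover have "rot K 1 \<rho> \<in> missed K (shift x) \<longleftrightarrow> \<rho> \<in> missed K x"
    unfolding missed_shift using inj assms missed_subset by (intro inj_on_image_mem_iff)
  ultimately show ?thesis by (simp add: clock_weight_def)
qed

lemma clock_weight_bounds: "0 \<le> clock_weight K \<rho> x" "clock_weight K \<rho> x \<le> 1"
proof -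
  show "0 \<le> clock_weight K \<rho> x" by (simp add: clock_weight_def)
  have "1 \<le> card (missed K x)" if "\<rho> \<in> missed K x"
    using that by (metis One_nat_def Suc_leI card_gt_0_iff empty_iff finite_missed)
  then show "clock_weight K \<rho> x \<le> 1" by (auto simp: clock_weight_def divide_le_eq_1)
qed

lemma sum_clock_weight:
  assumes "x \<in> free_subshift (range b)"
  shows "(\<Sum>\<rho>\<in>clocks K. clock_weight K \<rho> x) = 1"
proof -
  have "(\<Sum>\<rho>\<in>clocks K. clock_weight K \<rho> x) = (\<Sum>\<rho>\<in>missed K x. 1 / real (card (missed K x)))"
    unfolding clock_weight_def using missed_subset[of K x]
    by (simp add: sum.If_cases Int_absorb1)
  then show ?thesis using missed_nonempty[OF assms, of K] by simp
qed

lemma measurable_clock_weight [measurable]: "clock_weight K \<rho> \<in> borel_measurable borel"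
proof -
  have [measurable]: "Measurable.pred borel (\<lambda>x. \<sigma> \<in> missed K x)" for \<sigma>
    unfolding missed_def mem_Collect_eq by measurable
  have "real (card (missed K x)) = (\<Sum>\<sigma>\<in>clocks K. if \<sigma> \<in> missed K x then 1 else 0)" for x
    using missed_subset[of K x] by (simp add: sum.If_cases Int_absorb1)
  then have "clock_weight K \<rho> = (\<lambda>x. if \<rho> \<in> missed K x then 1 / (\<Sum>\<sigma>\<in>clocks K. if \<sigma> \<in> missed K x then 1 else 0) else 0)"
    by (simp add: clock_weight_def fun_eq_iff)
  then show ?thesis by simp
qed

end

locale free_measure = coprime_moduli +
  fixes \<mu> :: "config measure"
  assumes inv: "\<mu> \<in> invariant_measures (free_subshift (range b))"
begin

sublocale prob_space \<mu>
  using inv by (simp add: invariant_measures_def)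

lemma sets_mu [measurable_cong]: "sets \<mu> = sets borel"
  using inv by (simp add: invariant_measures_def)

lemma space_mu [simp]: "space \<mu> = UNIV"
  using sets_eq_imp_space_eq[OF sets_mu] by simp

lemma prob_UNIV [simp]: "prob UNIV = 1"
  using prob_space by simp

lemma AE_free: "AE x in \<mu>. x \<in> XF"
  using inv prob_eq_1[of XF] by (simp add: invariant_measures_def sets_mu)

lemma distr_shift: "distr \<mu> borel shift = \<mu>"
  using inv by (simp add: invariant_measures_def)

lemma integral_shift:
  fixes f :: "config \<Rightarrow> real"
  assumes [measurable]: "f \<in> borel_measurable borel"
  shows "(\<integral>x. f (shift x) \<partial>\<mu>) = (\<integral>x. f x \<partial>\<mu>)"
proof -
  have "(\<integral>x. f x \<partial>\<mu>) = (\<integral>x. f x \<partial>distr \<mu> borel shift)" by (simp add: distr_shift)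
  also have "\<dots> = (\<integral>x. f (shift x) \<partial>\<mu>)" by (rule integral_distr) measurable
  finally show ?thesis by simp
qed

lemma integrable_joint:
  "integrable \<mu> (\<lambda>x. if window i n x = w then clock_weight K \<rho> x else 0)"
proof (rule integrable_const_bound[where B = 1])
  show "AE x in \<mu>. norm (if window i n x = w then clock_weight K \<rho> x else 0) \<le> 1"
    using clock_weight_bounds by (intro AE_I2) simp
qed measurable

lemma stationary_joint_law: "stationary_family (clocks K) (rot K 1) (joint_law \<mu> K)"
proof
  show "finite (clocks K)" by simp
  show "bij_betw (rot K 1) (clocks K) (clocks K)" by (rule bij_rot)
  fix w \<rho>
  show "0 \<le> joint_law \<mu> K w \<rho>"
    unfolding joint_law_def using clock_weight_bounds by (intro integral_nonneg_AE AE_I2) simp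
  show "joint_law \<mu> K w \<rho> = joint_law \<mu> K (w @ [True]) \<rho> + joint_law \<mu> K (w @ [False]) \<rho>"
  proof -
    have "joint_law \<mu> K w \<rho> = (\<integral>x. (if window 0 (length (w @ [True])) x = w @ [True] then clock_weight K \<rho> x else 0)
        + (if window 0 (length (w @ [False])) x = w @ [False] then clock_weight K \<rho> x else 0) \<partial>\<mu>)"
      unfolding joint_law_def
      by (intro Bochner_Integration.integral_cong refl) (auto simp: window_Suc_snoc)
    also have "\<dots> = joint_law \<mu> K (w @ [True]) \<rho> + joint_law \<mu> K (w @ [False]) \<rho>"
      unfolding joint_law_def by (rule Bochner_Integration.integral_add; rule integrable_joint)
    finally show ?thesis .
  qed
  assume \<rho>: "\<rho> \<in> clocks K"
  have "joint_law \<mu> K w (rot K 1 \<rho>)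
      = (\<integral>x. (if window 0 (length w) (shift x) = w then clock_weight K (rot K 1 \<rho>) (shift x) else 0) \<partial>\<mu>)"
    unfolding joint_law_def by (rule integral_shift[symmetric]) measurable
  also have "\<dots> = (\<integral>x. (if window 1 (length w) x = w then clock_weight K \<rho> x else 0) \<partial>\<mu>)"
    by (simp add: window_shift clock_weight_shift[OF \<rho>] cong: if_cong)
  also have "\<dots> = (\<integral>x. (if window 0 (length (True # w)) x = True # w then clock_weight K \<rho> x else 0)
        + (if window 0 (length (False # w)) x = False # w then clock_weight K \<rho> x else 0) \<partial>\<mu>)"
    by (intro Bochner_Integration.integral_cong refl) (auto simp: window_Suc_Cons)
  also have "\<dots> = joint_law \<mu> K (True # w) \<rho> + joint_law \<mu> K (False # w) \<rho>"
    unfolding joint_law_def by (rule Bochner_Integration.integral_add; rule integrable_joint)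
  finally show "joint_law \<mu> K w (rot K 1 \<rho>) = joint_law \<mu> K (True # w) \<rho> + joint_law \<mu> K (False # w) \<rho>" .
next
  have "(\<Sum>\<rho>\<in>clocks K. joint_law \<mu> K [] \<rho>) = (\<integral>x. (\<Sum>\<rho>\<in>clocks K. clock_weight K \<rho> x) \<partial>\<mu>)"
    unfolding joint_law_def using integrable_joint[of 0 0 "[]" K]
    by (subst Bochner_Integration.integral_sum) (auto simp: window_eq_iff)
  also have "\<dots> = (\<integral>x. 1 \<partial>\<mu>)"
    by (rule integral_cong_AE) (use AE_free in \<open>auto simp: sum_clock_weight elim!: eventually_mono\<close>)
  finally show "(\<Sum>\<rho>\<in>clocks K. joint_law \<mu> K [] \<rho>) = 1" by simp
qed

sublocale clock: stationary_family "clocks K" "rot K 1" "joint_law \<mu> K" for K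
  by (rule stationary_joint_law)

lemma sum_joint_law: "(\<Sum>\<rho>\<in>clocks K. joint_law \<mu> K w \<rho>) = measure \<mu> {x. window 0 (length w) x = w}"
proof -
  have "(\<Sum>\<rho>\<in>clocks K. joint_law \<mu> K w \<rho>)
      = (\<integral>x. (\<Sum>\<rho>\<in>clocks K. if window 0 (length w) x = w then clock_weight K \<rho> x else 0) \<partial>\<mu>)"
    unfolding joint_law_def by (subst Bochner_Integration.integral_sum) (auto intro: integrable_joint)
  also have "\<dots> = (\<integral>x. indicator {x. window 0 (length w) x = w} x \<partial>\<mu>)"
    by (rule integral_cong_AE)
      (use AE_free in \<open>auto simp: sum_clock_weight indicator_def elim!: eventually_mono\<close>)
  finally show ?thesis by simp
qed

text \<open>The law of the clock is invariant under rotation, and the rotation has a single orbit.\<close>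

lemma joint_law_Nil:
  assumes "\<rho> \<in> clocks K"
  shows "joint_law \<mu> K [] \<rho> = 1 / real (period K)"
proof -
  have inv: "joint_law \<mu> K [] (rot K (int j) \<rho>) = joint_law \<mu> K [] \<rho>" for j
  proof (induction j)
    case (Suc j)
    have "rot K (int (Suc j)) \<rho> = rot K 1 (rot K (int j) \<rho>)" by (simp add: rot_rot)
    then show ?case using Suc clock.G_Nil_T[of "rot K (int j) \<rho>" K] by simp
  qed (simp add: rot_0[OF assms])
  have "1 = (\<Sum>\<sigma>\<in>clocks K. joint_law \<mu> K [] \<sigma>)" by (simp add: clock.total)
  also have "\<dots> = (\<Sum>j<period K. joint_law \<mu> K [] (rot K (int j) \<rho>))"
    by (rule sum.reindex_bij_betw[OF orbit_bij[OF assms], symmetric])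
  also have "\<dots> = real (period K) * joint_law \<mu> K [] \<rho>" by (simp add: inv)
  finally show ?thesis using period_pos[of K] by (simp add: field_simps del: period_pos)
qed

lemma joint_law_blocked:
  assumes "u \<in> words n" "\<not> allowed K \<rho> (int n)"
  shows "joint_law \<mu> K (u @ [True]) \<rho> = 0"
proof -
  have "(if window 0 (length (u @ [True])) x = u @ [True] then clock_weight K \<rho> x else 0) = 0" for x
    using assms by (auto simp: clock_weight_def missed_def window_Suc_snoc length_words)
  then show ?thesis unfolding joint_law_def by simp
qed

lemma mass_allowed: "(\<Sum>\<rho>\<in>clocks K \<inter> {\<rho>. allowed K \<rho> j}. joint_law \<mu> K [] \<rho>) = dens K"
proof -
  have "(\<Sum>\<rho>\<in>clocks K \<inter> {\<rho>. allowed K \<rho> j}. joint_law \<mu> K [] \<rho>)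
      = (\<Sum>\<rho>\<in>clocks K \<inter> {\<rho>. allowed K \<rho> j}. 1 / real (period K))"
    by (intro sum.cong refl joint_law_Nil) auto
  also have "\<dots> = real (card {\<rho> \<in> clocks K. allowed K \<rho> j}) / real (period K)"
    by (simp add: Int_def)
  also have "\<dots> = dens K" using period_pos[of K] by (simp add: card_allowed del: period_pos)
  finally show ?thesis .
qed

lemma measure_cylinder: "measure \<mu> (cylinder XF w) = measure \<mu> {x. window 0 (length w) x = w}"
proof (rule finite_measure_eq_AE)
  show "AE x in \<mu>. x \<in> cylinder XF w \<longleftrightarrow> x \<in> {x. window 0 (length w) x = w}"
    using AE_free by eventually_elim (simp add: cylinder_eq_window)
qed (auto simp: cylinder_eq_window sets_mu[symmetric])

text \<open>A clock without hands has one state; with it, the general theory of the pair specializes to the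
  process itself.\<close>

lemma language_sum_eq_block_entropy:
  "- (\<Sum>w\<in>language n XF. measure \<mu> (cylinder XF w) * log 2 (measure \<mu> (cylinder XF w))) = clock.block_entropy 0 n"
proof -
  have mass: "joint_law \<mu> 0 w (\<lambda>_. undefined) = measure \<mu> (cylinder XF w)" for w
    using sum_joint_law[of 0 w] by (simp add: clocks_0 measure_cylinder)
  have "(\<Sum>w\<in>language n XF. measure \<mu> (cylinder XF w) * log 2 (measure \<mu> (cylinder XF w)))
     = (\<Sum>w\<in>words n. measure \<mu> (cylinder XF w) * log 2 (measure \<mu> (cylinder XF w)))"
  proof (rule sum.mono_neutral_left)
    show "language n XF \<subseteq> words n" by (auto simp: language_def words_def)
    have "cylinder XF w = {}" if "w \<in> words n - language n XF" for w
      using that by (auto simp: language_def words_def cylinder_def)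
    then show "\<forall>w\<in>words n - language n XF. measure \<mu> (cylinder XF w) * log 2 (measure \<mu> (cylinder XF w)) = 0"
      by simp
  qed simp
  then show ?thesis unfolding clock.block_entropy_def by (simp add: clocks_0 mass)
qed

lemma entropy_tendsto: "(\<lambda>n. clock.block_entropy 0 n / real n) \<longlonglongrightarrow> measure_entropy XF \<mu>"
proof -
  from clock.entropy_rate[of 0]
  obtain h where "(\<lambda>n. clock.block_entropy 0 n / real n) \<longlonglongrightarrow> h" by blast
  moreover from this have "lim (\<lambda>n. clock.block_entropy 0 n / real n) = h" by (rule limI)
  ultimately show ?thesis
    by (simp add: measure_entropy_def language_sum_eq_block_entropy)
qed

lemma measure_entropy_le_step: "measure_entropy XF \<mu> \<le> clock.entropy_step K n"
proof -
  obtain h where h: "(\<lambda>n. clock.block_entropy K n / real n) \<longlonglongrightarrow> h" "h \<le> clock.entropy_step K n"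
    using clock.entropy_rate[of K] by blast
  have "clock.block_entropy 0 n \<le> clock.block_entropy K n" for n
  proof -
    have "clock.block_entropy 0 n
        = - (\<Sum>w\<in>words n. (\<Sum>\<rho>\<in>clocks K. joint_law \<mu> K w \<rho>) * log 2 (\<Sum>\<rho>\<in>clocks K. joint_law \<mu> K w \<rho>))"
      unfolding sum_joint_law[of K] sum_joint_law[of 0, symmetric] clock.block_entropy_def
      by (simp add: clocks_0)
    also have "\<dots> \<le> clock.block_entropy K n" by (rule clock.entropy_forget_clock_le)
    finally show ?thesis .
  qed
  then have "measure_entropy XF \<mu> \<le> h"
    by (intro LIMSEQ_le[OF entropy_tendsto h(1)]) (auto intro!: divide_right_mono)
  with h(2) show ?thesis by simp
qed

abbreviation "rate_of_ones \<equiv> measure \<mu> {x. window 0 1 x = [True]}"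

lemma sum_joint_True: "(\<Sum>\<rho>\<in>clocks K. joint_law \<mu> K [True] \<rho>) = rate_of_ones"
  using sum_joint_law[of K "[True]"] by simp

text \<open>The clock is uniformly distributed, so a position is free with probability \<^term>\<open>dens K\<close>, and each
  free position contributes at most \<open>log 2 (1 / (1 - s))\<close> to entropy plus energy.\<close>

lemma free_energy_le_dens:
  assumes s: "0 < s" "s < 1"
  shows "measure_entropy XF \<mu> + log 2 (s / (1 - s)) * rate_of_ones \<le> dens K * log 2 (1 / (1 - s))"
proof -
  have "clock.entropy_step K 0 + log 2 (s / (1 - s)) * rate_of_ones
     \<le> dens K * log 2 (1 / (1 - s)) - (\<Sum>r\<in>clocks K \<inter> {\<rho>. allowed K \<rho> 0}. \<Sum>u\<in>words 0. clock.deviation K s u r)"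
    using clock.entropy_step_bound[where K = K and n = 0 and A = "{\<rho>. allowed K \<rho> 0}", OF s]
      joint_law_blocked[of _ 0 K] by (simp add: mass_allowed sum_joint_True)
  moreover have "0 \<le> (\<Sum>r\<in>clocks K \<inter> {\<rho>. allowed K \<rho> 0}. \<Sum>u\<in>words 0. clock.deviation K s u r)"
    by (intro sum_nonneg clock.deviation_nonneg) auto
  ultimately show ?thesis using measure_entropy_le_step[of K 0] by linarith
qed

lemma free_energy_le:
  assumes s: "0 < s" "s < 1"
  shows "measure_entropy XF \<mu> + log 2 (s / (1 - s)) * rate_of_ones \<le> density * log 2 (1 / (1 - s))"
proof (rule LIMSEQ_le_const)
  show "(\<lambda>K. dens K * log 2 (1 / (1 - s))) \<longlonglongrightarrow> density * log 2 (1 / (1 - s))"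
    by (intro tendsto_intros dens_tendsto)
qed (use free_energy_le_dens[OF s] in blast)

definition thinning_error :: "real \<Rightarrow> nat \<Rightarrow> nat \<Rightarrow> real" where
  "thinning_error s K n = (\<Sum>\<rho>\<in>clocks K. \<Sum>u\<in>words n.
     \<bar>joint_law \<mu> K u \<rho> - (\<Prod>j<n. thin s (allowed K \<rho> (int j)) (u ! j)) / real (period K)\<bar>)"

text \<open>Each new symbol adds its deviation from an independent choice given the past and the clock;
  errors made earlier are propagated by a Markov kernel and do not grow.\<close>

lemma thinning_error_Suc:
  assumes s: "0 < s" "s < 1"
  shows "thinning_error s K (Suc n) \<le> thinning_error s K n +
    (\<Sum>\<rho>\<in>clocks K \<inter> {\<rho>. allowed K \<rho> (int n)}. \<Sum>u\<in>words n. 2 * \<bar>joint_law \<mu> K (u @ [True]) \<rho> - s * joint_law \<mu> K u \<rho>\<bar>)"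
proof -
  let ?G = "joint_law \<mu> K" and ?N = "real (period K)"
  let ?\<Gamma> = "\<lambda>n u \<rho>. (\<Prod>j<n. thin s (allowed K \<rho> (int j)) (u ! j)) / ?N"
  have loc: "\<bar>?G (u @ [True]) \<rho> - ?\<Gamma> (Suc n) (u @ [True]) \<rho>\<bar> + \<bar>?G (u @ [False]) \<rho> - ?\<Gamma> (Suc n) (u @ [False]) \<rho>\<bar>
      \<le> \<bar>?G u \<rho> - ?\<Gamma> n u \<rho>\<bar> + (if allowed K \<rho> (int n) then 2 * \<bar>?G (u @ [True]) \<rho> - s * ?G u \<rho>\<bar> else 0)"
    if \<rho>: "\<rho> \<in> clocks K" and u: "u \<in> words n" for \<rho> u
  proof -
    have \<Gamma>: "?\<Gamma> (Suc n) (u @ [v]) \<rho> = ?\<Gamma> n u \<rho> * thin s (allowed K \<rho> (int n)) v" for v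
      by (subst prod_nth_snoc[OF u]) simp
    have sum: "?G (u @ [False]) \<rho> = ?G u \<rho> - ?G (u @ [True]) \<rho>" using clock.snoc[OF \<rho>, of u] by simp
    show ?thesis
    proof (cases "allowed K \<rho> (int n)")
      case True
      \<comment> \<open>In the free case both symbols have the same deviation, up to sign, which gives the factor 2.\<close>
      define g t \<gamma> where "g = ?G u \<rho>" and "t = ?G (u @ [True]) \<rho>" and "\<gamma> = ?\<Gamma> n u \<rho>"
      have "\<bar>t - \<gamma> * s\<bar> \<le> \<bar>t - s * g\<bar> + s * \<bar>g - \<gamma>\<bar>"
      proof -
        have "t - \<gamma> * s = (t - s * g) + s * (g - \<gamma>)" by (simp add: algebra_simps)
        then show ?thesis using abs_triangle_ineq[of "t - s * g" "s * (g - \<gamma>)"] s by (simp add: abs_mult)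
      qed
      moreover have "\<bar>g - t - \<gamma> * (1 - s)\<bar> \<le> \<bar>t - s * g\<bar> + (1 - s) * \<bar>g - \<gamma>\<bar>"
      proof -
        have "g - t - \<gamma> * (1 - s) = - (t - s * g) + (1 - s) * (g - \<gamma>)" by (simp add: algebra_simps)
        then show ?thesis
          using abs_triangle_ineq[of "- (t - s * g)" "(1 - s) * (g - \<gamma>)"] s by (simp add: abs_mult)
      qed
      ultimately have "\<bar>t - \<gamma> * s\<bar> + \<bar>g - t - \<gamma> * (1 - s)\<bar> \<le> \<bar>g - \<gamma>\<bar> + 2 * \<bar>t - s * g\<bar>"
        by (simp add: left_diff_distrib)
      then show ?thesis
        unfolding \<Gamma> sum using True by (simp add: thin_def g_def t_def \<gamma>_def)
    next
      case False
      then show ?thesis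
        unfolding \<Gamma> sum using joint_law_blocked[OF u False] by (simp add: thin_def)
    qed
  qed
  have "thinning_error s K (Suc n) \<le> (\<Sum>\<rho>\<in>clocks K. \<Sum>u\<in>words n. \<bar>?G u \<rho> - ?\<Gamma> n u \<rho>\<bar>
      + (if allowed K \<rho> (int n) then 2 * \<bar>?G (u @ [True]) \<rho> - s * ?G u \<rho>\<bar> else 0))"
    unfolding thinning_error_def sum_words_snoc by (intro sum_mono loc)
  also have "\<dots> = thinning_error s K n + (\<Sum>\<rho>\<in>clocks K. \<Sum>u\<in>words n.
      if allowed K \<rho> (int n) then 2 * \<bar>?G (u @ [True]) \<rho> - s * ?G u \<rho>\<bar> else 0)"
    by (simp add: thinning_error_def sum.distrib)
  also have "(\<Sum>\<rho>\<in>clocks K. \<Sum>u\<in>words n. if allowed K \<rho> (int n) then 2 * \<bar>?G (u @ [True]) \<rho> - s * ?G u \<rho>\<bar> else 0)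
      = (\<Sum>\<rho>\<in>clocks K \<inter> {\<rho>. allowed K \<rho> (int n)}. \<Sum>u\<in>words n. 2 * \<bar>?G (u @ [True]) \<rho> - s * ?G u \<rho>\<bar>)"
    by (rule sum.mono_neutral_cong_right) auto
  finally show ?thesis .
qed

lemma thinning_error_bound:
  assumes s: "0 < s" "s < 1" and \<epsilon>: "0 < \<epsilon>"
    and max: "density * log 2 (1 / (1 - s)) \<le> measure_entropy XF \<mu> + log 2 (s / (1 - s)) * rate_of_ones"
  shows "thinning_error s K n \<le> real n * (\<epsilon> + 4 * ((dens K - density) * log 2 (1 / (1 - s))) / \<epsilon>)"
proof (induction n)
  case 0
  show ?case by (simp add: thinning_error_def joint_law_Nil)
next
  case (Suc n)
  have "(\<Sum>\<rho>\<in>clocks K \<inter> {\<rho>. allowed K \<rho> (int n)}. \<Sum>u\<in>words n. 2 * \<bar>joint_law \<mu> K (u @ [True]) \<rho> - s * joint_law \<mu> K u \<rho>\<bar>)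
     \<le> \<epsilon> + 4 * ((dens K - density) * log 2 (1 / (1 - s))) / \<epsilon>"
  proof (rule clock.deviation_from_thinning[OF s _ _ \<epsilon>])
    show "(\<Sum>\<rho>\<in>clocks K \<inter> {\<rho>. allowed K \<rho> (int n)}. joint_law \<mu> K [] \<rho>) * log 2 (1 / (1 - s))
        - (dens K - density) * log 2 (1 / (1 - s))
        \<le> clock.entropy_step K n + log 2 (s / (1 - s)) * (\<Sum>\<rho>\<in>clocks K. joint_law \<mu> K [True] \<rho>)"
      using max measure_entropy_le_step[of K n]
      by (simp add: mass_allowed sum_joint_True left_diff_distrib)
  qed (simp add: joint_law_blocked)
  with Suc thinning_error_Suc[OF s, of K n] show ?case
    by (simp only: of_nat_Suc distrib_right mult_1)
qed

text \<open>For a maximizer the defect in \<open>entropy_step_bound\<close> is at most a multiple of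
  \<open>dens K - density\<close>. As \<open>K\<close> tends to infinity it vanishes, and with it the distance from the
  thinning of a uniformly distributed clock.\<close>

lemma window_of_maximizer:
  assumes s: "0 < s" "s < 1"
    and max: "density * log 2 (1 / (1 - s)) \<le> measure_entropy XF \<mu> + log 2 (s / (1 - s)) * rate_of_ones"
  shows "measure \<mu> {x. window 0 (length w) x = w} = thinned_window s 0 w"
proof -
  let ?n = "length w" and ?L = "log 2 (1 / (1 - s))"
  have close: "\<bar>measure \<mu> {x. window 0 ?n x = w} - thinned_clock s K 0 w\<bar> \<le> thinning_error s K ?n" for K
  proof -
    let ?f = "\<lambda>u \<rho>. joint_law \<mu> K u \<rho> - (\<Prod>j<?n. thin s (allowed K \<rho> (int j)) (u ! j)) / real (period K)"
    have "measure \<mu> {x. window 0 ?n x = w} - thinned_clock s K 0 w = (\<Sum>\<rho>\<in>clocks K. ?f w \<rho>)"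
      by (simp add: sum_joint_law[of K w, symmetric] thinned_clock_def sum_subtractf sum_divide_distrib)
    then have "\<bar>measure \<mu> {x. window 0 ?n x = w} - thinned_clock s K 0 w\<bar> \<le> (\<Sum>\<rho>\<in>clocks K. \<bar>?f w \<rho>\<bar>)"
      by (simp only: sum_abs)
    also have "\<dots> \<le> (\<Sum>\<rho>\<in>clocks K. \<Sum>u\<in>words ?n. \<bar>?f u \<rho>\<bar>)"
      by (intro sum_mono member_le_sum) (simp_all, simp add: words_def)
    finally show ?thesis by (simp add: thinning_error_def)
  qed
  have "\<bar>measure \<mu> {x. window 0 ?n x = w} - thinned_window s 0 w\<bar> \<le> real ?n * \<epsilon>" if \<epsilon>: "0 < \<epsilon>" for \<epsilon>
  proof (rule LIMSEQ_le)
    show "(\<lambda>K. \<bar>measure \<mu> {x. window 0 ?n x = w} - thinned_clock s K 0 w\<bar>)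
        \<longlonglongrightarrow> \<bar>measure \<mu> {x. window 0 ?n x = w} - thinned_window s 0 w\<bar>"
      using s by (intro tendsto_intros thinned_clock_tendsto) auto
    have "(\<lambda>K. real ?n * (\<epsilon> + 4 * ((dens K - density) * ?L) / \<epsilon>)) \<longlonglongrightarrow> real ?n * (\<epsilon> + 4 * ((density - density) * ?L) / \<epsilon>)"
      using \<epsilon> by (intro tendsto_intros dens_tendsto) auto
    then show "(\<lambda>K. real ?n * (\<epsilon> + 4 * ((dens K - density) * ?L) / \<epsilon>)) \<longlonglongrightarrow> real ?n * \<epsilon>" by simp
    show "\<exists>N. \<forall>K\<ge>N. \<bar>measure \<mu> {x. window 0 ?n x = w} - thinned_clock s K 0 w\<bar>
        \<le> real ?n * (\<epsilon> + 4 * ((dens K - density) * ?L) / \<epsilon>)"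
      using order_trans[OF close thinning_error_bound[OF s \<epsilon> max]] by blast
  qed
  note bound = this
  have "\<bar>measure \<mu> {x. window 0 ?n x = w} - thinned_window s 0 w\<bar> \<le> 0"
  proof (rule field_le_epsilon)
    fix e :: real assume "0 < e"
    then have "real ?n * (e / (real ?n + 1)) \<le> e" by (simp add: field_simps)
    with bound[of "e / (real ?n + 1)"] \<open>0 < e\<close>
    show "\<bar>measure \<mu> {x. window 0 ?n x = w} - thinned_window s 0 w\<bar> \<le> 0 + e" by simp
  qed
  then show ?thesis by simp
qed

lemma maximizer_eq_conv:
  assumes s: "0 < s" "s < 1"
    and max: "density * log 2 (1 / (1 - s)) \<le> measure_entropy XF \<mu> + log 2 (s / (1 - s)) * rate_of_ones"
  shows "\<mu> = conv (1 - s)"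
proof (rule measure_eqI_windows)
  fix i w
  have "measure \<mu> {x. window i (length w) x = w} = thinned_window s 0 w"
    by (rule trans[OF measure_window_eq_0[OF inv] window_of_maximizer[OF assms]])
  also have "\<dots> = measure (conv (1 - s)) {x. window i (length w) x = w}"
    using s measure_conv_window[of "1 - s" i w] thinned_window_shift[of s i w] by simp
  finally show "measure \<mu> {x. window i (length w) x = w} = measure (conv (1 - s)) {x. window i (length w) x = w}" .
qed (simp_all add: prob_space_axioms prob_space_conv sets_mu sets_conv)

end

context coprime_moduli
begin

lemma thinned_window_snoc_True_le:
  assumes s: "0 \<le> s" "s \<le> 1"
  shows "thinned_window s i (u @ [True]) \<le> s * thinned_window s i u"
proof -
  interpret prob_space haar by (rule prob_space_haar)
  let ?P = "\<lambda>\<omega>. \<Prod>j<length u. thin s (code \<omega> (i + int j)) (u ! j)"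
  have "thinned_window s i (u @ [True]) = (\<integral>\<omega>. ?P \<omega> * thin s (code \<omega> (i + int (length u))) True \<partial>haar)"
    unfolding thinned_window_def by (simp add: nth_append)
  also have "\<dots> \<le> (\<integral>\<omega>. ?P \<omega> * s \<partial>haar)"
  proof (rule integral_mono)
    show "integrable haar (\<lambda>\<omega>. ?P \<omega> * thin s (code \<omega> (i + int (length u))) True)"
      using integrable_prod_thin[OF s, where w = "u @ [True]" and n = "length (u @ [True])"] by (simp add: nth_append)
    show "integrable haar (\<lambda>\<omega>. ?P \<omega> * s)"
      using integrable_prod_thin[OF s] by simp
    show "?P \<omega> * thin s (code \<omega> (i + int (length u))) True \<le> ?P \<omega> * s" for \<omega>
      using s prod_thin_bounds[OF s] by (intro mult_left_mono) (auto simp: thin_def)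
  qed
  also have "\<dots> = s * thinned_window s i u" by (simp add: thinned_window_def)
  finally show ?thesis .
qed

text \<open>Under the convolution, the conditional probability of a 1 given any past is at most \<open>s\<close>, so
  that by superadditivity its entropy is at least that of independent choices at the sites that
  the residue pattern leaves free.\<close>

lemma conv_free_energy:
  assumes s: "0 < s" "s < 1"
  shows "density * log 2 (1 / (1 - s))
    = measure_entropy XF (conv (1 - s)) + log 2 (s / (1 - s)) * measure (conv (1 - s)) {x. window 0 1 x = [True]}"
    (is "_ * ?L = _ + ?\<beta> * _")
proof -
  let ?\<mu> = "conv (1 - s)"
  interpret free_measure b ?\<mu>
    by unfold_locales (use s in \<open>auto intro: conv_invariant\<close>)
  have win: "measure ?\<mu> {x. window 0 (length w) x = w} = thinned_window s 0 w" for w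
    using measure_conv_window[of "1 - s" 0 w] s by simp
  have rate: "rate_of_ones = s * density"
    using win[of "[True]"] thinned_window_True[of s] s by simp
  have joint: "joint_law ?\<mu> 0 w (\<lambda>_. undefined) = thinned_window s 0 w" for w
    using sum_joint_law[of 0 w] by (simp add: clocks_0 win)
  have nonneg: "0 \<le> thinned_window s 0 w" for w unfolding win[symmetric] by simp
  have split: "thinned_window s 0 w = thinned_window s 0 (w @ [True]) + thinned_window s 0 (w @ [False])" for w
    using clock.snoc[of _ 0 w] by (simp add: clocks_0 joint)
  have step: "density * (?L - s * ?\<beta>) \<le> clock.entropy_step 0 n" for n
  proof -
    have "split_entropy (thinned_window s 0 (u @ [True])) (thinned_window s 0 (u @ [False]))
        \<ge> thinned_window s 0 (u @ [True]) / s * (?L - s * ?\<beta>)" for u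
    proof -
      \<comment> \<open>The mass on which the next site is free; on the rest of the mass of \<open>u\<close> a 0 is forced.\<close>
      define m where "m = thinned_window s 0 (u @ [True]) / s"
      have t: "thinned_window s 0 (u @ [True]) = s * m" using s by (simp add: m_def)
      have m: "0 \<le> m" using nonneg s by (simp add: m_def)
      have "s * m \<le> s * thinned_window s 0 u"
        unfolding t[symmetric] using s by (intro thinned_window_snoc_True_le) auto
      then have le: "m \<le> thinned_window s 0 u" using s by simp
      have f: "thinned_window s 0 (u @ [False]) = (1 - s) * m + (thinned_window s 0 u - m)"
        using split[of u] t by (simp add: left_diff_distrib)
      have "split_entropy (s * m) ((1 - s) * m) + split_entropy 0 (thinned_window s 0 u - m)
          \<le> split_entropy (s * m + 0) ((1 - s) * m + (thinned_window s 0 u - m))"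
        using s m le by (intro split_entropy_superadditive) auto
      moreover have "split_entropy (s * m) ((1 - s) * m) = m * (?L - s * ?\<beta>)"
        using split_entropy_optimal[OF s m] by (simp add: algebra_simps)
      ultimately show ?thesis unfolding t f using s by simp
    qed
    then have "(\<Sum>u\<in>words n. thinned_window s 0 (u @ [True]) / s * (?L - s * ?\<beta>)) \<le> clock.entropy_step 0 n"
      unfolding clock.entropy_step_def by (simp add: clocks_0 joint sum_mono)
    moreover have "(\<Sum>u\<in>words n. thinned_window s 0 (u @ [True])) = s * density"
      using clock.sum_last_True[of 0 n] rate sum_joint_True[of 0] by (simp add: clocks_0 joint)
    then have "(\<Sum>u\<in>words n. thinned_window s 0 (u @ [True]) / s * (?L - s * ?\<beta>)) = density * (?L - s * ?\<beta>)"
      using s by (simp add: sum_distrib_right[symmetric] sum_divide_distrib[symmetric])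
    ultimately show ?thesis by simp
  qed
  have "density * (?L - s * ?\<beta>) \<le> measure_entropy XF ?\<mu>"
    by (rule clock.entropy_rate_ge[OF step entropy_tendsto])
  then have "density * ?L \<le> measure_entropy XF ?\<mu> + ?\<beta> * rate_of_ones"
    unfolding rate by (simp add: algebra_simps)
  with free_energy_le[OF s] show ?thesis by simp
qed

end

section \<open>Counting ones\<close>

definition ones :: "bool list \<Rightarrow> real" where
  "ones w = (\<Sum>j<length w. if w ! j then 1 else 0)"

lemma prod_ones:
  assumes "0 < z"
  shows "(\<Prod>j<length w. if w ! j then z else 1) = z powr ones w"
proof -
  have "(\<Prod>j<length w. if w ! j then z else 1) = (\<Prod>j<length w. z powr (if w ! j then 1 else 0))"
    using assms by (intro prod.cong) auto
  also have "\<dots> = z powr ones w"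
    using assms by (simp add: ones_def powr_sum)
  finally show ?thesis .
qed

context coprime_moduli
begin

text \<open>The expected number of ones in a window of the residue pattern is \<open>density * n\<close>, and this mean
  is reached with positive probability.\<close>

lemma dense_window:
  obtains W where "W \<in> words n" and "density * real n \<le> ones W"
    and "0 < measure haar {\<omega> \<in> space haar. window 0 n (code \<omega>) = W}"
proof (rule ccontr)
  assume neg: "\<not> thesis"
  interpret prob_space haar by (rule prob_space_haar)
  let ?f = "\<lambda>\<omega>. \<Sum>j<n. if code \<omega> (int j) then 1 else 0 :: real"
  have int1: "integrable haar (\<lambda>\<omega>. if code \<omega> m then 1 else 0 :: real)" for m
    by (rule integrable_const_bound[where B = 1]) (auto intro!: AE_I2)
  have one: "(\<integral>\<omega>. (if code \<omega> (int j) then 1 else 0) \<partial>haar) = density" for j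
  proof -
    have "(\<integral>\<omega>. (if code \<omega> (int j) then 1 else 0) \<partial>haar) = thinned_window 1 (int j) [True]"
      by (simp add: thinned_window_def thin_def)
    also have "\<dots> = density"
      using thinned_window_shift[of 1 "int j" "[True]"] thinned_window_True[of 1] by simp
    finally show ?thesis .
  qed
  have AE: "AE \<omega> in haar. \<forall>W\<in>{W \<in> words n. density * real n \<le> ones W}. window 0 n (code \<omega>) \<noteq> W"
  proof (rule AE_finite_allI)
    fix W assume W: "W \<in> {W \<in> words n. density * real n \<le> ones W}"
    have "measure haar {\<omega> \<in> space haar. window 0 n (code \<omega>) = W} = 0"
      using neg that[of W] W measure_nonneg[of haar "{\<omega> \<in> space haar. window 0 n (code \<omega>) = W}"]
      by (metis (no_types, lifting) less_eq_real_def mem_Collect_eq)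
    then show "AE \<omega> in haar. window 0 n (code \<omega>) \<noteq> W"
      by (intro AE_I[where N = "{\<omega> \<in> space haar. window 0 n (code \<omega>) = W}"]) (auto simp: emeasure_eq_measure)
  qed simp
  then have "AE \<omega> in haar. ?f \<omega> < density * real n"
  proof eventually_elim
    case (elim \<omega>)
    then have "\<not> density * real n \<le> ones (window 0 n (code \<omega>))"
      by (metis (no_types, lifting) mem_Collect_eq window_in_words)
    then show ?case by (simp add: ones_def)
  qed
  then have "(\<integral>\<omega>. ?f \<omega> \<partial>haar) < (\<integral>\<omega>. density * real n \<partial>haar)"
    by (intro integral_less_AE_space) (auto simp: emeasure_space_1 int1)
  moreover have "(\<integral>\<omega>. ?f \<omega> \<partial>haar) = real n * density"
    using int1 by (simp add: Bochner_Integration.integral_sum one)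
  ultimately show False by (simp add: prob_space mult.commute)
qed

lemma count_orbit:
  assumes "\<rho> \<in> clocks K"
  shows "(\<Sum>j<q * period K. if P (rot K (int j) \<rho>) then 1 else 0 :: real) = real q * real (card {\<sigma> \<in> clocks K. P \<sigma>})"
proof -
  have "(\<Sum>\<sigma>\<in>clocks K. if P \<sigma> then 1 else 0 :: real) = real (card {\<sigma> \<in> clocks K. P \<sigma>})"
    by (simp add: sum.inter_filter[symmetric])
  then show ?thesis using sum_orbit[OF assms, of "\<lambda>\<sigma>. if P \<sigma> then 1 else 0" q] by simp
qed

text \<open>Whole periods contain the exact proportion of free positions; an incomplete period costs at most
  the additional term.\<close>

lemma count_allowed_le:
  assumes "\<rho> \<in> clocks K"
  shows "(\<Sum>j<n. if allowed K \<rho> (int j) then 1 else 0 :: real) \<le> dens K * (real n + real (period K))"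
proof -
  define q where "q = n div period K + 1"
  have n: "n \<le> q * period K"
    unfolding q_def distrib_right mult_1
    using div_mult_mod_eq[of n "period K"] mod_less_divisor[OF period_pos[of K], of n] by linarith
  have "(\<Sum>j<n. if allowed K \<rho> (int j) then 1 else 0 :: real) \<le> (\<Sum>j<q * period K. if allowed K \<rho> (int j) then 1 else 0)"
    using n by (intro sum_mono2) auto
  also have "\<dots> = real q * (dens K * real (period K))"
    using count_orbit[OF assms, of "\<lambda>\<sigma>. allowed K \<sigma> 0" q] by (simp add: allowed_rot card_allowed)
  also have "\<dots> = dens K * (real q * real (period K))" by simp
  also have "real q * real (period K) \<le> real n + real (period K)"
  proof -
    have "q * period K \<le> n + period K" by (simp add: q_def)
    then have "real (q * period K) \<le> real (n + period K)" by (rule of_nat_mono)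
    then show ?thesis by simp
  qed
  then have "dens K * (real q * real (period K)) \<le> dens K * (real n + real (period K))"
    using dens_pos[of K] by (intro mult_left_mono) auto
  finally show ?thesis .
qed

section \<open>Pressure\<close>

lemma language_eq: "language n X = {w \<in> words n. \<exists>x\<in>X. window 0 n x = w}"
  by (auto simp: language_def words_def window_eq_iff)

definition partition_sum :: "real \<Rightarrow> nat \<Rightarrow> real" where
  "partition_sum z n = (\<Sum>w\<in>language n XF. z powr ones w)"

text \<open>The words below a pattern with \<open>k\<close> ones form a cube, over which the sum factorizes into \<open>k\<close>
  factors \<open>1 + z\<close>.\<close>

lemma sum_below:
  assumes "0 < z"
  shows "(\<Sum>w\<in>words n. if \<forall>j<n. w ! j \<longrightarrow> a j then z powr ones w else 0)
    = (1 + z) powr (\<Sum>j<n. if a j then 1 else 0)"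
proof -
  have "(\<Sum>w\<in>words n. if \<forall>j<n. w ! j \<longrightarrow> a j then z powr ones w else 0)
      = (\<Sum>w\<in>words n. \<Prod>j<n. if w ! j then (if a j then z else 0) else 1)"
  proof (intro sum.cong refl)
    fix w assume w: "w \<in> words n"
    show "(if \<forall>j<n. w ! j \<longrightarrow> a j then z powr ones w else 0) = (\<Prod>j<n. if w ! j then (if a j then z else 0) else 1)"
    proof (cases "\<forall>j<n. w ! j \<longrightarrow> a j")
      case True
      then have "(\<Prod>j<n. if w ! j then (if a j then z else 0) else 1) = (\<Prod>j<length w. if w ! j then z else 1)"
        using w by (intro prod.cong) (auto simp: words_def)
      then show ?thesis using True prod_ones[OF assms, of w] by simp
    next
      case False
      then have "(\<Prod>j<n. if w ! j then (if a j then z else 0) else 1) = 0"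
        by (intro prod_zero) auto
      then show ?thesis by (subst if_not_P[OF False]) (rule sym)
    qed
  qed
  also have "\<dots> = (\<Prod>j<n. (if a j then z else 0) + 1)"
    using sum_words_prod[of "\<lambda>j v. if v then (if a j then z else 0) else 1" n] by simp
  also have "\<dots> = (\<Prod>j<n. (1 + z) powr (if a j then 1 else 0))"
    using assms by (intro prod.cong) auto
  also have "\<dots> = (1 + z) powr (\<Sum>j<n. if a j then 1 else 0)"
    using assms by (simp add: powr_sum)
  finally show ?thesis .
qed

text \<open>Each word lies below the pattern of free positions of one of the finitely many clock states.\<close>

lemma partition_sum_upper:
  assumes z: "0 < z"
  shows "partition_sum z n \<le> real (period K) * (1 + z) powr (dens K * (real n + real (period K)))"
proof -
  let ?g = "\<lambda>\<rho> w. if \<forall>j<n. w ! j \<longrightarrow> allowed K \<rho> (int j) then z powr ones w else 0"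
  have "partition_sum z n \<le> (\<Sum>w\<in>language n XF. \<Sum>\<rho>\<in>clocks K. ?g \<rho> w)"
    unfolding partition_sum_def
  proof (intro sum_mono)
    fix w assume "w \<in> language n XF"
    then obtain x where x: "x \<in> XF" "window 0 n x = w" by (auto simp: language_eq)
    obtain \<rho> where \<rho>: "\<rho> \<in> missed K x" using missed_nonempty[OF x(1)] by blast
    then have "z powr ones w = ?g \<rho> w" using x(2) by (auto simp: missed_def)
    also have "\<dots> \<le> (\<Sum>\<rho>\<in>clocks K. ?g \<rho> w)"
      using \<rho> missed_subset by (intro member_le_sum) auto
    finally show "z powr ones w \<le> (\<Sum>\<rho>\<in>clocks K. ?g \<rho> w)" .
  qed
  also have "\<dots> \<le> (\<Sum>w\<in>words n. \<Sum>\<rho>\<in>clocks K. ?g \<rho> w)"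
    by (intro sum_mono2 sum_nonneg) (auto simp: language_eq)
  also have "\<dots> = (\<Sum>\<rho>\<in>clocks K. \<Sum>w\<in>words n. ?g \<rho> w)" by (rule sum.swap)
  also have "\<dots> \<le> (\<Sum>\<rho>\<in>clocks K. (1 + z) powr (dens K * (real n + real (period K))))"
    using z by (intro sum_mono) (simp add: sum_below count_allowed_le powr_mono)
  also have "\<dots> = real (period K) * (1 + z) powr (dens K * (real n + real (period K)))"
    by (simp add: card_clocks)
  finally show ?thesis .
qed

text \<open>All words below a dense window belong to the language by heredity.\<close>

lemma partition_sum_lower:
  assumes z: "0 < z"
  shows "(1 + z) powr (density * real n) \<le> partition_sum z n"
proof -
  obtain W where W: "W \<in> words n" "density * real n \<le> ones W"
    "0 < measure haar {\<omega> \<in> space haar. window 0 n (code \<omega>) = W}"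
    by (rule dense_window)
  then have "{\<omega> \<in> space haar. window 0 n (code \<omega>) = W} \<noteq> {}" by (metis measure_empty less_irrefl)
  then obtain \<omega> where \<omega>: "window 0 n (code \<omega>) = W" by blast
  have "(1 + z) powr (density * real n) \<le> (1 + z) powr ones W"
    using W z by (intro powr_mono) auto
  also have "\<dots> = (\<Sum>w\<in>words n. if \<forall>j<n. w ! j \<longrightarrow> W ! j then z powr ones w else 0)"
    using sum_below[OF z, of n "\<lambda>j. W ! j"] W by (simp add: ones_def words_def)
  also have "\<dots> = (\<Sum>w\<in>language n XF. if \<forall>j<n. w ! j \<longrightarrow> W ! j then z powr ones w else 0)"
  proof (rule sum.mono_neutral_right)
    show "\<forall>w\<in>words n - language n XF. (if \<forall>j<n. w ! j \<longrightarrow> W ! j then z powr ones w else 0) = 0"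
    proof
      fix w assume w: "w \<in> words n - language n XF"
      have "\<not> (\<forall>j<n. w ! j \<longrightarrow> W ! j)"
      proof
        assume below: "\<forall>j<n. w ! j \<longrightarrow> W ! j"
        define y where "y m = (0 \<le> m \<and> m < int n \<and> w ! nat m)" for m
        have "code \<omega> m" if "y m" for m
        proof -
          have m: "0 \<le> m" "nat m < n" "w ! nat m" using that by (auto simp: y_def)
          then have "W ! nat m" using below by blast
          then show ?thesis using m \<omega>[symmetric] by simp
        qed
        then have "y \<in> XF" by (rule free_subshift_hereditary[OF residue_coding_in_free_subshift])
        moreover have "window 0 n y = w" using w by (auto simp: window_eq_iff y_def words_def)
        ultimately show False using w by (auto simp: language_eq)
      qed
      then show "(if \<forall>j<n. w ! j \<longrightarrow> W ! j then z powr ones w else 0) = 0" by (rule if_not_P)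
    qed
  qed (auto simp: language_eq)
  also have "\<dots> \<le> partition_sum z n"
    unfolding partition_sum_def by (intro sum_mono) auto
  finally show ?thesis .
qed

lemma partition_sum_pos: "0 < z \<Longrightarrow> 0 < partition_sum z n"
  using partition_sum_lower[of z n] by (metis less_le_trans powr_gt_zero add_pos_pos less_irrefl zero_less_one)

lemma partition_sum_rate:
  assumes z: "0 < z"
  shows "(\<lambda>n. log 2 (partition_sum z n) / real n) \<longlonglongrightarrow> density * log 2 (1 + z)"
proof (rule LIMSEQ_I)
  fix r :: real assume r: "0 < r"
  let ?L = "log 2 (1 + z)"
  have L: "0 < ?L" using z by simp
  have "(\<lambda>K. dens K * ?L) \<longlonglongrightarrow> density * ?L" by (intro tendsto_intros dens_tendsto)
  then have "eventually (\<lambda>K. dens K * ?L < density * ?L + r / 2) sequentially"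
    using r by (intro order_tendstoD) auto
  then obtain K where K: "dens K * ?L < density * ?L + r / 2" by (auto simp: eventually_sequentially)
  define C where "C = log 2 (real (period K)) + dens K * real (period K) * ?L"
  have "(\<lambda>n. C / real n) \<longlonglongrightarrow> 0" by (rule lim_const_over_n)
  then have "eventually (\<lambda>n. C / real n < r / 2) sequentially"
    using r by (intro order_tendstoD) auto
  then obtain N where N: "\<And>n. N \<le> n \<Longrightarrow> C / real n < r / 2" by (auto simp: eventually_sequentially)
  show "\<exists>no. \<forall>n\<ge>no. norm (log 2 (partition_sum z n) / real n - density * ?L) < r"
  proof (intro exI allI impI)
    fix n assume n: "max N 1 \<le> n"
    then have n0: "0 < real n" by simp
    have "density * real n * ?L = log 2 ((1 + z) powr (density * real n))"
      using z by (simp add: log_powr)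
    also have "\<dots> \<le> log 2 (partition_sum z n)"
      using z partition_sum_lower[OF z, of n] partition_sum_pos[OF z, of n] by (subst log_le_cancel_iff) auto
    finally have lower: "density * ?L \<le> log 2 (partition_sum z n) / real n"
      using n0 by (simp add: field_simps)
    have "log 2 (partition_sum z n) \<le> log 2 (real (period K) * (1 + z) powr (dens K * (real n + real (period K))))"
      using z partition_sum_upper[OF z, of n K] partition_sum_pos[OF z, of n] by (subst log_le_cancel_iff) auto
    also have "\<dots> = C + real n * (dens K * ?L)"
      using z by (simp add: log_mult_pos log_powr C_def algebra_simps)
    finally have "log 2 (partition_sum z n) / real n \<le> C / real n + dens K * ?L"
      using n0 by (simp add: field_simps)
    moreover have "C / real n < r / 2" by (rule N) (use n in simp)
    ultimately have "log 2 (partition_sum z n) / real n < density * ?L + r"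
      using K by linarith
    with lower show "norm (log 2 (partition_sum z n) / real n - density * ?L) < r" by simp
  qed
qed

text \<open>A bounded error in the Birkhoff sums changes the logarithm of the partition sum by a constant,
  which disappears on division by \<open>n\<close>.\<close>

lemma pressure_counting:
  fixes \<phi> :: "config \<Rightarrow> real"
  assumes count: "\<And>n x. x \<in> XF \<Longrightarrow> \<bar>birkhoff_sum n \<phi> x - (real n * a + \<beta> * ones (window 0 n x))\<bar> \<le> C"
  shows "pressure XF \<phi> = a + density * log 2 (1 + 2 powr \<beta>)"
proof -
  define z where "z = 2 powr \<beta>"
  have z: "0 < z" by (simp add: z_def)
  define Z where "Z n = (\<Sum>w\<in>language n XF. 2 powr (SUP x\<in>cylinder XF w. birkhoff_sum n \<phi> x))" for n
  have sup: "real n * a + \<beta> * ones w - C \<le> (SUP x\<in>cylinder XF w. birkhoff_sum n \<phi> x)"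
    "(SUP x\<in>cylinder XF w. birkhoff_sum n \<phi> x) \<le> real n * a + \<beta> * ones w + C"
    if w: "w \<in> language n XF" for n w
  proof -
    have len: "length w = n" using w by (simp add: language_eq words_def)
    obtain y where y: "y \<in> cylinder XF w" using w len by (auto simp: language_eq cylinder_eq_window)
    have bd: "birkhoff_sum n \<phi> x \<le> real n * a + \<beta> * ones w + C \<and> real n * a + \<beta> * ones w - C \<le> birkhoff_sum n \<phi> x"
      if "x \<in> cylinder XF w" for x
      using that count[of x n] len by (auto simp: cylinder_eq_window abs_le_iff)
    show "(SUP x\<in>cylinder XF w. birkhoff_sum n \<phi> x) \<le> real n * a + \<beta> * ones w + C"
      using y bd by (intro cSUP_least) auto
    have "birkhoff_sum n \<phi> y \<le> (SUP x\<in>cylinder XF w. birkhoff_sum n \<phi> x)"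
      using bd by (intro cSUP_upper y bdd_aboveI2) auto
    then show "real n * a + \<beta> * ones w - C \<le> (SUP x\<in>cylinder XF w. birkhoff_sum n \<phi> x)"
      using bd[OF y] by linarith
  qed
  have zpow: "2 powr (c + \<beta> * t) = 2 powr c * z powr t" for c t
    by (simp add: z_def powr_add powr_powr)
  have lower: "2 powr (real n * a - C) * partition_sum z n \<le> Z n" for n
  proof -
    have "2 powr (real n * a - C) * z powr ones w \<le> 2 powr (SUP x\<in>cylinder XF w. birkhoff_sum n \<phi> x)"
      if "w \<in> language n XF" for w
      unfolding zpow[symmetric] using sup(1)[OF that] by (intro powr_mono) auto
    then show ?thesis unfolding partition_sum_def Z_def sum_distrib_left by (intro sum_mono)
  qed
  have upper: "Z n \<le> 2 powr (real n * a + C) * partition_sum z n" for n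
  proof -
    have "2 powr (SUP x\<in>cylinder XF w. birkhoff_sum n \<phi> x) \<le> 2 powr (real n * a + C) * z powr ones w"
      if "w \<in> language n XF" for w
      unfolding zpow[symmetric] using sup(2)[OF that] by (intro powr_mono) auto
    then show ?thesis unfolding partition_sum_def Z_def sum_distrib_left by (intro sum_mono)
  qed
  have logs: "real n * a - C + log 2 (partition_sum z n) \<le> log 2 (Z n)"
      "log 2 (Z n) \<le> real n * a + C + log 2 (partition_sum z n)" for n
  proof -
    have pos: "0 < partition_sum z n" by (rule partition_sum_pos[OF z])
    then have Zpos: "0 < Z n" using lower[of n] by (metis less_le_trans mult_pos_pos powr_gt_zero zero_neq_numeral)
    have eq: "log 2 (2 powr c * partition_sum z n) = c + log 2 (partition_sum z n)" for c
      using pos by (simp add: log_mult_pos)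
    show "real n * a - C + log 2 (partition_sum z n) \<le> log 2 (Z n)"
      unfolding eq[symmetric] using lower[of n] pos Zpos by (subst log_le_cancel_iff) auto
    show "log 2 (Z n) \<le> real n * a + C + log 2 (partition_sum z n)"
      unfolding eq[symmetric] using upper[of n] pos Zpos by (subst log_le_cancel_iff) auto
  qed
  have "(\<lambda>n. 1 / real n * log 2 (Z n)) \<longlonglongrightarrow> a + density * log 2 (1 + z)"
  proof (rule tendsto_sandwich)
    show "eventually (\<lambda>n. a - C / real n + log 2 (partition_sum z n) / real n \<le> 1 / real n * log 2 (Z n)) sequentially"
      using eventually_gt_at_top[of 0]
    proof eventually_elim
      case (elim n)
      then show ?case
        using divide_right_mono[OF logs(1)[of n], of "real n"] by (simp add: add_divide_distrib diff_divide_distrib)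
    qed
    show "eventually (\<lambda>n. 1 / real n * log 2 (Z n) \<le> a + C / real n + log 2 (partition_sum z n) / real n) sequentially"
      using eventually_gt_at_top[of 0]
    proof eventually_elim
      case (elim n)
      then show ?case
        using divide_right_mono[OF logs(2)[of n], of "real n"] by (simp add: add_divide_distrib)
    qed
    have "(\<lambda>n. a - C / real n + log 2 (partition_sum z n) / real n) \<longlonglongrightarrow> a - 0 + density * log 2 (1 + z)"
      by (intro tendsto_intros lim_const_over_n partition_sum_rate z)
    then show "(\<lambda>n. a - C / real n + log 2 (partition_sum z n) / real n) \<longlonglongrightarrow> a + density * log 2 (1 + z)" by simp
    have "(\<lambda>n. a + C / real n + log 2 (partition_sum z n) / real n) \<longlonglongrightarrow> a + 0 + density * log 2 (1 + z)"
      by (intro tendsto_intros lim_const_over_n partition_sum_rate z)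
    then show "(\<lambda>n. a + C / real n + log 2 (partition_sum z n) / real n) \<longlonglongrightarrow> a + density * log 2 (1 + z)" by simp
  qed
  then show ?thesis unfolding pressure_def Z_def[symmetric] z_def[symmetric] by (rule limI)
qed

section \<open>Failure of the Gibbs property\<close>

lemma thinned_window_pos:
  assumes s: "0 < s" "s < 1" and W: "W \<in> words n"
    and pos: "0 < measure haar {\<omega> \<in> space haar. window 0 n (code \<omega>) = W}"
  shows "0 < thinned_window s 0 W"
proof -
  interpret prob_space haar by (rule prob_space_haar)
  have len: "length W = n" using W by (simp add: words_def)
  let ?E = "{\<omega> \<in> space haar. window 0 n (code \<omega>) = W}"
  have E: "?E \<in> sets haar" by measurable
  have "0 < s ^ n * measure haar ?E" using s pos by simp
  also have "\<dots> = (\<integral>\<omega>. s ^ n * indicator ?E \<omega> \<partial>haar)" using E by simp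
  also have "\<dots> \<le> (\<integral>\<omega>. (\<Prod>j<n. thin s (code \<omega> (0 + int j)) (W ! j)) \<partial>haar)"
  proof (rule integral_mono)
    show "integrable haar (\<lambda>\<omega>. s ^ n * indicator ?E \<omega>)"
      using E by (simp add: integrable_real_indicator emeasure_eq_measure)
    show "integrable haar (\<lambda>\<omega>. \<Prod>j<n. thin s (code \<omega> (0 + int j)) (W ! j))"
      using s by (intro integrable_prod_thin) auto
    show "s ^ n * indicator ?E \<omega> \<le> (\<Prod>j<n. thin s (code \<omega> (0 + int j)) (W ! j))" for \<omega>
    proof (cases "\<omega> \<in> ?E")
      case True
      then have eq: "W ! j = code \<omega> (int j)" if "j < n" for j using that by auto
      have "s ^ n = (\<Prod>j<n. s)" by simp
      also have "\<dots> \<le> (\<Prod>j<n. thin s (code \<omega> (0 + int j)) (W ! j))"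
        using s by (intro prod_mono) (auto simp: eq thin_def)
      finally show ?thesis using True by simp
    next
      case False
      then show ?thesis using prod_thin_bounds(1)[of s] s by simp
    qed
  qed
  finally show ?thesis by (simp add: thinned_window_def len)
qed

lemma thinned_window_le:
  assumes s: "0 < s" "s < 1" and W: "W \<in> words n" and \<rho>: "\<rho> \<in> clocks K"
    and det: "\<And>\<omega>. \<omega> \<in> space haar \<Longrightarrow> (\<And>j. j < n \<Longrightarrow> W ! j \<Longrightarrow> code \<omega> (int j)) \<Longrightarrow> restrict \<omega> {..<K} = \<rho>"
  shows "thinned_window s 0 W \<le> s powr ones W / real (period K)"
proof -
  interpret prob_space haar by (rule prob_space_haar)
  have len: "length W = n" using W by (simp add: words_def)
  let ?E = "{\<omega> \<in> space haar. restrict \<omega> {..<K} = \<rho>}"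
  have E: "?E \<in> sets haar" by measurable
  have "thinned_window s 0 W \<le> (\<integral>\<omega>. s powr ones W * indicator ?E \<omega> \<partial>haar)"
    unfolding thinned_window_def len
  proof (rule integral_mono)
    show "integrable haar (\<lambda>\<omega>. s powr ones W * indicator ?E \<omega>)"
      using E by (simp add: integrable_real_indicator emeasure_eq_measure)
    show "integrable haar (\<lambda>\<omega>. \<Prod>j<n. thin s (code \<omega> (0 + int j)) (W ! j))"
      using s by (intro integrable_prod_thin) auto
    show "(\<Prod>j<n. thin s (code \<omega> (0 + int j)) (W ! j)) \<le> s powr ones W * indicator ?E \<omega>"
      if \<omega>: "\<omega> \<in> space haar" for \<omega>
    proof (cases "\<forall>j<n. W ! j \<longrightarrow> code \<omega> (int j)")
      case True
      then have "\<omega> \<in> ?E" using det \<omega> by blast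
      moreover have "(\<Prod>j<n. thin s (code \<omega> (0 + int j)) (W ! j)) \<le> (\<Prod>j<length W. if W ! j then s else 1)"
        unfolding len using s by (intro prod_mono) (auto simp: thin_def)
      ultimately show ?thesis using prod_ones[of s W] s by simp
    next
      case False
      then obtain j where "j < n" "W ! j" "\<not> code \<omega> (int j)" by blast
      then have eq: "(\<Prod>j<n. thin s (code \<omega> (0 + int j)) (W ! j)) = 0"
        by (intro prod_zero) (auto simp: thin_def intro!: bexI[of _ j])
      show ?thesis unfolding eq by simp
    qed
  qed
  also have "\<dots> = s powr ones W * measure haar ?E" using E by simp
  finally show ?thesis by (simp add: haar_clock[OF \<rho>])
qed

text \<open>If two residue patterns with different residues modulo \<open>b k\<close> both lie above \<open>W\<close>, then \<open>W\<close>
  misses two classes modulo \<open>b k\<close>. This costs the factor \<open>(b k - 2) / (b k - 1)\<close> in density, too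
  much for a window with the average number of ones once \<open>dens K'\<close> is close to \<open>density\<close>.\<close>

lemma dense_window_determines_clock:
  assumes k: "k < K'" and small: "dens K' * (real (b k) - 2) / (real (b k) - 1) < density"
    and W: "W \<in> words (period K')" "density * real (period K') \<le> ones W"
    and \<omega>: "\<omega> \<in> space haar" "\<And>j. j < period K' \<Longrightarrow> W ! j \<Longrightarrow> code \<omega> (int j)"
    and \<omega>': "\<omega>' \<in> space haar" "\<And>j. j < period K' \<Longrightarrow> W ! j \<Longrightarrow> code \<omega>' (int j)"
  shows "\<omega>' k = \<omega> k"
proof (rule ccontr)
  assume neq: "\<omega>' k \<noteq> \<omega> k"
  let ?n = "period K'"
  define e where "e = (\<omega> k - \<omega>' k) mod int (b k)"
  have range: "0 \<le> \<omega> k" "\<omega> k < int (b k)" "0 \<le> \<omega>' k" "\<omega>' k < int (b k)"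
    using \<omega>(1) \<omega>'(1) by (auto simp: space_haar PiE_iff)
  have "e \<noteq> 0"
  proof
    assume "e = 0"
    then have "\<omega> k mod int (b k) = \<omega>' k mod int (b k)" by (simp add: e_def mod_eq_dvd_iff dvd_eq_mod_eq_0)
    then show False using neq range by simp
  qed
  moreover have "0 \<le> e" "e < int (b k)" by (simp_all add: e_def)
  ultimately have e: "e \<in> {1..<int (b k)}" by auto
  define \<rho> where "\<rho> = restrict \<omega> {..<K'}"
  have \<rho>: "\<rho> \<in> clocks K'" unfolding \<rho>_def by (rule restrict_in_clocks[OF \<omega>(1)])
  let ?P = "\<lambda>\<sigma>. allowed K' \<sigma> 0 \<and> \<sigma> k \<noteq> e"
  have P: "?P (rot K' (int j) \<rho>)" if j: "j < ?n" "W ! j" for j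
  proof
    show "allowed K' (rot K' (int j) \<rho>) 0"
      using \<omega>(2)[OF j] by (simp add: allowed_rot \<rho>_def allowed_restrict) (simp add: allowed_def residue_coding_def)
    show "rot K' (int j) \<rho> k \<noteq> e"
    proof
      assume "rot K' (int j) \<rho> k = e"
      then have "(\<omega> k + int j) mod int (b k) = (\<omega> k - \<omega>' k) mod int (b k)"
        using k by (simp add: rot_def \<rho>_def e_def)
      then have "int (b k) dvd (\<omega> k + int j) - (\<omega> k - \<omega>' k)" by (simp add: mod_eq_dvd_iff)
      then have "(\<omega>' k + int j) mod int (b k) = 0" by (simp add: dvd_eq_mod_eq_0 add.commute)
      then show False using \<omega>'(2)[OF j] by (auto simp: residue_coding_def)
    qed
  qed
  have "ones W = (\<Sum>j<?n. if W ! j then 1 else 0)" using W(1) by (simp add: ones_def words_def)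
  also have "\<dots> \<le> (\<Sum>j<1 * ?n. if ?P (rot K' (int j) \<rho>) then 1 else 0)"
    unfolding mult_1 by (intro sum_mono) (use P in auto)
  also have "\<dots> = dens K' * real ?n * (real (b k) - 2) / (real (b k) - 1)"
    using count_orbit[OF \<rho>, of ?P 1] card_twice_allowed[OF k e] by simp
  also have "\<dots> = (dens K' * (real (b k) - 2) / (real (b k) - 1)) * real ?n" by simp
  also have "\<dots> < density * real ?n"
    using small period_pos[of K'] by (intro mult_strict_right_mono) auto
  finally show False using W(2) by simp
qed

lemma eventually_twice_allowed_sparse:
  "eventually (\<lambda>K. dens K * (real (b k) - 2) / (real (b k) - 1) < density) sequentially"
proof (rule order_tendstoD)
  show "(\<lambda>K. dens K * (real (b k) - 2) / (real (b k) - 1)) \<longlonglongrightarrow> density * (real (b k) - 2) / (real (b k) - 1)"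
    using ge2[of k] by (intro tendsto_intros dens_tendsto) auto
  have "density * (real (b k) - 2) < density * (real (b k) - 1)"
    using density_pos by (intro mult_strict_left_mono) auto
  then show "density * (real (b k) - 2) / (real (b k) - 1) < density"
    using ge2[of k] by (simp add: divide_less_eq)
qed

text \<open>A word is attained only through residue patterns above it. For a dense word of suitable length
  these have prescribed residues modulo the first \<open>K\<close> moduli, which has probability
  \<open>1 / period K\<close>.\<close>

lemma rare_dense_window:
  assumes s: "0 < s" "s < 1"
  obtains n W where "W \<in> language n XF" "density * real n \<le> ones W"
    "0 < thinned_window s 0 W" "thinned_window s 0 W \<le> s powr ones W / real (period K)"
proof -
  have "eventually (\<lambda>K'. \<forall>k\<in>{..<K}. dens K' * (real (b k) - 2) / (real (b k) - 1) < density) sequentially"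
    by (intro eventually_ball_finite ballI eventually_twice_allowed_sparse) simp
  then have "eventually (\<lambda>K'. (\<forall>k\<in>{..<K}. dens K' * (real (b k) - 2) / (real (b k) - 1) < density) \<and> K \<le> K') sequentially"
    using eventually_ge_at_top[of K] by (rule eventually_conj)
  then obtain K' where K': "K \<le> K'"
    "\<And>k. k < K \<Longrightarrow> dens K' * (real (b k) - 2) / (real (b k) - 1) < density"
    by (auto simp: eventually_sequentially)
  define n where "n = period K'"
  obtain W where W: "W \<in> words n" "density * real n \<le> ones W"
    "0 < measure haar {\<omega> \<in> space haar. window 0 n (code \<omega>) = W}"
    by (rule dense_window)
  then have "{\<omega> \<in> space haar. window 0 n (code \<omega>) = W} \<noteq> {}" by (metis measure_empty less_irrefl)
  then obtain \<omega> where \<omega>: "\<omega> \<in> space haar" "window 0 n (code \<omega>) = W" by blast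
  show ?thesis
  proof (rule that)
    show "W \<in> language n XF"
      using W(1) \<omega>(2) residue_coding_in_free_subshift by (auto simp: language_eq)
    show "density * real n \<le> ones W" by (rule W(2))
    show "0 < thinned_window s 0 W" by (rule thinned_window_pos[OF s W(1,3)])
    show "thinned_window s 0 W \<le> s powr ones W / real (period K)"
    proof (rule thinned_window_le[OF s W(1) restrict_in_clocks[OF \<omega>(1)]])
      fix \<omega>' assume \<omega>': "\<omega>' \<in> space haar" "\<And>j. j < n \<Longrightarrow> W ! j \<Longrightarrow> code \<omega>' (int j)"
      have code: "code \<omega> (int j)" if "j < n" "W ! j" for j using that \<omega>(2) by auto
      have "\<omega>' k = \<omega> k" if "k < K" for k
        using that K' W \<omega>(1) code \<omega>' unfolding n_def
        by (intro dense_window_determines_clock[of k K' W \<omega> \<omega>']) auto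
      then show "restrict \<omega>' {..<K} = restrict \<omega> {..<K}" by (auto simp: restrict_def)
    qed
  qed
qed

lemma period_ge: "2 ^ K \<le> period K"
  unfolding period_def using prod_mono[of "{..<K}" "\<lambda>_. 2" b] ge2 by simp

text \<open>The Gibbs weight of a word \<open>W\<close> of length \<open>n\<close> is, up to a bounded factor,
  \<open>2 powr (\<beta> * ones W) * (1 - s) powr (density * n)\<close>, which for a dense word is at least
  \<open>s powr ones W\<close>. The measure of a rare dense word is smaller by the factor \<open>period K\<close>.\<close>

lemma conv_not_gibbs:
  fixes \<phi> :: "config \<Rightarrow> real"
  assumes s: "0 < s" "s < 1"
    and count: "\<And>n x. x \<in> XF \<Longrightarrow> \<bar>birkhoff_sum n \<phi> x - (real n * a + log 2 (s / (1 - s)) * ones (window 0 n x))\<bar> \<le> C"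
  shows "\<not> gibbs_measure XF \<phi> (conv (1 - s))"
proof
  let ?\<mu> = "conv (1 - s)" and ?\<beta> = "log 2 (s / (1 - s))" and ?L = "log 2 (1 / (1 - s))"
  assume "gibbs_measure XF \<phi> ?\<mu>"
  then obtain c where c: "0 < c"
    and gibbs: "\<And>n w x. w \<in> language n XF \<Longrightarrow> 0 < measure ?\<mu> (cylinder XF w) \<Longrightarrow> x \<in> cylinder XF w \<Longrightarrow>
      inverse c \<le> measure ?\<mu> (cylinder XF w) / 2 powr (birkhoff_sum n \<phi> x - real n * pressure XF \<phi>)"
    unfolding gibbs_measure_def by blast
  interpret free_measure b ?\<mu>
    by unfold_locales (use s in \<open>auto intro: conv_invariant\<close>)
  have b2: "2 powr ?\<beta> = s / (1 - s)" using s by simp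
  then have "1 + 2 powr ?\<beta> = 1 / (1 - s)" using s by (simp add: field_simps)
  then have P: "pressure XF \<phi> = a + density * ?L" using pressure_counting[OF count] by simp
  obtain K :: nat where K: "c * 2 powr C < 2 ^ K" using real_arch_pow[of 2 "c * 2 powr C"] by auto
  obtain n W where W: "W \<in> language n XF" "density * real n \<le> ones W"
    "0 < thinned_window s 0 W" "thinned_window s 0 W \<le> s powr ones W / real (period K)"
    by (rule rare_dense_window[OF s])
  have len: "length W = n" using W(1) by (simp add: language_eq words_def)
  obtain x where x: "x \<in> XF" "window 0 n x = W" using W(1) by (auto simp: language_eq)
  have cyl: "x \<in> cylinder XF W" using x len by (simp add: cylinder_eq_window)
  have mu: "measure ?\<mu> (cylinder XF W) = thinned_window s 0 W"
    using measure_conv_window[of "1 - s" 0 W] s by (simp add: measure_cylinder)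
  define E where "E = birkhoff_sum n \<phi> x - real n * pressure XF \<phi>"
  have E: "?\<beta> * ones W - C - density * real n * ?L \<le> E"
    using count[OF x(1), of n] unfolding E_def P x(2) by (simp add: abs_le_iff algebra_simps)
  have "inverse c \<le> thinned_window s 0 W / 2 powr E"
    using gibbs[OF W(1) _ cyl] W(3) unfolding mu E_def by simp
  also have "\<dots> \<le> (s powr ones W / real (period K)) / 2 powr E"
    using W(4) by (intro divide_right_mono) auto
  also have "s powr ones W = 2 powr (?\<beta> * ones W - ?L * ones W)"
  proof -
    have "?\<beta> - ?L = log 2 s" using s by (simp add: log_divide_pos)
    then have "2 powr (?\<beta> * ones W - ?L * ones W) = 2 powr (log 2 s * ones W)"
      by (simp add: left_diff_distrib[symmetric])
    also have "\<dots> = s powr ones W" using s by (simp add: powr_powr[symmetric])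
    finally show ?thesis by simp
  qed
  also have "(2 powr (?\<beta> * ones W - ?L * ones W) / real (period K)) / 2 powr E
      = 2 powr (?\<beta> * ones W - ?L * ones W - E) / real (period K)"
    by (simp add: powr_diff)
  also have "\<dots> \<le> 2 powr C / real (period K)"
  proof -
    have "0 \<le> ?L" using s by simp
    then have "?L * (density * real n) \<le> ?L * ones W" using W(2) by (intro mult_left_mono)
    then have "?\<beta> * ones W - ?L * ones W - E \<le> C" using E by (simp add: mult.commute mult.left_commute)
    then show ?thesis by (intro divide_right_mono powr_mono) auto
  qed
  also have "\<dots> \<le> 2 powr C / 2 ^ K"
  proof -
    have "real (2 ^ K) \<le> real (period K)" by (intro of_nat_mono period_ge)
    then show ?thesis by (intro divide_left_mono) (auto simp: period_pos)
  qed
  also have "\<dots> < inverse c" using K c by (simp add: field_simps)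
  finally show False by simp
qed

section \<open>Equilibrium states\<close>

lemma equilibrium_iff_conv:
  fixes \<phi> :: "config \<Rightarrow> real"
  assumes s: "0 < s" "s < 1"
    and count: "\<And>n x. x \<in> XF \<Longrightarrow> \<bar>birkhoff_sum n \<phi> x - (real n * a + log 2 (s / (1 - s)) * ones (window 0 n x))\<bar> \<le> C"
    and integral: "\<And>\<mu>. \<mu> \<in> invariant_measures XF \<Longrightarrow>
      (\<integral>x. \<phi> x \<partial>\<mu>) = a + log 2 (s / (1 - s)) * measure \<mu> {x. window 0 1 x = [True]}"
  shows "equilibrium_state XF \<phi> \<mu> \<longleftrightarrow> \<mu> = conv (1 - s)"
proof -
  let ?L = "log 2 (1 / (1 - s))"
  have "1 + 2 powr log 2 (s / (1 - s)) = 1 / (1 - s)" using s by (simp add: field_simps)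
  then have P: "pressure XF \<phi> = a + density * ?L" using pressure_counting[OF count] by simp
  show ?thesis
  proof
    assume eq: "equilibrium_state XF \<phi> \<mu>"
    then have inv: "\<mu> \<in> invariant_measures XF" by (simp add: equilibrium_state_def)
    interpret free_measure b \<mu> by unfold_locales (rule inv)
    show "\<mu> = conv (1 - s)"
      using eq unfolding equilibrium_state_def P integral[OF inv] by (intro maximizer_eq_conv s) simp
  next
    assume \<mu>: "\<mu> = conv (1 - s)"
    have inv: "conv (1 - s) \<in> invariant_measures XF" using s by (intro conv_invariant) auto
    show "equilibrium_state XF \<phi> \<mu>"
      unfolding \<mu> equilibrium_state_def P integral[OF inv] using inv conv_free_energy[OF s] by simp
  qed
qed

lemma no_adjacent_ones:
  assumes "b k = 2" "x \<in> XF" "x m"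
  shows "\<not> x (m + 1)"
proof
  assume "x (m + 1)"
  obtain r where r: "\<And>m. x m \<Longrightarrow> (r + m) mod 2 \<noteq> 0"
    using assms(1,2) unfolding free_subshift_iff by (metis of_nat_numeral)
  from r[OF assms(3)] r[OF \<open>x (m + 1)\<close>] show False by presburger
qed

text \<open>In the absence of adjacent ones the three cylinders are determined by the two separate symbols.
  The right-hand side differs from \<open>a00 + (a1 + a01 - 2 a00) x\<^sub>0\<close> by the coboundary
  \<open>(a01 - a00) (x\<^sub>1 - x\<^sub>0)\<close>.\<close>

lemma two_block_potential_linear:
  assumes "b k = 2" "x \<in> XF"
  shows "two_block_potential XF a00 a01 a1 x = a00 + (a1 - a00) * of_bool (x 0) + (a01 - a00) * of_bool (x 1)"
proof -
  have "\<not> (x 0 \<and> x 1)" using no_adjacent_ones[OF assms, of 0] by auto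
  moreover have "x \<in> cylinder XF [False, v] \<longleftrightarrow> \<not> x 0 \<and> x 1 = v" for v
    using assms(2) by (auto simp: cylinder_def less_Suc_eq)
  moreover have "x \<in> cylinder XF [True] \<longleftrightarrow> x 0"
    using assms(2) by (auto simp: cylinder_def)
  ultimately show ?thesis by (auto simp: two_block_potential_def indicator_def)
qed

lemma shift_funpow: "(shift ^^ i) x m = x (m + int i)"
  by (induction i arbitrary: m) (auto simp: shift_def algebra_simps)

lemma shift_funpow_free: "x \<in> XF \<Longrightarrow> (shift ^^ i) x \<in> XF"
  by (induction i) (auto intro: shift_in_free_subshift)

lemma birkhoff_two_block:
  assumes "b k = 2" "x \<in> XF"
  shows "\<bar>birkhoff_sum n (two_block_potential XF a00 a01 a1) x
    - (real n * a00 + (a1 + a01 - 2 * a00) * ones (window 0 n x))\<bar> \<le> \<bar>a01 - a00\<bar>"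
proof -
  have ones: "ones (window 0 n x) = (\<Sum>i<n. of_bool (x (int i)))"
    unfolding ones_def of_bool_def by (intro sum.cong) auto
  have "birkhoff_sum n (two_block_potential XF a00 a01 a1) x
      = (\<Sum>i<n. a00 + (a1 + a01 - 2 * a00) * of_bool (x (int i)) + (a01 - a00) * (of_bool (x (int (Suc i))) - of_bool (x (int i))))"
    unfolding birkhoff_sum_def two_block_potential_linear[OF assms(1) shift_funpow_free[OF assms(2)]]
    by (intro sum.cong refl) (simp add: shift_funpow algebra_simps)
  also have "\<dots> = real n * a00 + (a1 + a01 - 2 * a00) * ones (window 0 n x)
      + (a01 - a00) * (\<Sum>i<n. of_bool (x (int (Suc i))) - of_bool (x (int i)))"
    by (simp only: sum.distrib sum_distrib_left[symmetric] ones) simp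
  also have "(\<Sum>i<n. of_bool (x (int (Suc i))) - of_bool (x (int i)) :: real) = of_bool (x (int n)) - of_bool (x (int 0))"
    by (rule sum_lessThan_telescope)
  finally have "birkhoff_sum n (two_block_potential XF a00 a01 a1) x
      - (real n * a00 + (a1 + a01 - 2 * a00) * ones (window 0 n x)) = (a01 - a00) * (of_bool (x (int n)) - of_bool (x 0))"
    by simp
  then show ?thesis by (auto simp:)
qed

lemma integral_two_block:
  assumes "b k = 2" "\<mu> \<in> invariant_measures XF"
  shows "(\<integral>x. two_block_potential XF a00 a01 a1 x \<partial>\<mu>)
    = a00 + (a1 + a01 - 2 * a00) * measure \<mu> {x. window 0 1 x = [True]}"
proof -
  interpret free_measure b \<mu> by unfold_locales (rule assms(2))
  have int: "integrable \<mu> (\<lambda>x. of_bool (x m) :: real)" for m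
    unfolding of_bool_def by (rule integrable_const_bound[where B = 1]) (auto intro!: AE_I2)
  have rate: "(\<integral>x. of_bool (x m) \<partial>\<mu>) = measure \<mu> {x. window 0 1 x = [True]}" for m
  proof -
    have "(\<integral>x. of_bool (x m) \<partial>\<mu>) = (\<integral>x. indicator {x. window m 1 x = [True]} x \<partial>\<mu>)"
      by (intro Bochner_Integration.integral_cong refl) (auto simp: window_def)
    also have "\<dots> = measure \<mu> {x. window m 1 x = [True]}" by simp
    also have "\<dots> = measure \<mu> {x. window 0 1 x = [True]}" by (rule measure_window_eq_0[OF assms(2)])
    finally show ?thesis .
  qed
  have [measurable]: "cylinder XF w \<in> sets borel" for w
    unfolding cylinder_eq_window by measurable
  have "(\<integral>x. two_block_potential XF a00 a01 a1 x \<partial>\<mu>)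
      = (\<integral>x. a00 + (a1 - a00) * of_bool (x 0) + (a01 - a00) * of_bool (x 1) \<partial>\<mu>)"
  proof (rule integral_cong_AE)
    show "AE x in \<mu>. two_block_potential XF a00 a01 a1 x = a00 + (a1 - a00) * of_bool (x 0) + (a01 - a00) * of_bool (x 1)"
      using AE_free by eventually_elim (rule two_block_potential_linear[OF assms(1)])
  qed (simp_all add: two_block_potential_def of_bool_def)
  also have "\<dots> = a00 + (a1 - a00) * measure \<mu> {x. window 0 1 x = [True]} + (a01 - a00) * measure \<mu> {x. window 0 1 x = [True]}"
    using int by (simp add: rate prob_space)
  finally show ?thesis by (simp add: algebra_simps)
qed

end

theorem theorem1p2:
  fixes B :: "nat set" and b :: "nat \<Rightarrow> nat" and a00 a01 a1 p :: real
    and \<phi> :: "config \<Rightarrow> real"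
  assumes "B = range b" and "inj b"
    and "\<And>i. 2 \<le> b i"
    and "pairwise coprime B"
    and "summable (\<lambda>i. 1 / real (b i))"
    and "b 0 = 2"
    and "\<phi> = two_block_potential (free_subshift B) a00 a01 a1"
    and "p = 2 powr (2 * a00) / (2 powr (a1 + a01) + 2 powr (2 * a00))"
  shows "(\<forall>\<mu>. equilibrium_state (free_subshift B) \<phi> \<mu> \<longleftrightarrow>
            \<mu> = mult_convolution (mirsky_measure b) (bernoulli_measure p)) \<and>
         \<not> gibbs_measure (free_subshift B) \<phi>
            (mult_convolution (mirsky_measure b) (bernoulli_measure p))"
proof -
  interpret coprime_moduli b
  proof
    show "coprime (b i) (b j)" if "i \<noteq> j" for i j
      using assms(1,2,4) that by (auto simp: pairwise_def inj_def)
  qed (use assms in auto)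
  define s where "s = 1 - p"
  define A Q where "A = 2 powr (a1 + a01)" and "Q = 2 powr (2 * a00)"
  have pos: "0 < A" "0 < Q" by (simp_all add: A_def Q_def)
  have p: "p = Q / (A + Q)" using assms(8) by (simp add: A_def Q_def)
  have s_eq: "s = A / (A + Q)" using pos by (simp add: s_def p field_simps)
  have "1 - s = Q / (A + Q)" by (simp add: s_def p)
  with s_eq pos have s: "0 < s" "s < 1" and odds: "s / (1 - s) = A / Q"
    by simp_all
  have \<beta>: "log 2 (s / (1 - s)) = a1 + a01 - 2 * a00"
    unfolding odds A_def Q_def by (simp add: powr_diff[symmetric])
  have count: "\<bar>birkhoff_sum n \<phi> x - (real n * a00 + log 2 (s / (1 - s)) * ones (window 0 n x))\<bar> \<le> \<bar>a01 - a00\<bar>"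
    if "x \<in> XF" for n x
    unfolding \<beta> assms(7) assms(1) by (rule birkhoff_two_block[OF assms(6) that])
  have integral: "(\<integral>x. \<phi> x \<partial>\<mu>) = a00 + log 2 (s / (1 - s)) * measure \<mu> {x. window 0 1 x = [True]}"
    if "\<mu> \<in> invariant_measures XF" for \<mu>
    unfolding \<beta> assms(7) assms(1) by (rule integral_two_block[OF assms(6) that])
  have "p = 1 - s" by (simp add: s_def)
  then show ?thesis
    unfolding assms(1) using equilibrium_iff_conv[OF s count integral] conv_not_gibbs[OF s count] by simp
qed

end
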